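(* Let $\Delta\ge 2$ be a constant integer and let $\lambda>0$ be a constant with $\lambda<\frac{(\Delta-1)^{\Delta-1}}{(\Delta-2)^{\Delta}}$ (for $\Delta=2$ the right-hand side is interpreted as $+\infty$, so every $\lambda>0$ is allowed). Then there is an FPTAS that computes the hardcore partition function $Z(G)$ with activity $\lambda$ for hypergraphs $G$ of maximum degree $\Delta$.
   Context: A hypergraph $G=(V,\mathcal{E})$ has a finite vertex set $V$ and a set of hyperedges $\mathcal{E}\subseteq 2^V$ (hyperedges may have any size). The degree of a vertex is the number of hyperedges containing it; the maximum degree is the maximum over vertices. An independent set of $G$ is a set $I\subseteq V$ such that $e\not\subseteq I$ for every $e\in\mathcal{E}$. For an activity parameter $\lambda>0$, the hardcore partition function is $Z(G)=\sum_{I}\lambda^{|I|}$, the sum over all independent sets $I$ of $G$. An FPTAS (fully polynomial-time approximation scheme) is a deterministic algorithm that, given an instance $G$ with $n$ vertices and an accuracy parameter $0<\varepsilon<1$, outputs a number $\hat Z$ with $e^{-\varepsilon}\le Z(G)/\hat Z\le e^{\varepsilon}$ in time polynomial in $n$ and $1/\varepsilon$. *)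

theory Defs
  imports Complex_Main "HOL-Library.Log_Nat"
begin

section \<open>The hardcore model on hypergraphs\<close>

record 'a hypergraph =
  verts :: "'a set"
  edges :: "'a set set"

definition is_hypergraph :: "'a hypergraph \<Rightarrow> bool" where
  "is_hypergraph G \<longleftrightarrow> finite (verts G) \<and> edges G \<subseteq> Pow (verts G)"

definition degree :: "'a hypergraph \<Rightarrow> 'a \<Rightarrow> nat" where
  "degree G v = card {e \<in> edges G. v \<in> e}"

text \<open>Inserting 0 only matters for the hypergraphs without vertices.\<close>

definition max_degree :: "'a hypergraph \<Rightarrow> nat" where
  "max_degree G = Max (insert 0 (degree G ` verts G))"

definition independent :: "'a hypergraph \<Rightarrow> 'a set \<Rightarrow> bool" where
  "independent G I \<longleftrightarrow> I \<subseteq> verts G \<and> (\<forall>e\<in>edges G. \<not> e \<subseteq> I)"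

definition hardcore_Z :: "real \<Rightarrow> 'a hypergraph \<Rightarrow> real" where
  "hardcore_Z lam G = (\<Sum>I | independent G I. lam ^ card I)"


section \<open>Algorithms\<close>

text \<open>
  A program is a list of mutually recursive unary functions, called by position and
  evaluated call-by-value on binary trees with natural numbers at the leaves (0 doubles as the
  empty list). Arithmetic is charged the bit lengths of its operands and, queries apart, every other step 1, so
  the cost is polynomially related to the running time of a Turing machine that represents
  values as pointers into a shared heap.

  Real parameters are accessible only through rational approximations, as in the standard
  machine model of computable analysis: \<^term>\<open>Query r\<close> applied to \<^term>\<open>k\<close> returns an integer
  approximating the parameter times \<^term>\<open>2 ^ k\<close>, and is charged \<^term>\<open>k\<close> and the bit length
  of the answer. In particular nothing is assumed about the computability of the parameters.
\<close>

datatype val = Num nat | Pair val val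

datatype arith = Add | Sub | Mul | Div

datatype param = Activity | Accuracy

datatype expr =
    Var nat \<comment> \<open>de Bruijn index\<close>
  | Lit nat
  | Bind expr expr
  | Arith arith expr expr
  | IfZero expr expr expr
  | MkPair expr expr
  | Fst expr
  | Snd expr
  | Call nat expr
  | Query param expr

type_synonym prog = "expr list"

type_synonym access = "param \<Rightarrow> nat \<Rightarrow> nat"

fun apply_arith :: "arith \<Rightarrow> nat \<Rightarrow> nat \<Rightarrow> nat" where
  "apply_arith Add m n = m + n"
| "apply_arith Sub m n = m - n"
| "apply_arith Mul m n = m * n"
| "apply_arith Div m n = m div n"

abbreviation bits :: "nat \<Rightarrow> nat" where
  "bits n \<equiv> floorlog 2 n"

text \<open>\<^term>\<open>eval P acc env e v t\<close>: expression \<^term>\<open>e\<close> evaluates to \<^term>\<open>v\<close> at cost \<^term>\<open>t\<close>.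
  Ill-typed expressions and diverging ones have no value.\<close>

inductive eval :: "prog \<Rightarrow> access \<Rightarrow> val list \<Rightarrow> expr \<Rightarrow> val \<Rightarrow> nat \<Rightarrow> bool"
  for P :: prog and acc :: access where
  Var: "i < length env \<Longrightarrow> eval P acc env (Var i) (env ! i) 1"
| Lit: "eval P acc env (Lit n) (Num n) 1"
| Bind: "eval P acc env a u s \<Longrightarrow> eval P acc (u # env) b v t
    \<Longrightarrow> eval P acc env (Bind a b) v (1 + s + t)"
| Arith: "eval P acc env a (Num m) s \<Longrightarrow> eval P acc env b (Num n) t
    \<Longrightarrow> eval P acc env (Arith f a b) (Num (apply_arith f m n)) (1 + s + t + bits m + bits n)"
| IfZero_True: "eval P acc env c (Num 0) s \<Longrightarrow> eval P acc env a v t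
    \<Longrightarrow> eval P acc env (IfZero c a b) v (1 + s + t)"
| IfZero_False: "eval P acc env c u s \<Longrightarrow> u \<noteq> Num 0 \<Longrightarrow> eval P acc env b v t
    \<Longrightarrow> eval P acc env (IfZero c a b) v (1 + s + t)"
| MkPair: "eval P acc env a u s \<Longrightarrow> eval P acc env b v t
    \<Longrightarrow> eval P acc env (MkPair a b) (Pair u v) (1 + s + t)"
| Fst: "eval P acc env a (Pair u v) s \<Longrightarrow> eval P acc env (Fst a) u (1 + s)"
| Snd: "eval P acc env a (Pair u v) s \<Longrightarrow> eval P acc env (Snd a) v (1 + s)"
| Call: "f < length P \<Longrightarrow> eval P acc env a u s \<Longrightarrow> eval P acc [u] (P ! f) v t
    \<Longrightarrow> eval P acc env (Call f a) v (1 + s + t)"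
| Query: "eval P acc env a (Num k) s
    \<Longrightarrow> eval P acc env (Query r a) (Num (acc r k)) (1 + s + k + bits (acc r k))"

lemma eval_deterministic:
  assumes "eval P acc env e v t" "eval P acc env e v' t'"
  shows "v' = v \<and> t' = t"
  using assms
proof (induction arbitrary: v' t' rule: eval.induct)
  case Var then show ?case by (auto elim: eval.cases)
next
  case Lit then show ?case by (auto elim: eval.cases)
next
  case Bind from Bind.prems Bind.IH show ?case by (cases rule: eval.cases) blast
next
  case Arith from Arith.prems Arith.IH show ?case by (cases rule: eval.cases) blast
next
  case IfZero_True from IfZero_True.prems IfZero_True.IH show ?case
    by (cases rule: eval.cases) blast+
next
  case IfZero_False from IfZero_False.prems IfZero_False.IH IfZero_False.hyps show ?case
    by (cases rule: eval.cases) blast+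
next
  case MkPair from MkPair.prems MkPair.IH show ?case by (cases rule: eval.cases) blast
next
  case Fst from Fst.prems Fst.IH show ?case by (cases rule: eval.cases) blast
next
  case Snd from Snd.prems Snd.IH show ?case by (cases rule: eval.cases) blast
next
  case Call from Call.prems Call.IH show ?case by (cases rule: eval.cases) blast
next
  case Query from Query.prems Query.IH show ?case by (cases rule: eval.cases) blast
qed

definition runs :: "prog \<Rightarrow> access \<Rightarrow> val \<Rightarrow> val \<Rightarrow> nat \<Rightarrow> bool" where
  "runs P acc x y t \<longleftrightarrow> eval P acc [x] (Call 0 (Var 0)) y t"

fun val_of_list :: "val list \<Rightarrow> val" where
  "val_of_list [] = Num 0"
| "val_of_list (x # xs) = Pair x (val_of_list xs)"

text \<open>Vertices are numbered from 0; the order in which hyperedges and their elements are listed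
  is arbitrary.\<close>

definition encodes :: "val \<Rightarrow> nat hypergraph \<Rightarrow> bool" where
  "encodes x G \<longleftrightarrow> (\<exists>n es. verts G = {..<n} \<and> edges G = set ` set es \<and>
     distinct (map set es) \<and> (\<forall>e\<in>set es. distinct e) \<and>
     x = Pair (Num n) (val_of_list (map (\<lambda>e. val_of_list (map Num e)) es)))"

definition approximates :: "(nat \<Rightarrow> nat) \<Rightarrow> real \<Rightarrow> bool" where
  "approximates f r \<longleftrightarrow> (\<forall>k. \<bar>real (f k) / 2 ^ k - r\<bar> \<le> 1 / 2 ^ k)"


section \<open>Approximation schemes\<close>

text \<open>If the empty set is a hyperedge, then \<^term>\<open>Z = 0\<close> and no ratio with \<^term>\<open>Z\<close> is positive;
  only the exact output 0 is then accepted.\<close>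

definition within_accuracy :: "real \<Rightarrow> real \<Rightarrow> real \<Rightarrow> bool" where
  "within_accuracy eps Z Z' \<longleftrightarrow>
     (if Z = 0 then Z' = 0 else exp (- eps) \<le> Z / Z' \<and> Z / Z' \<le> exp eps)"

text \<open>The program may depend on the constant \<^term>\<open>a\<close>, but not on the accuracy. It outputs
  numerator and denominator of a rational number.\<close>

definition is_fptas :: "real \<Rightarrow> (nat hypergraph \<Rightarrow> bool) \<Rightarrow> (nat hypergraph \<Rightarrow> real) \<Rightarrow> prog \<Rightarrow> bool" where
  "is_fptas a C F P \<longleftrightarrow> (\<exists>(c::real) (d::nat). \<forall>G x eps acc.
     C G \<and> encodes x G \<and> 0 < eps \<and> eps < 1 \<and>
     approximates (acc Activity) a \<and> approximates (acc Accuracy) eps \<longrightarrow>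
     (\<exists>p q t. runs P acc x (Pair (Num p) (Num q)) t \<and> q > 0 \<and>
        within_accuracy eps (F G) (real p / real q) \<and>
        real t \<le> c * (real (card (verts G)) + 1 / eps) ^ d))"

end

theory Submission
  imports Defs "HOL-Analysis.Convex"
begin

text \<open>
  The partition function telescopes into the conditional probabilities that vertex \<open>v\<close> is occupied
  once the earlier vertices are unoccupied, and these satisfy a tree recursion: the odds of \<open>v\<close> are
  \<open>\<lambda> \<Prod>\<^sub>i (1 - \<Prod>\<^sub>j y\<^sub>i\<^sub>j)\<close>, where \<open>i\<close> ranges over the hyperedges through \<open>v\<close> and \<open>y\<^sub>i\<^sub>j\<close> is the
  probability of the \<open>j\<close>-th remaining vertex of the \<open>i\<close>-th hyperedge, conditioned on the previous ones
  being occupied. Write every probability as \<open>tanh\<^sup>2 s\<close>.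

  In these coordinates the product over one hyperedge is nonexpansive for the supremum distance, and
  the vertex map \<open>sinh s = sqrt \<lambda> / \<Prod>\<^sub>i cosh \<sigma>\<^sub>i\<close> has the partial derivatives \<open>- tanh s tanh \<sigma>\<^sub>i\<close>. By
  AM-GM, \<open>tanh s \<Sum>\<^sub>i tanh \<sigma>\<^sub>i\<close> is bounded away from 1 exactly below the critical activity. As
  \<open>tanh \<sigma>\<^sub>i\<close> is exponentially small in the size \<open>w\<close> of the hyperedge, the contraction survives when the
  recursion depth available to the vertices of this hyperedge is lowered by \<open>w\<close> instead of 1. This makes
  the truncated tree of depth \<open>L\<close> have fewer than \<open>(\<Delta> + 2)\<^sup>L\<close> inner nodes although hyperedges are unbounded, and
  \<open>L = O(log (n / \<epsilon>))\<close> suffices. All arithmetic is exact on fractions; only \<open>\<lambda>\<close> is replaced by a rational.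
\<close>

section \<open>Contraction in hyperbolic coordinates\<close>

text \<open>Write \<open>d\<close> for \<open>\<Delta> - 1\<close>. A vertex reached through a
  hyperedge no longer counts that hyperedge, so it meets at most \<open>d\<close> others; for
  \<open>d > 1\<close> the critical activity is \<open>d ^ d / (d - 1) ^ (d + 1)\<close>. Only the
  vertices at which the partition function is telescoped can still meet \<open>d + 1\<close>
  hyperedges. There contraction may fail, but the error grows by a factor of at most
  \<open>d + 1\<close>, once per vertex and not once per level. Three obstacles shape the rest.
  Shrinking can make different hyperedges coincide, so they are kept in lists with multiplicity. A
  vertex that is a hyperedge by itself cannot be conditioned to be occupied; the recursion has to
  give it probability exactly 0 at every depth, so that the meaningless factors after it are
  multiplied by 0. Finally, the activity is known only approximately, so the constants are fixed for
  an upper bound \<open>lam1\<close> strictly between the activity and the threshold, which also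
  bounds the rational replacement. As fractions are never reduced, the size of the tree bounds their
  bit lengths too.\<close>

lemma AM_GM_power:
  fixes a :: "'a \<Rightarrow> real"
  assumes "finite S" and "\<And>i. i \<in> S \<Longrightarrow> 0 \<le> a i" and "0 \<le> m" and "(\<Sum>i\<in>S. a i) \<le> real (card S) * m"
  shows "(\<Prod>i\<in>S. a i) \<le> m ^ card S"
proof (cases "m = 0")
  case True
  then have "\<forall>i\<in>S. a i = 0"
    using assms sum_nonneg_eq_0_iff[of S a] sum_nonneg[of S a] by simp
  then show ?thesis
    using True assms(1) by (cases "S = {}") (auto simp: prod_eq_1_iff)
next
  case False
  then have m: "m > 0" using assms by simp
  \<comment> \<open>The tangent bound \<open>1 + t \<le> exp t\<close>; in the product the exponents
    add up to a nonpositive number.\<close>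
  have "a i \<le> m * exp (a i / m - 1)" for i
    using exp_ge_add_one_self[of "a i / m - 1"] m by (simp add: field_simps)
  then have "(\<Prod>i\<in>S. a i) \<le> (\<Prod>i\<in>S. m * exp (a i / m - 1))"
    by (intro prod_mono) (auto simp: assms)
  also have "\<dots> = m ^ card S * exp ((\<Sum>i\<in>S. a i) / m - card S)"
    using assms(1) by (simp add: prod.distrib exp_sum[symmetric] sum_subtractf sum_divide_distrib)
  also have "\<dots> \<le> m ^ card S * 1"
    using m assms(4) by (intro mult_left_mono) (auto simp: field_simps)
  finally show ?thesis by simp
qed

text \<open>With \<open>x\<close> the squared \<open>sinh\<close> of the vertex coordinate,
  \<open>x / (1 + x)\<close> is its squared \<open>tanh\<close>, so the left side is the squared
  total derivative. Cauchy-Schwarz replaces the squared sum by \<open>c + 1\<close>, AM-GM gives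
  \<open>x * c \<le> rho\<close>, and \<open>(rho + x) / (1 + x)\<close> grows with
  \<open>x\<close>.\<close>

lemma contraction_bound:
  fixes u :: "nat \<Rightarrow> real" and d :: nat
  assumes d: "1 \<le> d" and lam: "0 < lam" "lam \<le> lam1" and rho: "0 \<le> rho" "rho \<le> 1"
    and crit: "lam1 * (real d - 1) ^ (d + 1) \<le> rho * real d ^ d"
    and r: "r \<le> d" and u: "\<And>i. i < r \<Longrightarrow> 0 \<le> u i \<and> u i < 1"
    and x: "x = lam * (\<Prod>i<r. 1 - (u i)\<^sup>2)"
  shows "(\<Sum>i<r. u i)\<^sup>2 * (x / (1 + x)) \<le> (rho + lam1) / (1 + lam1)"
proof -
  \<comment> \<open>Padding by 0 changes neither the sum nor the product and leaves exactly
    \<open>d\<close> numbers.\<close>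
  define v where "v i = (if i < r then u i else 0)" for i
  define a where "a i = 1 - (v i)\<^sup>2" for i
  have v: "0 \<le> v i" "v i < 1" for i
    using u by (auto simp: v_def)
  have a: "0 < a i" "a i \<le> 1" for i
    using v[of i] by (auto simp: a_def abs_square_less_1)
  have split: "{..<d} = {..<r} \<union> {r..<d}" using r by auto
  have su: "(\<Sum>i<r. u i) = (\<Sum>i<d. v i)"
    unfolding split by (subst sum.union_disjoint) (auto simp: v_def)
  have pu: "(\<Prod>i<r. 1 - (u i)\<^sup>2) = (\<Prod>i<d. a i)"
    unfolding split by (subst prod.union_disjoint) (auto simp: v_def a_def)
  define c where "c = real d * (\<Sum>i<d. (v i)\<^sup>2) - 1"
  have prod_a: "0 < (\<Prod>i<d. a i)" "(\<Prod>i<d. a i) \<le> 1"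
    using a less_imp_le[OF a(1)] by (auto intro: prod_pos prod_le_1)
  have x0: "0 < x" "x \<le> lam1"
  proof -
    show "0 < x" unfolding x pu using prod_a lam by simp
    have "x \<le> lam * 1" unfolding x pu using prod_a lam by (intro mult_left_mono) auto
    then show "x \<le> lam1" using lam by simp
  qed
  have xc: "x * c \<le> rho"
  proof (cases "c \<le> 0")
    case True
    then show ?thesis using x0 rho by (meson mult_nonneg_nonpos order_trans less_imp_le)
  next
    case False
    \<comment> \<open>The \<open>d\<close> numbers \<open>d * a i\<close> together with
      \<open>c\<close> have the sum \<open>d * d - 1\<close> whatever \<open>v\<close> is. Their
      mean is \<open>d - 1\<close>, which is how the threshold enters.\<close>
    define b where "b i = (if i < d then real d * a i else c)" for i
    have sb: "(\<Sum>i<d. real d * a i) = real d * real d - real d * (\<Sum>i<d. (v i)\<^sup>2)"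
      by (simp add: a_def sum_subtractf algebra_simps flip: sum_distrib_left)
    have "(\<Prod>i\<in>{..d}. b i) \<le> (real d - 1) ^ card {..d}"
    proof (rule AM_GM_power)
      show "0 \<le> b i" if "i \<in> {..d}" for i
        using False a[of i] by (auto simp: b_def)
      have "(\<Sum>i\<in>{..d}. b i) = (\<Sum>i<d. real d * a i) + c"
        unfolding lessThan_Suc_atMost[symmetric] by (simp add: b_def)
      also have "\<dots> = real d * real d - 1"
        unfolding sb c_def by simp
      finally show "(\<Sum>i\<in>{..d}. b i) \<le> real (card {..d}) * (real d - 1)"
        using d by (simp add: algebra_simps)
    qed (use d in auto)
    moreover have "(\<Prod>i\<in>{..d}. b i) = real d ^ d * (\<Prod>i<d. a i) * c"
      unfolding lessThan_Suc_atMost[symmetric] by (simp add: b_def prod.distrib)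
    ultimately have "lam1 * (real d ^ d * (\<Prod>i<d. a i) * c) \<le> rho * real d ^ d"
      using crit lam by (smt (verit) card_atMost Suc_eq_plus1 mult_left_mono)
    then have "real d ^ d * (lam1 * (\<Prod>i<d. a i) * c) \<le> real d ^ d * rho"
      by (simp add: mult_ac)
    then have "lam1 * (\<Prod>i<d. a i) * c \<le> rho"
      using d by (simp add: mult_le_cancel_left_pos)
    moreover have "x * c \<le> lam1 * (\<Prod>i<d. a i) * c"
      unfolding x pu using lam prod_a False by (intro mult_right_mono) auto
    ultimately show ?thesis by simp
  qed
  have "(\<Sum>i<r. u i)\<^sup>2 \<le> (\<Sum>i<d. (v i)\<^sup>2) * card {..<d}"
    unfolding su by (rule sum_squared_le_sum_of_squares)
  then have "(\<Sum>i<r. u i)\<^sup>2 * x \<le> (c + 1) * x"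
    using x0 by (intro mult_right_mono) (auto simp: c_def mult_ac)
  also have "\<dots> \<le> rho + x" using xc by (simp add: algebra_simps)
  finally have "(\<Sum>i<r. u i)\<^sup>2 * (x / (1 + x)) \<le> (rho + x) / (1 + x)"
    using x0 by (simp add: divide_simps)
  also have "\<dots> \<le> (rho + lam1) / (1 + lam1)"
  proof -
    have "(1 - rho) * x \<le> (1 - rho) * lam1" using x0 rho by (intro mult_left_mono) auto
    then show ?thesis using x0 by (simp add: divide_simps algebra_simps)
  qed
  finally show ?thesis .
qed

section \<open>The vertex map and its Lipschitz bound\<close>

text \<open>The coordinate of a vertex as a function of the coordinates of its hyperedges.\<close>

definition level :: "real \<Rightarrow> nat \<Rightarrow> (nat \<Rightarrow> real) \<Rightarrow> real" where
  "level lam r \<sigma> = arsinh (sqrt lam / (\<Prod>i<r. cosh (\<sigma> i)))"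

lemma one_minus_tanh_sq: "1 - (tanh x)\<^sup>2 = 1 / (cosh x)\<^sup>2" for x :: real
proof -
  have "1 - (tanh x)\<^sup>2 = ((cosh x)\<^sup>2 - (sinh x)\<^sup>2) / (cosh x)\<^sup>2"
    by (simp add: tanh_def power_divide diff_divide_distrib)
  then show ?thesis by (simp add: cosh_square_eq)
qed

lemma tanh_sq_eq: "(tanh x)\<^sup>2 = (sinh x)\<^sup>2 / (1 + (sinh x)\<^sup>2)" for x :: real
  using cosh_square_eq[of x] by (simp add: tanh_def power_divide)

lemma sinh_level_sq:
  assumes "0 < lam"
  shows "(sinh (level lam r \<sigma>))\<^sup>2 = lam * (\<Prod>i<r. 1 - (tanh (\<sigma> i))\<^sup>2)"
  using assms by (simp add: level_def one_minus_tanh_sq power_divide prod_dividef prod_power_distrib)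

lemma level_pos: "0 < lam \<Longrightarrow> 0 < level lam r \<sigma>"
  by (simp add: level_def prod_pos)

text \<open>The form to differentiate: the derivative of \<open>ln (cosh y)\<close> is
  \<open>tanh y\<close>.\<close>

lemma level_eq_exp: "level lam r \<sigma> = arsinh (sqrt lam * exp (- (\<Sum>i<r. ln (cosh (\<sigma> i)))))"
  by (simp add: level_def exp_minus exp_sum divide_inverse)

text \<open>The box of admissible coordinates is convex because \<open>tanh\<close> is monotone, so
  the intermediate point of the mean value theorem stays inside.\<close>

lemma tanh_between:
  fixes a b \<theta> :: real
  assumes "0 \<le> \<theta>" "\<theta> \<le> 1" "0 \<le> a" "0 \<le> b" "tanh a \<le> u" "tanh b \<le> u"
  shows "0 \<le> a + \<theta> * (b - a) \<and> tanh (a + \<theta> * (b - a)) \<le> u"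
proof -
  have e: "a + \<theta> * (b - a) = (1 - \<theta>) * a + \<theta> * b" by (simp add: algebra_simps)
  have "(1 - \<theta>) * a + \<theta> * b \<le> (1 - \<theta>) * max a b + \<theta> * max a b"
    using assms by (intro add_mono mult_left_mono) auto
  then have "a + \<theta> * (b - a) \<le> max a b" unfolding e by (simp add: algebra_simps)
  then have "tanh (a + \<theta> * (b - a)) \<le> tanh (max a b)" by simp
  also have "\<dots> \<le> u" using assms by (simp add: max_def)
  finally show ?thesis using assms unfolding e by auto
qed

text \<open>Mean value theorem on the segment from \<open>\<sigma>\<close> to \<open>\<tau>\<close>.
  The intermediate point is unknown, so \<open>bound\<close> is required on the whole box; the
  individual \<open>D i\<close> allow a different error for every hyperedge.\<close>

lemma level_lipschitz:
  assumes lam: "0 < lam"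
    and nonneg: "\<And>i. i < r \<Longrightarrow> 0 \<le> \<sigma> i \<and> 0 \<le> \<tau> i"
    and le: "\<And>i. i < r \<Longrightarrow> tanh (\<sigma> i) \<le> u i \<and> tanh (\<tau> i) \<le> u i"
    and dist: "\<And>i. i < r \<Longrightarrow> \<bar>\<tau> i - \<sigma> i\<bar> \<le> D i"
    and bound: "\<And>\<xi>. (\<And>i. i < r \<Longrightarrow> 0 \<le> \<xi> i \<and> tanh (\<xi> i) \<le> u i) \<Longrightarrow>
      tanh (level lam r \<xi>) * (\<Sum>i<r. tanh (\<xi> i) * D i) \<le> B"
  shows "\<bar>level lam r \<tau> - level lam r \<sigma>\<bar> \<le> B"
proof -
  define \<xi> where "\<xi> \<theta> i = \<sigma> i + \<theta> * (\<tau> i - \<sigma> i)" for \<theta> i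
  define f where "f \<theta> = level lam r (\<xi> \<theta>)" for \<theta>
  define G where "G \<theta> = (\<Sum>i<r. ln (cosh (\<xi> \<theta> i)))" for \<theta>
  define G' where "G' \<theta> = (\<Sum>i<r. tanh (\<xi> \<theta> i) * (\<tau> i - \<sigma> i))" for \<theta>
  have G: "(G has_real_derivative G' \<theta>) (at \<theta>)" for \<theta>
    unfolding G_def G'_def \<xi>_def
    by (rule DERIV_sum) (auto intro!: derivative_eq_intros simp: tanh_def)
  have f_eq: "f = (\<lambda>\<theta>. arsinh (sqrt lam * exp (- G \<theta>)))"
    by (simp add: f_def G_def level_eq_exp fun_eq_iff)
  have der: "(f has_real_derivative - (tanh (f \<theta>) * G' \<theta>)) (at \<theta>)" for \<theta>
  proof -
    have "(f has_real_derivative (1 / sqrt ((sqrt lam * exp (- G \<theta>))\<^sup>2 + 1)) * (sqrt lam * (exp (- G \<theta>) * - G' \<theta>))) (at \<theta>)"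
      unfolding f_eq
      by (intro DERIV_chain2[OF arsinh_real_has_field_derivative] DERIV_cmult DERIV_fun_exp DERIV_minus G)
    moreover have "tanh (f \<theta>) = sqrt lam * exp (- G \<theta>) / sqrt ((sqrt lam * exp (- G \<theta>))\<^sup>2 + 1)"
      by (simp add: f_eq tanh_def cosh_arsinh_real)
    ultimately show ?thesis by (simp add: mult_ac)
  qed
  obtain z where z: "0 < z" "z < 1" "f 1 - f 0 = (1 - 0) * - (tanh (f z) * G' z)"
    using MVT2[of 0 1 f "\<lambda>\<theta>. - (tanh (f \<theta>) * G' \<theta>)"] der by auto
  have \<xi>: "0 \<le> \<xi> z i \<and> tanh (\<xi> z i) \<le> u i" if "i < r" for i
    unfolding \<xi>_def using tanh_between[of z "\<sigma> i" "\<tau> i" "u i"] nonneg[OF that] le[OF that] z by auto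
  have "\<bar>f 1 - f 0\<bar> = tanh (f z) * \<bar>G' z\<bar>"
    using z level_pos[OF lam, of r "\<xi> z"] by (simp add: abs_mult f_def)
  also have "\<bar>G' z\<bar> \<le> (\<Sum>i<r. tanh (\<xi> z i) * D i)"
    unfolding G'_def
  proof (intro order_trans[OF sum_abs] sum_mono)
    fix i assume "i \<in> {..<r}"
    then show "\<bar>tanh (\<xi> z i) * (\<tau> i - \<sigma> i)\<bar> \<le> tanh (\<xi> z i) * D i"
      using \<xi>[of i] dist[of i] by (auto simp: abs_mult intro!: mult_left_mono)
  qed
  then have "tanh (f z) * \<bar>G' z\<bar> \<le> tanh (f z) * (\<Sum>i<r. tanh (\<xi> z i) * D i)"
    using level_pos[OF lam, of r "\<xi> z"] by (intro mult_left_mono) (auto simp: f_def)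
  also have "\<dots> \<le> B"
    unfolding f_def using bound[OF \<xi>] by simp
  finally have "\<bar>f 1 - f 0\<bar> \<le> B" .
  moreover have "\<xi> 1 = \<tau>" "\<xi> 0 = \<sigma>" by (auto simp: \<xi>_def)
  ultimately show ?thesis by (simp add: f_def)
qed

section \<open>Nonexpansiveness of products over a hyperedge\<close>

text \<open>For \<open>E = tanh \<delta>\<close> this says that \<open>artanh p\<close> and \<open>artanh q\<close> differ by at most \<open>\<delta>\<close>, in a form
  that also makes sense for \<open>p = 1\<close>, the empty product.\<close>

definition close :: "real \<Rightarrow> real \<Rightarrow> real \<Rightarrow> bool" where
  "close E p q \<longleftrightarrow> q * (1 + p * E) \<le> p + E \<and> p * (1 + q * E) \<le> q + E"

text \<open>For \<open>E < 1\<close>, shifting a coordinate by \<open>artanh E\<close> sends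
  \<open>a\<close> to \<open>(a + E) / (1 + a * E)\<close>. The product of two shifted values is at
  most the shifted product, since after cross-multiplication the difference is a visibly nonnegative
  polynomial. Hence the error does not grow with the number of factors.\<close>

lemma close_mult_aux:
  fixes a b a' b' E :: real
  assumes "0 \<le> a" "a \<le> 1" "0 \<le> b" "b \<le> 1" "0 \<le> a'" "0 \<le> b'" "0 \<le> E" "E \<le> 1"
    and "a' * (1 + a * E) \<le> a + E" "b' * (1 + b * E) \<le> b + E"
  shows "a' * b' * (1 + a * b * E) \<le> a * b + E"
proof -
  have pos: "0 < (1 + a * E) * (1 + b * E)" "0 < 1 + a * b * E"
    using assms by (auto intro!: mult_pos_pos add_pos_nonneg)
  have "(a' * (1 + a * E)) * (b' * (1 + b * E)) \<le> (a + E) * (b + E)"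
    using assms by (intro mult_mono) auto
  then have "(a' * b' * (1 + a * b * E)) * ((1 + a * E) * (1 + b * E)) \<le> (a + E) * (b + E) * (1 + a * b * E)"
    using pos by (simp add: mult_ac mult_right_mono)
  also have "\<dots> \<le> (a * b + E) * ((1 + a * E) * (1 + b * E))"
  proof -
    have "(a * b + E) * ((1 + a * E) * (1 + b * E)) - (a + E) * (b + E) * (1 + a * b * E)
        = E * (1 - E) * ((1 - a * b) * ((1 - a) * (1 - b)))"
      by (simp add: algebra_simps)
    moreover have "a * b \<le> 1" using assms by (simp add: mult_le_one)
    ultimately show ?thesis using assms
      by (smt (verit) mult_nonneg_nonneg)
  qed
  finally show ?thesis using pos by (simp add: mult_le_cancel_right_pos)
qed

lemma close_mult:
  assumes "close E p q" "close E p' q'"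
    and "0 \<le> p" "p \<le> 1" "0 \<le> q" "q \<le> 1" "0 \<le> p'" "p' \<le> 1" "0 \<le> q'" "q' \<le> 1" "0 \<le> E" "E \<le> 1"
  shows "close E (p * p') (q * q')"
  using assms close_mult_aux[of p p' q q' E] close_mult_aux[of q q' p p' E] by (simp add: close_def)

lemma close_refl: "0 \<le> p \<Longrightarrow> p \<le> 1 \<Longrightarrow> 0 \<le> E \<Longrightarrow> close E p p"
  using mult_le_one[of p p] mult_right_mono[of "p * p" 1 E] by (simp add: close_def algebra_simps)

lemma close_tanh_iff:
  fixes \<sigma> \<tau> \<delta> :: real
  assumes "0 \<le> \<sigma>" "0 \<le> \<tau>" "0 \<le> \<delta>"
  shows "close (tanh \<delta>) (tanh \<sigma>) (tanh \<tau>) \<longleftrightarrow> \<bar>\<sigma> - \<tau>\<bar> \<le> \<delta>"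
proof -
  have "tanh b * (1 + tanh a * tanh \<delta>) \<le> tanh a + tanh \<delta> \<longleftrightarrow> b \<le> a + \<delta>" if "0 \<le> a" for a b
  proof -
    have "0 < 1 + tanh a * tanh \<delta>" using that assms by (simp add: add_pos_nonneg)
    moreover have "tanh (a + \<delta>) = (tanh a + tanh \<delta>) / (1 + tanh a * tanh \<delta>)"
      by (simp add: tanh_add)
    ultimately have "tanh b * (1 + tanh a * tanh \<delta>) \<le> tanh a + tanh \<delta> \<longleftrightarrow> tanh b \<le> tanh (a + \<delta>)"
      by (simp only: pos_le_divide_eq)
    then show ?thesis by simp
  qed
  then show ?thesis using assms by (auto simp: close_def)
qed

lemma obtain_artanh:
  fixes p :: real
  assumes "0 \<le> p" "p < 1"
  obtains \<sigma> where "0 \<le> \<sigma>" "tanh \<sigma> = p"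
proof
  define \<sigma> where "\<sigma> = arsinh (p / sqrt (1 - p\<^sup>2))"
  have p: "p\<^sup>2 < 1" using assms by (simp add: abs_square_less_1)
  show "0 \<le> \<sigma>" using assms p arsinh_real_neg_iff[of "p / sqrt (1 - p\<^sup>2)"] unfolding \<sigma>_def
    by (smt (verit) divide_nonneg_nonneg real_sqrt_ge_zero)
  then have "0 \<le> tanh \<sigma>" by simp
  moreover have "(tanh \<sigma>)\<^sup>2 = p\<^sup>2"
    using p by (simp add: tanh_sq_eq \<sigma>_def power_divide field_simps)
  ultimately show "tanh \<sigma> = p" using assms by simp
qed

text \<open>The budget spent on a hyperedge may be linear in its size, since its influence decays
  geometrically in the size.\<close>

lemma geometric_slack:
  fixes \<gamma> \<eta> :: real
  assumes "0 < \<gamma>" "\<gamma> < 1" "0 < \<eta>"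
  obtains \<alpha> where "0 < \<alpha>" "\<alpha> < 1" "\<And>w. \<gamma> ^ w * (1 / \<alpha>) ^ w \<le> 1"
    "\<And>u w. 0 \<le> u \<Longrightarrow> u \<le> \<gamma> ^ w \<Longrightarrow> u * (1 / \<alpha>) ^ w \<le> u + \<eta>"
proof -
  define g where "g = (1 + \<gamma>) / 2"
  have g: "0 < g" "g < 1" "\<gamma> < g" using assms by (auto simp: g_def)
  \<comment> \<open>\<open>\<beta>\<close> is \<open>1 / \<alpha>\<close>. The first bound keeps
    \<open>\<gamma> * \<beta>\<close> at most \<open>g < 1\<close>. The second makes the overshoot
    small: \<open>\<gamma> ^ w * (\<beta> ^ w - 1)\<close> is at most
    \<open>(\<beta> - 1) * w * g ^ w\<close>, and \<open>w * g ^ w\<close> is at most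
    \<open>1 / (1 - g)\<close> for all \<open>w\<close>.\<close>
  define \<beta> where "\<beta> = min (g / \<gamma>) (1 + \<eta> * (1 - g))"
  have \<beta>: "1 < \<beta>" "\<gamma> * \<beta> \<le> g" "\<beta> - 1 \<le> \<eta> * (1 - g)"
    using assms g by (auto simp: \<beta>_def min_def field_simps split: if_splits)
  have pow: "\<beta> ^ w - 1 \<le> (\<beta> - 1) * (real w * \<beta> ^ w)" for w
  proof (induction w)
    case (Suc w)
    have "\<beta> ^ Suc w - 1 = (\<beta> ^ w - 1) + (\<beta> - 1) * \<beta> ^ w" by (simp add: algebra_simps)
    also have "\<dots> \<le> (\<beta> - 1) * (real w * \<beta> ^ w) + (\<beta> - 1) * \<beta> ^ w" using Suc by simp
    also have "\<dots> = (\<beta> - 1) * (real (Suc w) * \<beta> ^ w)" by (simp add: algebra_simps)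
    also have "\<dots> \<le> (\<beta> - 1) * (real (Suc w) * \<beta> ^ Suc w)"
      using \<beta>(1) by (intro mult_left_mono) (auto simp: power_increasing)
    finally show ?case .
  qed simp
  have wg: "real w * g ^ w \<le> 1 / (1 - g)" for w
  proof -
    have "real w * g ^ w = (\<Sum>i<w. g ^ w)" by simp
    also have "\<dots> \<le> (\<Sum>i<w. g ^ i)"
      using g by (intro sum_mono power_decreasing) auto
    also have "\<dots> = (1 - g ^ w) / (1 - g)"
      using g by (simp add: sum_gp_strict)
    also have "\<dots> \<le> 1 / (1 - g)" using g by (simp add: divide_right_mono)
    finally show ?thesis .
  qed
  have g2: "\<gamma> ^ w * \<beta> ^ w \<le> g ^ w" for w
    using \<beta> assms by (auto simp: power_mult_distrib[symmetric] intro!: power_mono)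
  show ?thesis
  proof (rule that[of "1 / \<beta>"])
    show "0 < 1 / \<beta>" "1 / \<beta> < 1" using \<beta> by auto
    show "\<gamma> ^ w * (1 / (1 / \<beta>)) ^ w \<le> 1" for w
      using g2[of w] g power_le_one[of g w] by simp
    show "u * (1 / (1 / \<beta>)) ^ w \<le> u + \<eta>" if "0 \<le> u" "u \<le> \<gamma> ^ w" for u w
    proof -
      have "u * (\<beta> ^ w - 1) \<le> \<gamma> ^ w * (\<beta> ^ w - 1)"
        using that \<beta> by (intro mult_right_mono) (auto simp: one_le_power)
      also have "\<dots> \<le> \<gamma> ^ w * ((\<beta> - 1) * (real w * \<beta> ^ w))"
        using pow assms by (intro mult_left_mono) auto
      also have "\<dots> = (\<beta> - 1) * real w * (\<gamma> ^ w * \<beta> ^ w)" by simp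
      also have "\<dots> \<le> (\<beta> - 1) * real w * g ^ w"
        using \<beta> g2 by (intro mult_left_mono) auto
      also have "\<dots> = (\<beta> - 1) * (real w * g ^ w)" by simp
      also have "\<dots> \<le> (\<beta> - 1) * (1 / (1 - g))"
        using \<beta> wg by (intro mult_left_mono) auto
      also have "\<dots> \<le> \<eta>" using \<beta> g by (simp add: field_simps)
      finally show ?thesis by (simp add: algebra_simps)
    qed
  qed
qed

section \<open>Weights of lists of hyperedges\<close>

text \<open>Lists keep the multiplicity of coinciding hyperedges, so degrees add up when a list is
  split, while the weight depends only on the underlying sets.\<close>

definition indep_sets :: "'a set \<Rightarrow> 'a list list \<Rightarrow> 'a set set" where
  "indep_sets V ES = {I. I \<subseteq> V \<and> (\<forall>e\<in>set ES. \<not> set e \<subseteq> I)}"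

definition weight :: "real \<Rightarrow> 'a set \<Rightarrow> 'a list list \<Rightarrow> real" where
  "weight lam V ES = (\<Sum>I\<in>indep_sets V ES. lam ^ card I)"

definition weight_containing :: "real \<Rightarrow> 'a list \<Rightarrow> 'a set \<Rightarrow> 'a list list \<Rightarrow> real" where
  "weight_containing lam e V ES = (\<Sum>I | I \<in> indep_sets V ES \<and> set e \<subseteq> I. lam ^ card I)"

text \<open>Conditioning a vertex to be occupied shrinks the hyperedges through it, conditioning it to
  be unoccupied removes them.\<close>

definition shrink :: "'a \<Rightarrow> 'a list list \<Rightarrow> 'a list list" where
  "shrink v ES = map (removeAll v) ES"

definition touched :: "'a \<Rightarrow> 'a list list \<Rightarrow> 'a list list" where
  "touched v ES = map (removeAll v) (filter (\<lambda>e. v \<in> set e) ES)"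

definition avoiding :: "'a \<Rightarrow> 'a list list \<Rightarrow> 'a list list" where
  "avoiding v ES = filter (\<lambda>e. v \<notin> set e) ES"

definition deg :: "'a \<Rightarrow> 'a list list \<Rightarrow> nat" where
  "deg v ES = length (filter (\<lambda>e. v \<in> set e) ES)"

text \<open>Independent sets containing \<open>v\<close> correspond, after removal of
  \<open>v\<close>, to independent sets for the shrunken hyperedges; hence this is the probability
  that \<open>v\<close> is occupied.\<close>

definition occupied :: "real \<Rightarrow> 'a \<Rightarrow> 'a set \<Rightarrow> 'a list list \<Rightarrow> real" where
  "occupied lam v V ES = lam * weight lam (V - {v}) (shrink v ES) / weight lam V ES"

lemma finite_indep_sets: "finite V \<Longrightarrow> finite (indep_sets V ES)"
  by (rule finite_subset[of _ "Pow V"]) (auto simp: indep_sets_def)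

lemma weight_cong: "set ES = set ES' \<Longrightarrow> weight lam V ES = weight lam V ES'"
  by (simp add: weight_def indep_sets_def)

lemma set_shrink: "set (shrink v ES) = set (touched v ES) \<union> set (avoiding v ES)"
proof -
  have "removeAll v ` set ES = removeAll v ` {e \<in> set ES. v \<in> set e} \<union> removeAll v ` {e \<in> set ES. v \<notin> set e}"
    by blast
  also have "removeAll v ` {e \<in> set ES. v \<notin> set e} = (\<lambda>e. e) ` {e \<in> set ES. v \<notin> set e}"
    by (rule image_cong) auto
  finally show ?thesis by (simp add: shrink_def touched_def avoiding_def)
qed

lemma weight_shrink: "weight lam V (shrink v ES) = weight lam V (touched v ES @ avoiding v ES)"
  by (rule weight_cong) (simp add: set_shrink)

lemma weight_pos:
  assumes "finite V" "0 < lam" "[] \<notin> set ES"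
  shows "0 < weight lam V ES"
proof -
  have "{} \<in> indep_sets V ES" using assms by (auto simp: indep_sets_def)
  then show ?thesis unfolding weight_def using assms finite_indep_sets[OF assms(1)]
    by (intro sum_pos) auto
qed

lemma weight_zero: "[] \<in> set ES \<Longrightarrow> weight lam V ES = 0"
proof -
  assume "[] \<in> set ES"
  then have "indep_sets V ES = {}" by (force simp: indep_sets_def)
  then show ?thesis by (simp add: weight_def)
qed

lemma weight_nonneg: "0 < lam \<Longrightarrow> 0 \<le> weight lam V ES"
  by (simp add: weight_def sum_nonneg)

lemma weight_no_edges: "weight lam {} [] = 1"
  by (simp add: weight_def indep_sets_def)

lemma weight_containing_Cons:
  assumes "finite V" "u \<in> V" "u \<notin> set e"
  shows "weight_containing lam (u # e) V ES = lam * weight_containing lam e (V - {u}) (shrink u ES)"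
proof -
  let ?A = "{I \<in> indep_sets V ES. set (u # e) \<subseteq> I}"
  let ?B = "{I \<in> indep_sets (V - {u}) (shrink u ES). set e \<subseteq> I}"
  have "weight_containing lam (u # e) V ES = (\<Sum>J\<in>?B. lam * lam ^ card J)"
    unfolding weight_containing_def
  proof (rule sum.reindex_bij_witness[where i = "insert u" and j = "\<lambda>I. I - {u}"])
    fix I assume I: "I \<in> ?A"
    then show "insert u (I - {u}) = I" by auto
    show "I - {u} \<in> ?B" using I assms by (auto simp: indep_sets_def shrink_def)
    have "finite I" using I assms finite_subset by (auto simp: indep_sets_def)
    then show "lam * lam ^ card (I - {u}) = lam ^ card I"
      using I card_Suc_Diff1[of I u] by (simp flip: power_Suc)
  next
    fix J assume J: "J \<in> ?B"
    then show "insert u J - {u} = J" by (auto simp: indep_sets_def)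
    show "insert u J \<in> ?A" using J assms by (auto simp: indep_sets_def shrink_def)
  qed
  then show ?thesis by (simp add: weight_containing_def sum_distrib_left)
qed

lemma weight_containing_Nil: "weight_containing lam [] V ES = weight lam V ES"
  by (simp add: weight_containing_def weight_def)

lemma weight_remove:
  assumes "finite V" "v \<in> V"
  shows "weight lam V ES = weight lam (V - {v}) (avoiding v ES) + lam * weight lam (V - {v}) (shrink v ES)"
proof -
  have split: "indep_sets V ES = indep_sets (V - {v}) (avoiding v ES) \<union> {I \<in> indep_sets V ES. set [v] \<subseteq> I}"
    (is "_ = ?A \<union> ?B") by (auto simp: indep_sets_def avoiding_def)
  have "?A \<inter> ?B = {}" by (auto simp: indep_sets_def)
  then have "weight lam V ES = (\<Sum>I\<in>?A. lam ^ card I) + (\<Sum>I\<in>?B. lam ^ card I)"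
    unfolding weight_def by (subst split, intro sum.union_disjoint) (use assms in \<open>auto simp: finite_indep_sets\<close>)
  also have "(\<Sum>I\<in>?B. lam ^ card I) = weight_containing lam [v] V ES"
    by (simp add: weight_containing_def)
  also have "\<dots> = lam * weight lam (V - {v}) (shrink v ES)"
    using assms by (simp add: weight_containing_Cons weight_containing_Nil)
  finally show ?thesis by (simp add: weight_def)
qed

lemma weight_Cons:
  assumes "finite V"
  shows "weight lam V (e # ES) = weight lam V ES - weight_containing lam e V ES"
proof -
  have split: "indep_sets V ES = indep_sets V (e # ES) \<union> {I \<in> indep_sets V ES. set e \<subseteq> I}"
    (is "_ = ?A \<union> ?B") by (auto simp: indep_sets_def)
  have "?A \<inter> ?B = {}" by (auto simp: indep_sets_def)
  then have "weight lam V ES = (\<Sum>I\<in>?A. lam ^ card I) + (\<Sum>I\<in>?B. lam ^ card I)"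
    unfolding weight_def by (subst split, intro sum.union_disjoint) (use assms in \<open>auto simp: finite_indep_sets\<close>)
  then show ?thesis by (simp add: weight_def weight_containing_def)
qed

lemma deg_shrink: "deg u (shrink v ES) \<le> deg u ES"
  by (induction ES) (auto simp: deg_def shrink_def)

lemma deg_avoiding: "deg u (avoiding v ES) \<le> deg u ES"
  by (induction ES) (auto simp: deg_def avoiding_def)

text \<open>The two lists partition the hyperedges and shrinking only removes \<open>v\<close>. This
  additive form is the one that survives when \<open>survival\<close> moves hyperedges from its
  first list to its second.\<close>

lemma deg_touched_avoiding: "deg u (touched v ES) + deg u (avoiding v ES) \<le> deg u ES"
  by (induction ES) (auto simp: deg_def avoiding_def touched_def)

lemma length_touched: "length (touched v ES) = deg v ES"
  by (simp add: touched_def deg_def)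

lemma deg_Cons: "deg u (e # ES) = (if u \<in> set e then 1 else 0) + deg u ES"
  by (simp add: deg_def)

section \<open>The truncated recursion\<close>

text \<open>The parameter \<open>\<Lambda>\<close> is the activity as a fraction and \<open>l\<close> the remaining depth. The vertices of a
  hyperedge of size \<open>w\<close> are explored with depth \<open>Suc l - w\<close>, written as \<open>l - (w - 1)\<close> so that the
  functions terminate without a case distinction for \<open>w = 0\<close>, where the depth is irrelevant.\<close>

function (sequential) marginal :: "nat \<times> nat \<Rightarrow> nat \<Rightarrow> nat list list \<Rightarrow> nat \<Rightarrow> nat \<times> nat"
  and edge_marginal :: "nat \<times> nat \<Rightarrow> nat list \<Rightarrow> nat list list \<Rightarrow> nat \<Rightarrow> nat \<times> nat"
  and survival :: "nat \<times> nat \<Rightarrow> nat list list \<Rightarrow> nat list list \<Rightarrow> nat \<Rightarrow> nat \<times> nat" where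
  "marginal \<Lambda> v ES 0 = (0, 1)"
| "marginal \<Lambda> v ES (Suc l) =
    (let (N, D) = survival \<Lambda> (touched v ES) (avoiding v ES) l
     in (fst \<Lambda> * N, fst \<Lambda> * N + snd \<Lambda> * D))"
| "edge_marginal \<Lambda> [] H l = (1, 1)"
| "edge_marginal \<Lambda> (u # e) H l =
    (let (a, c) = marginal \<Lambda> u H l; (a', c') = edge_marginal \<Lambda> e (shrink u H) l
     in (a * a', c * c'))"
| "survival \<Lambda> [] H l = (1, 1)"
| "survival \<Lambda> (e # A) H l =
    (let (a, c) = edge_marginal \<Lambda> e H (l - (length e - 1)); (N, D) = survival \<Lambda> A (e # H) l
     in ((c - a) * N, c * D))"
  by pat_completeness auto

termination
  \<comment> \<open>Only \<open>marginal\<close> lowers the depth for sure. At equal depth, calls go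
    from \<open>survival\<close> to \<open>edge_marginal\<close> to \<open>marginal\<close>, or to
    the same function with a shorter list.\<close>
  by (relation "measures
    [\<lambda>x. case x of Inl (\<Lambda>, v, ES, l) \<Rightarrow> l | Inr (Inl (\<Lambda>, e, H, l)) \<Rightarrow> l | Inr (Inr (\<Lambda>, A, H, l)) \<Rightarrow> l,
     \<lambda>x. case x of Inl _ \<Rightarrow> 0 | Inr (Inl _) \<Rightarrow> 1 | Inr (Inr _) \<Rightarrow> 2,
     \<lambda>x. case x of Inl _ \<Rightarrow> 0 | Inr (Inl (\<Lambda>, e, H, l)) \<Rightarrow> length e | Inr (Inr (\<Lambda>, A, H, l)) \<Rightarrow> length A]") auto

definition quot :: "nat \<times> nat \<Rightarrow> real" where
  "quot p = real (fst p) / real (snd p)"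

lemma quot_nonneg [simp]: "0 \<le> quot p"
  by (simp add: quot_def)

lemma quot_Pair [simp]: "quot (a, c) = real a / real c"
  by (simp add: quot_def)

text \<open>These bounds make the subtraction \<open>c - a\<close> on naturals exact. For
  \<open>marginal\<close> the inequality is strict, so the complementary probability never vanishes
  and may be divided by.\<close>

lemma marginal_range:
  assumes "0 < snd \<Lambda>"
  shows "fst (marginal \<Lambda> v ES l) < snd (marginal \<Lambda> v ES l)"
    and "0 < snd (edge_marginal \<Lambda> e H l) \<and> fst (edge_marginal \<Lambda> e H l) \<le> snd (edge_marginal \<Lambda> e H l)"
    and "0 < snd (survival \<Lambda> A H l) \<and> fst (survival \<Lambda> A H l) \<le> snd (survival \<Lambda> A H l)"
  using assms
  by (induction \<Lambda> v ES l and \<Lambda> e H l and \<Lambda> A H l rule: marginal_edge_marginal_survival.induct)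
     (auto simp: Let_def split: prod.splits intro!: mult_le_mono)

text \<open>The factor of an empty hyperedge is \<open>1 - 1\<close>, exactly and at every
  depth.\<close>

lemma survival_zero: "[] \<in> set A \<Longrightarrow> fst (survival \<Lambda> A H l) = 0"
proof (induction A arbitrary: H)
  case (Cons e A)
  have "fst (survival \<Lambda> A (e # H) l) = 0" if "e \<noteq> []"
    using Cons that by auto
  then show ?case by (cases "e = []") (auto simp: Let_def split: prod.splits)
qed simp

lemma marginal_zero: "[] \<in> set (touched v ES) \<Longrightarrow> fst (marginal \<Lambda> v ES l) = 0"
  using survival_zero[of "touched v ES" \<Lambda> "avoiding v ES"]
  by (cases l) (auto simp: Let_def split: prod.splits, metis fst_conv less_numeral_extra(3))

section \<open>Exact conditional probabilities\<close>

lemma weight_append_le: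
  assumes "finite V" "0 < lam"
  shows "weight lam V (A @ H) \<le> weight lam V H"
  unfolding weight_def using assms
  by (intro sum_mono2 finite_indep_sets) (auto simp: indep_sets_def)

lemma weight_containing_le:
  assumes "finite V" "0 < lam"
  shows "weight_containing lam e V H \<le> weight lam V H"
  unfolding weight_def weight_containing_def using assms
  by (intro sum_mono2 finite_indep_sets) auto

lemma weight_containing_nonneg: "0 < lam \<Longrightarrow> 0 \<le> weight_containing lam e V H"
  by (simp add: weight_containing_def sum_nonneg)

definition valid_edges :: "'a set \<Rightarrow> 'a list list \<Rightarrow> bool" where
  "valid_edges V ES \<longleftrightarrow> (\<forall>e\<in>set ES. distinct e \<and> set e \<subseteq> V)"

lemma valid_shrink: "valid_edges V ES \<Longrightarrow> valid_edges (V - {v}) (shrink v ES)"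
  by (auto simp: valid_edges_def shrink_def distinct_removeAll)

lemma valid_touched: "valid_edges V ES \<Longrightarrow> valid_edges (V - {v}) (touched v ES)"
  by (auto simp: valid_edges_def touched_def distinct_removeAll)

lemma valid_avoiding: "valid_edges V ES \<Longrightarrow> valid_edges (V - {v}) (avoiding v ES)"
  by (auto simp: valid_edges_def avoiding_def)

text \<open>The exact counterpart of \<open>marginal\<close>: \<open>r\<close> is the probability,
  under the avoiding hyperedges alone, that no touched hyperedge is filled, and the odds of
  \<open>v\<close> are \<open>lam * r\<close>. The last claim is the telescoping step of the
  partition function.\<close>

lemma occupied_eq:
  assumes "finite V" "v \<in> V" "0 < lam" "[] \<notin> set ES"
  defines "r \<equiv> weight lam (V - {v}) (touched v ES @ avoiding v ES) / weight lam (V - {v}) (avoiding v ES)"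
  shows "occupied lam v V ES = lam * r / (1 + lam * r)" and "0 \<le> r" and "r \<le> 1"
    and "weight lam V ES * (1 - occupied lam v V ES) = weight lam (V - {v}) (avoiding v ES)"
proof -
  have "[] \<notin> set (avoiding v ES)" using assms by (auto simp: avoiding_def)
  then have pos: "0 < weight lam (V - {v}) (avoiding v ES)" "0 < weight lam V ES"
    using assms by (auto intro: weight_pos)
  have W: "weight lam V ES = weight lam (V - {v}) (avoiding v ES) * (1 + lam * r)"
    using weight_remove[OF assms(1,2), of lam ES] pos by (simp add: r_def weight_shrink field_simps)
  show "occupied lam v V ES = lam * r / (1 + lam * r)"
    using pos unfolding occupied_def W by (simp add: weight_shrink r_def)
  show "0 \<le> r" using assms(3) pos by (simp add: r_def weight_nonneg)
  show "r \<le> 1" using pos weight_append_le[of "V - {v}" lam] assms by (simp add: r_def)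
  show "weight lam V ES * (1 - occupied lam v V ES) = weight lam (V - {v}) (avoiding v ES)"
    using weight_remove[OF assms(1,2), of lam ES] pos by (simp add: occupied_def right_diff_distrib)
qed

lemma occupied_le:
  assumes "finite V" "v \<in> V" "0 < lam" "lam \<le> lam1" "[] \<notin> set ES"
  shows "0 \<le> occupied lam v V ES" "occupied lam v V ES \<le> lam1 / (1 + lam1)"
proof -
  define r where "r = weight lam (V - {v}) (touched v ES @ avoiding v ES) / weight lam (V - {v}) (avoiding v ES)"
  have o: "occupied lam v V ES = lam * r / (1 + lam * r)" and r: "0 \<le> r" "r \<le> 1"
    unfolding r_def using occupied_eq[of V v lam ES] assms by auto
  show "0 \<le> occupied lam v V ES" unfolding o using r assms by simp
  have "lam * r \<le> lam1 * 1" using r assms by (intro mult_mono) auto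
  then show "occupied lam v V ES \<le> lam1 / (1 + lam1)"
    unfolding o using r assms by (simp add: divide_simps add_pos_nonneg add_nonneg_pos) (simp add: algebra_simps)
qed

text \<open>The chain rule that \<open>edge_marginal\<close> imitates.\<close>

lemma containing_ratio_Cons:
  assumes "finite V" "0 < lam" "u \<in> V" "u \<notin> set e"
  shows "weight_containing lam (u # e) V H / weight lam V H = occupied lam u V H *
    (weight_containing lam e (V - {u}) (shrink u H) / weight lam (V - {u}) (shrink u H))"
proof (cases "weight lam (V - {u}) (shrink u H) = 0")
  \<comment> \<open>Conditioning on \<open>u\<close> is impossible here; the last quotient is
    \<open>0 / 0 = 0\<close> and both sides vanish.\<close>
  case True
  then have "weight_containing lam e (V - {u}) (shrink u H) = 0"
    using weight_containing_le[of "V - {u}" lam e "shrink u H"] weight_containing_nonneg[of lam e "V - {u}" "shrink u H"] assms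
    by simp
  then show ?thesis using assms by (simp add: weight_containing_Cons)
next
  case False
  then show ?thesis using assms by (simp add: weight_containing_Cons occupied_def)
qed

text \<open>\<open>lam1\<close> bounds the admissible activities and \<open>rho\<close> measures its
  distance from the threshold. \<open>C\<close> is the coordinate of the largest possible
  probability of a vertex, hence the error at depth 0, and \<open>\<alpha>\<close> is the decay per
  level. In \<open>slack\<close>, one minus the contraction rate is shared equally among
  \<open>d\<close> hyperedges.\<close>

locale decay =
  fixes d :: nat and lam1 rho \<alpha> C :: real
  assumes d: "1 \<le> d" and lam1: "0 < lam1" and rho: "0 \<le> rho" "rho \<le> 1"
    and crit: "lam1 * (real d - 1) ^ (d + 1) \<le> rho * real d ^ d"
    and \<alpha>: "0 < \<alpha>" "\<alpha> < 1"
    and C: "0 \<le> C" "(tanh C)\<^sup>2 = lam1 / (1 + lam1)"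
    and slack: "\<And>w. tanh C ^ w * (1 / \<alpha>) ^ w \<le> 1"
      "\<And>u w. 0 \<le> u \<Longrightarrow> u \<le> tanh C ^ w \<Longrightarrow>
        u * (1 / \<alpha>) ^ w \<le> u + (1 - sqrt ((rho + lam1) / (1 + lam1))) / d"
begin

text \<open>\<open>\<kappa>\<close> bounds the unweighted influence. The weights
  \<open>(1 / \<alpha>) ^ w i\<close> add at most \<open>(1 - \<kappa>) / d\<close> for each of at
  most \<open>d\<close> hyperedges, which just fills the gap up to 1.\<close>

lemma influence_le_1:
  assumes lam: "0 < lam" "lam \<le> lam1" and r: "r \<le> d"
    and \<xi>: "\<And>i. i < r \<Longrightarrow> 0 \<le> \<xi> i \<and> tanh (\<xi> i) \<le> tanh C ^ w i"
  shows "tanh (level lam r \<xi>) * (\<Sum>i<r. tanh (\<xi> i) * (1 / \<alpha>) ^ w i) \<le> 1"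
proof -
  define \<kappa> where "\<kappa> = sqrt ((rho + lam1) / (1 + lam1))"
  have \<kappa>: "\<kappa> \<le> 1" using rho lam1 by (simp add: \<kappa>_def)
  let ?t = "tanh (level lam r \<xi>)"
  have t: "0 < ?t" "?t < 1" using level_pos[OF lam(1)] tanh_real_lt_1 by auto
  have "(?t * (\<Sum>i<r. tanh (\<xi> i)))\<^sup>2 \<le> (rho + lam1) / (1 + lam1)"
    unfolding power_mult_distrib tanh_sq_eq[of "level lam r \<xi>"] sinh_level_sq[OF lam(1)]
    using contraction_bound[OF d lam rho crit r, of "\<lambda>i. tanh (\<xi> i)", OF _ refl] \<xi>
    by (simp add: tanh_real_lt_1 mult.commute)
  then have main: "?t * (\<Sum>i<r. tanh (\<xi> i)) \<le> \<kappa>"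
    unfolding \<kappa>_def by (rule real_le_rsqrt)
  have "(\<Sum>i<r. tanh (\<xi> i) * (1 / \<alpha>) ^ w i) \<le> (\<Sum>i<r. tanh (\<xi> i) + (1 - \<kappa>) / d)"
    unfolding \<kappa>_def using \<xi> by (intro sum_mono slack) auto
  also have "\<dots> = (\<Sum>i<r. tanh (\<xi> i)) + real r * ((1 - \<kappa>) / d)"
    by (simp add: sum.distrib)
  also have "real r * ((1 - \<kappa>) / d) \<le> real d * ((1 - \<kappa>) / d)"
    using r \<kappa> by (intro mult_right_mono) auto
  finally have "(\<Sum>i<r. tanh (\<xi> i) * (1 / \<alpha>) ^ w i) \<le> (\<Sum>i<r. tanh (\<xi> i)) + (1 - \<kappa>)"
    using d by simp
  then have "?t * (\<Sum>i<r. tanh (\<xi> i) * (1 / \<alpha>) ^ w i) \<le> ?t * ((\<Sum>i<r. tanh (\<xi> i)) + (1 - \<kappa>))"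
    using t by (intro mult_left_mono) auto
  also have "\<dots> \<le> \<kappa> + 1 * (1 - \<kappa>)"
    unfolding distrib_left using t \<kappa> main by (intro add_mono mult_right_mono) auto
  finally show ?thesis by simp
qed

lemma influence_le_card:
  assumes lam: "0 < lam"
    and \<xi>: "\<And>i. i < r \<Longrightarrow> 0 \<le> \<xi> i \<and> tanh (\<xi> i) \<le> tanh C ^ w i"
  shows "tanh (level lam r \<xi>) * (\<Sum>i<r. tanh (\<xi> i) * (1 / \<alpha>) ^ w i) \<le> real r"
proof -
  have "(\<Sum>i<r. tanh (\<xi> i) * (1 / \<alpha>) ^ w i) \<le> (\<Sum>i<r. 1)"
  proof (rule sum_mono)
    fix i assume "i \<in> {..<r}"
    then have "tanh (\<xi> i) * (1 / \<alpha>) ^ w i \<le> tanh C ^ w i * (1 / \<alpha>) ^ w i"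
      using \<xi> \<alpha> by (intro mult_right_mono) auto
    then show "tanh (\<xi> i) * (1 / \<alpha>) ^ w i \<le> 1" using slack(1)[of "w i"] by simp
  qed
  moreover have "0 \<le> (\<Sum>i<r. tanh (\<xi> i) * (1 / \<alpha>) ^ w i)"
    using \<xi> \<alpha> by (intro sum_nonneg mult_nonneg_nonneg) auto
  moreover have "0 < tanh (level lam r \<xi>)" "tanh (level lam r \<xi>) < 1"
    using level_pos[OF lam] tanh_real_lt_1 by auto
  ultimately have "tanh (level lam r \<xi>) * (\<Sum>i<r. tanh (\<xi> i) * (1 / \<alpha>) ^ w i) \<le> 1 * real r"
    by (intro mult_mono) auto
  then show ?thesis by simp
qed

end

lemma quot_marginal_Suc:
  assumes "0 < snd \<Lambda>"
  shows "quot (marginal \<Lambda> v ES (Suc l)) =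
    quot \<Lambda> * quot (survival \<Lambda> (touched v ES) (avoiding v ES) l) /
      (1 + quot \<Lambda> * quot (survival \<Lambda> (touched v ES) (avoiding v ES) l))"
proof -
  obtain N D where ND: "survival \<Lambda> (touched v ES) (avoiding v ES) l = (N, D)" by fastforce
  have "0 < D" using marginal_range(3)[OF assms, of "touched v ES" "avoiding v ES" l] ND by simp
  moreover have "0 \<le> real (fst \<Lambda>) * real N" by simp
  ultimately show ?thesis using assms
    by (simp add: quot_def ND divide_simps add_pos_nonneg add_nonneg_pos add_nonneg_eq_0_iff)
qed

lemma quot_edge_marginal_Cons:
  "quot (edge_marginal \<Lambda> (u # e) H l) = quot (marginal \<Lambda> u H l) * quot (edge_marginal \<Lambda> e (shrink u H) l)"
  by (simp add: quot_def Let_def split: prod.splits)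

text \<open>Hyperedges are imposed one at a time: the factor of \<open>e\<close> is taken with
  respect to \<open>H\<close>, and afterwards \<open>e\<close> is an ordinary constraint for the
  hyperedges in \<open>A\<close>.\<close>

lemma quot_survival_Cons:
  assumes "0 < snd \<Lambda>"
  shows "quot (survival \<Lambda> (e # A) H l) =
    (1 - quot (edge_marginal \<Lambda> e H (l - (length e - 1)))) * quot (survival \<Lambda> A (e # H) l)"
proof -
  obtain a c where ac: "edge_marginal \<Lambda> e H (l - (length e - 1)) = (a, c)" by fastforce
  then have "0 < c" "a \<le> c" using marginal_range(2)[OF assms, of e H "l - (length e - 1)"] by auto
  moreover obtain N D where "survival \<Lambda> A (e # H) l = (N, D)" by fastforce
  ultimately show ?thesis
    by (simp add: quot_def ac[unfolded One_nat_def] Let_def of_nat_diff diff_divide_distrib left_diff_distrib)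
qed

declare marginal.simps(2) [simp del] edge_marginal.simps(2) [simp del] survival.simps(2) [simp del]

text \<open>The vertex with the largest number is removed first, so the remaining vertices are again
  an initial segment. Each vertex contributes the reciprocal of its probability to be
  unoccupied.\<close>

fun partition_value :: "nat \<times> nat \<Rightarrow> nat \<Rightarrow> nat list list \<Rightarrow> nat \<Rightarrow> nat \<times> nat" where
  "partition_value \<Lambda> 0 ES l = (1, 1)"
| "partition_value \<Lambda> (Suc k) ES l =
    (let (a, c) = marginal \<Lambda> k ES l; (p, q) = partition_value \<Lambda> k (avoiding k ES) l
     in (c * p, (c - a) * q))"

text \<open>The telescoping factor \<open>1 / (1 - p)\<close> with \<open>p\<close> the square of
  \<open>tanh s\<close> is the square of \<open>cosh s\<close>, so errors in coordinates pass to the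
  logarithm of the partition function with a factor of 2.\<close>

lemma abs_ln_cosh_diff_le: "\<bar>ln (cosh x) - ln (cosh y)\<bar> \<le> \<bar>x - y\<bar>" for x y :: real
proof -
  have *: "ln (cosh x) \<le> \<bar>x - y\<bar> + ln (cosh y)" for x y :: real
  proof -
    have "exp x \<le> exp (\<bar>x - y\<bar> + y)" "exp (- x) \<le> exp (\<bar>x - y\<bar> + - y)" by simp_all
    then have "cosh x \<le> exp \<bar>x - y\<bar> * cosh y"
      unfolding exp_add by (simp add: cosh_def algebra_simps)
    then have "ln (cosh x) \<le> ln (exp \<bar>x - y\<bar> * cosh y)" by (intro ln_mono) auto
    then show ?thesis by (simp add: ln_mult_pos)
  qed
  show ?thesis using *[of x y] *[of y x] by (simp add: abs_le_iff abs_minus_commute)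
qed

section \<open>Error of the truncated recursion\<close>

context decay
begin

context
  fixes \<Lambda> :: "nat \<times> nat"
  assumes \<Lambda>: "0 < fst \<Lambda>" "0 < snd \<Lambda>" "quot \<Lambda> \<le> lam1"
begin

abbreviation "err l \<equiv> tanh (C * \<alpha> ^ l)"

text \<open>The recursion does not mention the vertex set, hence the quantifier over
  \<open>V\<close>. Square roots appear because a probability is a squared \<open>tanh\<close>.
  Vertices other than \<open>v\<close> may have degree \<open>d + 1\<close>, since they lose a
  hyperedge only when they are reached.\<close>

definition marginal_ok :: "nat \<Rightarrow> nat list list \<Rightarrow> nat \<Rightarrow> bool" where
  "marginal_ok v ES l \<longleftrightarrow> (\<forall>V. finite V \<and> v \<in> V \<and> valid_edges V ES \<and> [] \<notin> set ES \<and>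
     (\<forall>u. deg u ES \<le> d + 1) \<and> deg v ES \<le> d \<longrightarrow>
     close (err l) (sqrt (quot (marginal \<Lambda> v ES l))) (sqrt (occupied (quot \<Lambda>) v V ES)))"

definition edge_ok :: "nat list \<Rightarrow> nat list list \<Rightarrow> nat \<Rightarrow> bool" where
  "edge_ok e H l \<longleftrightarrow> (\<forall>V. finite V \<and> distinct e \<and> set e \<subseteq> V \<and> valid_edges V H \<and> [] \<notin> set H \<and>
     (\<forall>u. deg u H \<le> d + 1) \<and> (\<forall>u\<in>set e. deg u H \<le> d) \<longrightarrow>
     close (err l) (sqrt (quot (edge_marginal \<Lambda> e H l)))
       (sqrt (weight_containing (quot \<Lambda>) e V H / weight (quot \<Lambda>) V H)))"

text \<open>The second alternative provides explicit coordinates, as \<open>level_lipschitz\<close>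
  needs; \<open>w i\<close> will be the size of the hyperedge and accounts for its reduced depth.
  The first one covers empty hyperedges in \<open>A\<close>, whose factor 0 has no finite
  coordinate.\<close>

definition survival_ok :: "nat list list \<Rightarrow> nat list list \<Rightarrow> nat \<Rightarrow> bool" where
  "survival_ok A H l \<longleftrightarrow> (\<forall>V. finite V \<and> valid_edges V A \<and> valid_edges V H \<and> [] \<notin> set H \<and>
     (\<forall>u. deg u A + deg u H \<le> d + 1) \<longrightarrow>
     quot (survival \<Lambda> A H l) = 0 \<and> weight (quot \<Lambda>) V (A @ H) = 0 \<or>
     (\<exists>\<sigma> \<tau> w. (\<forall>i<length A. 0 \<le> \<sigma> i \<and> 0 \<le> \<tau> i \<and> tanh (\<sigma> i) \<le> tanh C ^ w i \<and> tanh (\<tau> i) \<le> tanh C ^ w i \<and>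
         \<bar>\<tau> i - \<sigma> i\<bar> \<le> (1 / \<alpha>) ^ w i * (C * \<alpha> ^ Suc l)) \<and>
       quot (survival \<Lambda> A H l) = (\<Prod>i<length A. 1 - (tanh (\<sigma> i))\<^sup>2) \<and>
       weight (quot \<Lambda>) V (A @ H) / weight (quot \<Lambda>) V H = (\<Prod>i<length A. 1 - (tanh (\<tau> i))\<^sup>2)))"

lemma tanh_C: "0 \<le> tanh C" "tanh C < 1"
  using C tanh_real_lt_1 by auto

lemma lam_pos: "0 < quot \<Lambda>"
  using \<Lambda> by (simp add: quot_def)

lemma quot_survival_le_1: "quot (survival \<Lambda> A H l) \<le> 1"
  using marginal_range(3)[OF \<Lambda>(2), of A H l] by (simp add: quot_def)

lemma quot_marginal_le: "quot (marginal \<Lambda> v ES l) \<le> (tanh C)\<^sup>2"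
proof (cases l)
  case (Suc k)
  define r where "r = quot (survival \<Lambda> (touched v ES) (avoiding v ES) k)"
  have r: "0 \<le> r" "r \<le> 1" using quot_survival_le_1 by (auto simp: r_def)
  have "quot \<Lambda> * r \<le> lam1 * 1" using r \<Lambda> lam1 by (intro mult_mono) auto
  then show ?thesis
    unfolding C(2) Suc quot_marginal_Suc[OF \<Lambda>(2)] r_def[symmetric]
    using r lam1 lam_pos by (simp add: frac_le_eq divide_simps add_pos_nonneg) (simp add: algebra_simps)
qed simp

lemma quot_edge_marginal_le: "quot (edge_marginal \<Lambda> e H l) \<le> (tanh C ^ length e)\<^sup>2"
proof (induction e arbitrary: H)
  case (Cons u e)
  have "quot (marginal \<Lambda> u H l) * quot (edge_marginal \<Lambda> e (shrink u H) l) \<le> (tanh C)\<^sup>2 * (tanh C ^ length e)\<^sup>2"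
    using Cons quot_marginal_le by (intro mult_mono) auto
  then show ?case unfolding quot_edge_marginal_Cons by (simp add: power_mult_distrib)
qed simp

lemma occupied_range:
  assumes "finite V" "v \<in> V" "[] \<notin> set ES"
  shows "0 \<le> occupied (quot \<Lambda>) v V ES" "occupied (quot \<Lambda>) v V ES \<le> (tanh C)\<^sup>2"
  unfolding C(2) using occupied_le[OF assms(1,2) lam_pos \<Lambda>(3) assms(3)] by auto

lemma containing_ratio_le:
  assumes "finite V" "distinct e" "set e \<subseteq> V" "[] \<notin> set H"
  shows "0 \<le> weight_containing (quot \<Lambda>) e V H / weight (quot \<Lambda>) V H \<and>
    weight_containing (quot \<Lambda>) e V H / weight (quot \<Lambda>) V H \<le> (tanh C ^ length e)\<^sup>2"
  using assms
proof (induction e arbitrary: V H)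
  case Nil
  then show ?case using weight_pos[of V "quot \<Lambda>" H] lam_pos by (simp add: weight_containing_Nil)
next
  case (Cons u e)
  have eq: "weight_containing (quot \<Lambda>) (u # e) V H / weight (quot \<Lambda>) V H = occupied (quot \<Lambda>) u V H *
    (weight_containing (quot \<Lambda>) e (V - {u}) (shrink u H) / weight (quot \<Lambda>) (V - {u}) (shrink u H))" (is "_ = _ * ?b")
    using Cons.prems lam_pos by (intro containing_ratio_Cons) auto
  show ?case
  proof (cases "[] \<in> set (shrink u H)")
    case True
    then show ?thesis unfolding eq by (simp add: weight_zero)
  next
    case False
    have b: "0 \<le> ?b \<and> ?b \<le> (tanh C ^ length e)\<^sup>2"
      using Cons.prems False by (intro Cons.IH) auto
    have o: "0 \<le> occupied (quot \<Lambda>) u V H" "occupied (quot \<Lambda>) u V H \<le> (tanh C)\<^sup>2"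
      using occupied_range[of V u H] Cons.prems by auto
    have "occupied (quot \<Lambda>) u V H * ?b \<le> (tanh C)\<^sup>2 * (tanh C ^ length e)\<^sup>2"
      using o b by (intro mult_mono) auto
    then show ?thesis unfolding eq using mult_nonneg_nonneg[OF o(1) conjunct1[OF b]] by (simp add: power_mult_distrib)
  qed
qed

lemma err_range: "0 \<le> err l" "err l \<le> 1"
  using C \<alpha> tanh_real_lt_1[of "C * \<alpha> ^ l"] by auto

lemma sqrt_le_pow: "0 \<le> x \<Longrightarrow> x \<le> (tanh C ^ n)\<^sup>2 \<Longrightarrow> sqrt x \<le> tanh C ^ n"
  using tanh_C by (simp add: real_le_lsqrt)

lemma sqrt_le_one: "x \<le> (tanh C ^ n)\<^sup>2 \<Longrightarrow> sqrt x \<le> 1"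
  using power_le_one[of "tanh C" n] power_le_one[of "tanh C ^ n" 2] tanh_C by simp

text \<open>A vertex lying on a hyperedge of size one is excluded by the recursion exactly, whatever the
  budget; this is what keeps the undefined conditional probabilities harmless.\<close>

lemma edge_ok_Cons:
  assumes "marginal_ok u H l" "edge_ok e (shrink u H) l"
  shows "edge_ok (u # e) H l"
  unfolding edge_ok_def
proof (intro allI impI, elim conjE)
  fix V :: "nat set"
  assume V: "finite V" "distinct (u # e)" "set (u # e) \<subseteq> V" "valid_edges V H" "[] \<notin> set H"
    and deg: "\<forall>u. deg u H \<le> d + 1" "\<forall>u\<in>set (u # e). deg u H \<le> d"
  have eq: "weight_containing (quot \<Lambda>) (u # e) V H / weight (quot \<Lambda>) V H = occupied (quot \<Lambda>) u V H *
    (weight_containing (quot \<Lambda>) e (V - {u}) (shrink u H) / weight (quot \<Lambda>) (V - {u}) (shrink u H))" (is "_ = ?o * ?b")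
    using V lam_pos by (intro containing_ratio_Cons) auto
  show "close (err l) (sqrt (quot (edge_marginal \<Lambda> (u # e) H l)))
       (sqrt (weight_containing (quot \<Lambda>) (u # e) V H / weight (quot \<Lambda>) V H))"
  proof (cases "[] \<in> set (shrink u H)")
    case True
    then have "[] \<in> set (touched u H)"
      using V by (auto simp: set_shrink avoiding_def)
    then have "quot (marginal \<Lambda> u H l) = 0" by (simp add: marginal_zero quot_def)
    then show ?thesis
      unfolding eq quot_edge_marginal_Cons using err_range True by (simp add: weight_zero close_refl)
  next
    case False
    have *: "set e \<subseteq> V - {u}" using V by auto
    have dle: "deg x (shrink u H) \<le> d + 1" for x
      using deg(1) deg_shrink[of x u H] order_trans by blast
    have dle': "\<forall>x\<in>set e. deg x (shrink u H) \<le> d"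
      using deg(2) deg_shrink[of _ u H] order_trans by (meson list.set_intros(2))
    have "close (err l) (sqrt (quot (marginal \<Lambda> u H l))) (sqrt ?o)"
      using assms(1) V deg unfolding marginal_ok_def by auto
    moreover have "close (err l) (sqrt (quot (edge_marginal \<Lambda> e (shrink u H) l))) (sqrt ?b)"
      using assms(2) V False * dle dle' unfolding edge_ok_def by (simp add: valid_shrink)
    moreover have "0 \<le> ?o" "?o \<le> (tanh C ^ 1)\<^sup>2" using occupied_range[of V u H] V by auto
    moreover have "0 \<le> ?b" "?b \<le> (tanh C ^ length e)\<^sup>2"
      using containing_ratio_le[of "V - {u}" e "shrink u H"] V False * by auto
    moreover have "quot (marginal \<Lambda> u H l) \<le> (tanh C ^ 1)\<^sup>2" using quot_marginal_le by simp
    moreover note quot_edge_marginal_le[of e "shrink u H" l]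
    ultimately show ?thesis
      unfolding eq quot_edge_marginal_Cons real_sqrt_mult
      using err_range by (intro close_mult) (assumption | erule sqrt_le_one | simp)+
  qed
qed

lemma tanh_level_sq:
  "0 < lam \<Longrightarrow> (tanh (level lam r \<sigma>))\<^sup>2 = lam * (\<Prod>i<r. 1 - (tanh (\<sigma> i))\<^sup>2) / (1 + lam * (\<Prod>i<r. 1 - (tanh (\<sigma> i))\<^sup>2))"
  by (simp add: tanh_sq_eq sinh_level_sq)

text \<open>\<open>level_lipschitz\<close> applied to the coordinates from
  \<open>survival_ok\<close>. The case of degree \<open>d + 1\<close> is kept for the telescoped
  vertices; it costs a factor of \<open>d + 1\<close>.\<close>

lemma marginal_close:
  assumes ok: "survival_ok (touched v ES) (avoiding v ES) l"
    and V: "finite V" "v \<in> V" "valid_edges V ES" "[] \<notin> set ES" and deg: "\<forall>u. deg u ES \<le> d + 1"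
  obtains s t where "0 \<le> s" "0 \<le> t" "quot (marginal \<Lambda> v ES (Suc l)) = (tanh s)\<^sup>2"
    "occupied (quot \<Lambda>) v V ES = (tanh t)\<^sup>2"
    "\<bar>s - t\<bar> \<le> real (if deg v ES \<le> d then 1 else d + 1) * (C * \<alpha> ^ Suc l)"
proof -
  let ?A = "touched v ES" and ?H = "avoiding v ES" and ?lam = "quot \<Lambda>"
  have Cl: "0 \<le> C * \<alpha> ^ Suc l" using C \<alpha> by simp
  have dd: "deg u ?A + deg u ?H \<le> d + 1" for u
    using deg deg_touched_avoiding[of u v ES] order_trans by blast
  have occ: "occupied ?lam v V ES = ?lam * (weight ?lam (V - {v}) (?A @ ?H) / weight ?lam (V - {v}) ?H) /
    (1 + ?lam * (weight ?lam (V - {v}) (?A @ ?H) / weight ?lam (V - {v}) ?H))"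
    using occupied_eq[of V v ?lam ES] V lam_pos by simp
  consider (zero) "quot (survival \<Lambda> ?A ?H l) = 0" "weight ?lam (V - {v}) (?A @ ?H) = 0"
    | (pos) \<sigma> \<tau> w where
        "\<And>i. i < length ?A \<Longrightarrow> 0 \<le> \<sigma> i \<and> 0 \<le> \<tau> i \<and> tanh (\<sigma> i) \<le> tanh C ^ w i \<and> tanh (\<tau> i) \<le> tanh C ^ w i \<and>
          \<bar>\<tau> i - \<sigma> i\<bar> \<le> (1 / \<alpha>) ^ w i * (C * \<alpha> ^ Suc l)"
        "quot (survival \<Lambda> ?A ?H l) = (\<Prod>i<length ?A. 1 - (tanh (\<sigma> i))\<^sup>2)"
        "weight ?lam (V - {v}) (?A @ ?H) / weight ?lam (V - {v}) ?H = (\<Prod>i<length ?A. 1 - (tanh (\<tau> i))\<^sup>2)"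
  proof -
    have "[] \<notin> set ?H" using V by (auto simp: avoiding_def)
    then have pre: "finite (V - {v}) \<and> valid_edges (V - {v}) ?A \<and> valid_edges (V - {v}) ?H \<and> [] \<notin> set ?H \<and>
        (\<forall>u. deg u ?A + deg u ?H \<le> d + 1)"
      using V dd valid_touched[OF V(3)] valid_avoiding[OF V(3)] by simp
    from ok[unfolded survival_ok_def, THEN spec, THEN mp, OF pre] show thesis
    proof (elim disjE exE conjE)
      assume "quot (survival \<Lambda> ?A ?H l) = 0" "weight ?lam (V - {v}) (?A @ ?H) = 0"
      then show thesis by (rule zero)
    qed (rule pos, blast+)
  qed
  then show thesis
  proof cases
    case zero
    then show thesis
      using that[of 0 0] quot_marginal_Suc[OF \<Lambda>(2), of v ES l] occ Cl by simp
  next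
    case pos
    let ?r = "length ?A" and ?B = "(if deg v ES \<le> d then 1 else real (d + 1)) * (C * \<alpha> ^ Suc l)"
    have "\<bar>level ?lam ?r \<tau> - level ?lam ?r \<sigma>\<bar> \<le> ?B"
    proof (rule level_lipschitz[OF lam_pos])
      fix \<xi> assume \<xi>: "\<And>i. i < ?r \<Longrightarrow> 0 \<le> \<xi> i \<and> tanh (\<xi> i) \<le> tanh C ^ w i"
      have "tanh (level ?lam ?r \<xi>) * (\<Sum>i<?r. tanh (\<xi> i) * (1 / \<alpha>) ^ w i) \<le> (if deg v ES \<le> d then 1 else real (d + 1))"
      proof (cases "deg v ES \<le> d")
        case True
        then show ?thesis
          using influence_le_1[OF lam_pos \<Lambda>(3), of ?r \<xi> w] \<xi> by (simp add: length_touched)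
      next
        case False
        have "deg v ES \<le> d + 1" using deg by blast
        then show ?thesis
          using False influence_le_card[OF lam_pos, of ?r \<xi> w] \<xi> by (simp add: length_touched)
      qed
      then have "tanh (level ?lam ?r \<xi>) * (\<Sum>i<?r. tanh (\<xi> i) * (1 / \<alpha>) ^ w i) * (C * \<alpha> ^ Suc l) \<le> ?B"
        using Cl by (intro mult_right_mono)
      then show "tanh (level ?lam ?r \<xi>) * (\<Sum>i<?r. tanh (\<xi> i) * ((1 / \<alpha>) ^ w i * (C * \<alpha> ^ Suc l))) \<le> ?B"
        by (simp add: sum_distrib_right mult.assoc)
    qed (use pos(1) in auto)
    moreover have "quot (marginal \<Lambda> v ES (Suc l)) = (tanh (level ?lam ?r \<sigma>))\<^sup>2"
      unfolding quot_marginal_Suc[OF \<Lambda>(2)] pos(2) tanh_level_sq[OF lam_pos] ..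
    moreover have "occupied ?lam v V ES = (tanh (level ?lam ?r \<tau>))\<^sup>2"
      unfolding occ pos(3) tanh_level_sq[OF lam_pos] ..
    ultimately show thesis
      using that[of "level ?lam ?r \<sigma>" "level ?lam ?r \<tau>"] less_imp_le[OF level_pos[OF lam_pos]]
      by (simp add: abs_minus_commute split: if_splits)
  qed
qed

text \<open>The answer 0 is off by at most \<open>C\<close>, as no vertex has a probability beyond
  the square of \<open>tanh C\<close>.\<close>

lemma marginal_ok_0: "marginal_ok v ES 0"
  unfolding marginal_ok_def
proof (intro allI impI, elim conjE)
  fix V assume "finite V" "v \<in> V" "[] \<notin> set ES"
  then have "sqrt (occupied (quot \<Lambda>) v V ES) \<le> tanh C ^ 1"
    using occupied_range[of V v ES] by (intro sqrt_le_pow) auto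
  then show "close (err 0) (sqrt (quot (marginal \<Lambda> v ES 0))) (sqrt (occupied (quot \<Lambda>) v V ES))"
    using \<open>finite V\<close> \<open>v \<in> V\<close> \<open>[] \<notin> set ES\<close> occupied_range[of V v ES] C by (simp add: close_def)
qed

lemma marginal_ok_Suc:
  assumes "survival_ok (touched v ES) (avoiding v ES) l"
  shows "marginal_ok v ES (Suc l)"
  unfolding marginal_ok_def
proof (intro allI impI, elim conjE)
  fix V assume V: "finite V" "v \<in> V" "valid_edges V ES" "[] \<notin> set ES"
    "\<forall>u. deg u ES \<le> d + 1" "deg v ES \<le> d"
  obtain s t where st: "0 \<le> s" "0 \<le> t" "quot (marginal \<Lambda> v ES (Suc l)) = (tanh s)\<^sup>2"
    "occupied (quot \<Lambda>) v V ES = (tanh t)\<^sup>2" "\<bar>s - t\<bar> \<le> C * \<alpha> ^ Suc l"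
    using marginal_close[OF assms V(1-5)] V(6) by auto
  then have "close (err (Suc l)) (tanh s) (tanh t)"
    using C \<alpha> by (subst close_tanh_iff) auto
  then show "close (err (Suc l)) (sqrt (quot (marginal \<Lambda> v ES (Suc l)))) (sqrt (occupied (quot \<Lambda>) v V ES))"
    using st by simp
qed

text \<open>For size \<open>w \<ge> 1\<close> the exponent \<open>w + (l - (w - 1))\<close> is at
  least \<open>Suc l\<close>, with equality as long as the subtraction does not truncate.\<close>

lemma budget_le:
  assumes "e \<noteq> []"
  shows "C * \<alpha> ^ (l - (length e - 1)) \<le> (1 / \<alpha>) ^ length e * (C * \<alpha> ^ Suc l)"
proof -
  have "\<alpha> ^ length e * \<alpha> ^ (l - (length e - 1)) \<le> \<alpha> ^ Suc l"
    unfolding power_add[symmetric] using \<alpha> assms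
    by (intro power_decreasing) (cases e, auto)
  then have "C * (\<alpha> ^ length e * \<alpha> ^ (l - (length e - 1))) \<le> C * \<alpha> ^ Suc l"
    using C by (intro mult_left_mono) auto
  then show ?thesis using \<alpha> by (simp add: field_simps power_one_over)
qed

lemma survival_ok_Cons:
  assumes "edge_ok e H (l - (length e - 1))" "survival_ok A (e # H) l"
  shows "survival_ok (e # A) H l"
  unfolding survival_ok_def
proof (intro allI impI, elim conjE)
  fix V :: "nat set"
  let ?lam = "quot \<Lambda>"
  assume V: "finite V" "valid_edges V (e # A)" "valid_edges V H" "[] \<notin> set H"
    and deg: "\<forall>u. deg u (e # A) + deg u H \<le> d + 1"
  show "quot (survival \<Lambda> (e # A) H l) = 0 \<and> weight ?lam V ((e # A) @ H) = 0 \<or>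
     (\<exists>\<sigma> \<tau> w. (\<forall>i<length (e # A). 0 \<le> \<sigma> i \<and> 0 \<le> \<tau> i \<and> tanh (\<sigma> i) \<le> tanh C ^ w i \<and> tanh (\<tau> i) \<le> tanh C ^ w i \<and>
         \<bar>\<tau> i - \<sigma> i\<bar> \<le> (1 / \<alpha>) ^ w i * (C * \<alpha> ^ Suc l)) \<and>
       quot (survival \<Lambda> (e # A) H l) = (\<Prod>i<length (e # A). 1 - (tanh (\<sigma> i))\<^sup>2) \<and>
       weight ?lam V ((e # A) @ H) / weight ?lam V H = (\<Prod>i<length (e # A). 1 - (tanh (\<tau> i))\<^sup>2))"
  proof (cases "e = []")
    case True
    then have "quot (survival \<Lambda> (e # A) H l) = 0" by (simp add: survival_zero quot_def)
    then show ?thesis using True by (simp add: weight_zero)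
  next
    case False
    let ?l = "l - (length e - 1)"
    have perm: "weight ?lam V ((e # A) @ H) = weight ?lam V (A @ e # H)"
      by (rule weight_cong) auto
    have deg': "deg u A + deg u (e # H) \<le> d + 1" for u
      using deg[rule_format, of u] by (simp add: deg_Cons)
    have IH: "quot (survival \<Lambda> A (e # H) l) = 0 \<and> weight ?lam V (A @ e # H) = 0 \<or>
     (\<exists>\<sigma> \<tau> w. (\<forall>i<length A. 0 \<le> \<sigma> i \<and> 0 \<le> \<tau> i \<and> tanh (\<sigma> i) \<le> tanh C ^ w i \<and> tanh (\<tau> i) \<le> tanh C ^ w i \<and>
         \<bar>\<tau> i - \<sigma> i\<bar> \<le> (1 / \<alpha>) ^ w i * (C * \<alpha> ^ Suc l)) \<and>
       quot (survival \<Lambda> A (e # H) l) = (\<Prod>i<length A. 1 - (tanh (\<sigma> i))\<^sup>2) \<and>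
       weight ?lam V (A @ e # H) / weight ?lam V (e # H) = (\<Prod>i<length A. 1 - (tanh (\<tau> i))\<^sup>2))"
      using assms(2)[unfolded survival_ok_def, rule_format, of V] V False deg'
      by (simp add: valid_edges_def)
    let ?p = "quot (edge_marginal \<Lambda> e H ?l)" and ?q = "weight_containing ?lam e V H / weight ?lam V H"
    have surv: "quot (survival \<Lambda> (e # A) H l) = (1 - ?p) * quot (survival \<Lambda> A (e # H) l)"
      by (rule quot_survival_Cons[OF \<Lambda>(2)])
    from IH show ?thesis
    proof (elim disjE exE conjE)
      assume "quot (survival \<Lambda> A (e # H) l) = 0" "weight ?lam V (A @ e # H) = 0"
      then show ?thesis unfolding surv perm by simp
    next
      fix \<sigma> \<tau> :: "nat \<Rightarrow> real" and w :: "nat \<Rightarrow> nat"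
      assume st: "\<forall>i<length A. 0 \<le> \<sigma> i \<and> 0 \<le> \<tau> i \<and> tanh (\<sigma> i) \<le> tanh C ^ w i \<and> tanh (\<tau> i) \<le> tanh C ^ w i \<and>
         \<bar>\<tau> i - \<sigma> i\<bar> \<le> (1 / \<alpha>) ^ w i * (C * \<alpha> ^ Suc l)"
        and eqs: "quot (survival \<Lambda> A (e # H) l) = (\<Prod>i<length A. 1 - (tanh (\<sigma> i))\<^sup>2)"
         "weight ?lam V (A @ e # H) / weight ?lam V (e # H) = (\<Prod>i<length A. 1 - (tanh (\<tau> i))\<^sup>2)"
      have p: "0 \<le> ?p" "?p \<le> (tanh C ^ length e)\<^sup>2" using quot_edge_marginal_le by auto
      have q: "0 \<le> ?q" "?q \<le> (tanh C ^ length e)\<^sup>2"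
        using containing_ratio_le[of V e H] V by (auto simp: valid_edges_def)
      have pq: "sqrt ?p \<le> tanh C ^ length e" "sqrt ?q \<le> tanh C ^ length e"
        using sqrt_le_pow p q by auto
      \<comment> \<open>A nonempty hyperedge has probability below 1, hence a finite
        coordinate.\<close>
      have lt1: "tanh C ^ length e < 1" using tanh_C False by (simp add: power_less_one_iff)
      obtain s where s: "0 \<le> s" "tanh s = sqrt ?p"
        using obtain_artanh[OF real_sqrt_ge_zero[OF p(1)] order_le_less_trans[OF pq(1) lt1]] .
      obtain t where t: "0 \<le> t" "tanh t = sqrt ?q"
        using obtain_artanh[OF real_sqrt_ge_zero[OF q(1)] order_le_less_trans[OF pq(2) lt1]] .
      have sq: "(tanh s)\<^sup>2 = ?p" "(tanh t)\<^sup>2 = ?q"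
        unfolding s t using p q by (simp_all only: real_sqrt_pow2)
      have "close (err ?l) (sqrt ?p) (sqrt ?q)"
      proof -
        have "deg u H \<le> d + 1" for u using deg[rule_format, of u] by simp
        \<comment> \<open>\<open>e\<close> itself is one of the at most \<open>d + 1\<close>
          hyperedges at \<open>u\<close>; this is where the branching drops to
          \<open>d\<close>.\<close>
        moreover have "deg u H \<le> d" if "u \<in> set e" for u
          using deg[rule_format, of u] that by (simp add: deg_Cons)
        ultimately show ?thesis
          using assms(1)[unfolded edge_ok_def, rule_format, of V] V by (simp add: valid_edges_def)
      qed
      then have "\<bar>s - t\<bar> \<le> C * \<alpha> ^ ?l"
        unfolding s(2)[symmetric] t(2)[symmetric] using s t C \<alpha> by (subst (asm) close_tanh_iff) auto
      also have "\<dots> \<le> (1 / \<alpha>) ^ length e * (C * \<alpha> ^ Suc l)"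
        by (rule budget_le[OF False])
      finally have diff: "\<bar>t - s\<bar> \<le> (1 / \<alpha>) ^ length e * (C * \<alpha> ^ Suc l)"
        by (simp only: abs_minus_commute)
      have "[] \<notin> set (e # H)" using False V by simp
      then have W: "0 < weight ?lam V (e # H)" "0 < weight ?lam V H"
        using V lam_pos by (auto intro!: weight_pos )
      have "weight ?lam V (A @ e # H) / weight ?lam V H
          = (weight ?lam V (A @ e # H) / weight ?lam V (e # H)) * (weight ?lam V (e # H) / weight ?lam V H)"
        using W by simp
      also have "weight ?lam V (e # H) / weight ?lam V H = 1 - ?q"
        using W weight_Cons[OF V(1), of ?lam e H] by (simp only: diff_divide_distrib) simp
      finally have ratio: "weight ?lam V (A @ e # H) / weight ?lam V H = (1 - ?q) * (\<Prod>i<length A. 1 - (tanh (\<tau> i))\<^sup>2)"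
        unfolding eqs by (simp only: mult.commute)
      let ?\<sigma> = "case_nat s \<sigma>" and ?\<tau> = "case_nat t \<tau>" and ?w = "case_nat (length e) w"
      have "\<forall>i<length (e # A). 0 \<le> ?\<sigma> i \<and> 0 \<le> ?\<tau> i \<and> tanh (?\<sigma> i) \<le> tanh C ^ ?w i \<and> tanh (?\<tau> i) \<le> tanh C ^ ?w i \<and>
         \<bar>?\<tau> i - ?\<sigma> i\<bar> \<le> (1 / \<alpha>) ^ ?w i * (C * \<alpha> ^ Suc l)"
        using st s t diff pq by (auto split: nat.split simp del: real_sqrt_divide)
      moreover have "quot (survival \<Lambda> (e # A) H l) = (\<Prod>i<length (e # A). 1 - (tanh (?\<sigma> i))\<^sup>2)"
        unfolding surv eqs by (simp add: prod.lessThan_Suc_shift sq del: prod.lessThan_Suc)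
      moreover have "weight ?lam V ((e # A) @ H) / weight ?lam V H = (\<Prod>i<length (e # A). 1 - (tanh (?\<tau> i))\<^sup>2)"
        unfolding perm ratio by (simp add: prod.lessThan_Suc_shift sq del: prod.lessThan_Suc)
      ultimately show ?thesis by blast
    qed
  qed
qed

text \<open>The induction rule varies the activity, whereas the three predicates refer to the fixed
  \<open>\<Lambda>\<close>; the premise \<open>L = \<Lambda>\<close> reconciles the two.\<close>

lemma all_ok:
  shows "L = \<Lambda> \<Longrightarrow> marginal_ok v ES l" and "L = \<Lambda> \<Longrightarrow> edge_ok e H l" and "L = \<Lambda> \<Longrightarrow> survival_ok A H l"
proof (induction L v ES l and L e H l and L A H l rule: marginal_edge_marginal_survival.induct)
  case (3 L H l)
  show ?case unfolding edge_ok_def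
  proof (intro allI impI, elim conjE)
    fix V :: "nat set" assume "finite V" "[] \<notin> set H"
    then have "0 < weight (quot \<Lambda>) V H" using lam_pos by (intro weight_pos)
    then show "close (err l) (sqrt (quot (edge_marginal \<Lambda> [] H l))) (sqrt (weight_containing (quot \<Lambda>) [] V H / weight (quot \<Lambda>) V H))"
      using err_range by (simp add: weight_containing_Nil close_refl)
  qed
next
  case (5 L H l)
  show ?case unfolding survival_ok_def
  proof (intro allI impI disjI2, elim conjE)
    fix V :: "nat set" assume "finite V" "[] \<notin> set H"
    then have "0 < weight (quot \<Lambda>) V H" using lam_pos by (intro weight_pos)
    then show "\<exists>\<sigma> \<tau> w. (\<forall>i<length ([] :: nat list list). 0 \<le> \<sigma> i \<and> 0 \<le> \<tau> i \<and> tanh (\<sigma> i) \<le> tanh C ^ w i \<and> tanh (\<tau> i) \<le> tanh C ^ w i \<and>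
         \<bar>\<tau> i - \<sigma> i\<bar> \<le> (1 / \<alpha>) ^ w i * (C * \<alpha> ^ Suc l)) \<and>
       quot (survival \<Lambda> [] H l) = (\<Prod>i<length []. 1 - (tanh (\<sigma> i))\<^sup>2) \<and>
       weight (quot \<Lambda>) V ([] @ H) / weight (quot \<Lambda>) V H = (\<Prod>i<length []. 1 - (tanh (\<tau> i))\<^sup>2)"
      by simp
  qed
next
  case (4 L u e H l)
  then show ?case by (metis edge_ok_Cons surj_pair)
next
  case (6 L e A H l)
  then show ?case by (metis survival_ok_Cons surj_pair)
qed (simp_all add: marginal_ok_0 marginal_ok_Suc)

text \<open>Per vertex, the 2 comes from the squared \<open>cosh\<close> and \<open>d + 1\<close>
  from the full degree of the telescoped vertex.\<close>

lemma ln_partition_close: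
  assumes "valid_edges {..<n} ES" "[] \<notin> set ES" "\<forall>u. deg u ES \<le> d + 1"
  shows "0 < quot (partition_value \<Lambda> n ES (Suc l)) \<and>
    \<bar>ln (quot (partition_value \<Lambda> n ES (Suc l))) - ln (weight (quot \<Lambda>) {..<n} ES)\<bar>
      \<le> real n * (2 * (d + 1) * C * \<alpha> ^ Suc l)"
  using assms
proof (induction n arbitrary: ES)
  case 0
  then have "ES = []" by (cases ES) (auto simp: valid_edges_def)
  then show ?case by (simp add: weight_no_edges)
next
  case (Suc k)
  let ?lam = "quot \<Lambda>" and ?E = "2 * (d + 1) * C * \<alpha> ^ Suc l" and ?H = "avoiding k ES"
  let ?Z = "weight ?lam {..<Suc k} ES" and ?Z' = "weight ?lam {..<k} ?H"
  let ?X = "quot (partition_value \<Lambda> k ?H (Suc l))"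
  have V: "{..<Suc k} - {k} = {..<k}" by auto
  have "deg u ?H \<le> d + 1" for u
    using Suc.prems(3)[rule_format, of u] deg_avoiding[of u k ES] by linarith
  moreover have "[] \<notin> set ?H" using Suc.prems by (simp add: avoiding_def)
  ultimately have IH: "0 < ?X" "\<bar>ln ?X - ln ?Z'\<bar> \<le> real k * ?E" and Z': "0 < ?Z'"
    using Suc.IH[of ?H] valid_avoiding[OF Suc.prems(1), of k] V lam_pos by (auto intro: weight_pos)
  obtain s t where st: "0 \<le> s" "0 \<le> t" "quot (marginal \<Lambda> k ES (Suc l)) = (tanh s)\<^sup>2"
    "occupied ?lam k {..<Suc k} ES = (tanh t)\<^sup>2"
    "\<bar>s - t\<bar> \<le> (if deg k ES \<le> d then 1 else d + 1) * (C * \<alpha> ^ Suc l)"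
    using marginal_close[of k ES l "{..<Suc k}", OF all_ok(3)[OF refl]] Suc.prems by auto
  have "real (if deg k ES \<le> d then 1 else d + 1) * (C * \<alpha> ^ Suc l) \<le> (d + 1) * (C * \<alpha> ^ Suc l)"
    using C \<alpha> by (intro mult_right_mono) auto
  from order_trans[OF st(5) this] have diff: "2 * \<bar>s - t\<bar> \<le> ?E"
    by (simp add: algebra_simps)
  have "?Z * (1 - (tanh t)\<^sup>2) = ?Z'"
    using occupied_eq(4)[of "{..<Suc k}" k ?lam ES] Suc.prems lam_pos st(4) V by simp
  then have Z: "?Z = (cosh t)\<^sup>2 * ?Z'"
    by (simp add: one_minus_tanh_sq divide_eq_eq mult.commute)
  obtain a c where ac: "marginal \<Lambda> k ES (Suc l) = (a, c)" by fastforce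
  obtain p q where pq: "partition_value \<Lambda> k ?H (Suc l) = (p, q)" by fastforce
  have "a < c" using marginal_range(1)[OF \<Lambda>(2), of k ES "Suc l"] ac by simp
  then have "real c / real (c - a) = 1 / (1 - quot (marginal \<Lambda> k ES (Suc l)))"
    using ac by (simp add: of_nat_diff field_simps)
  also have "\<dots> = (cosh s)\<^sup>2" unfolding st(3) by (simp add: one_minus_tanh_sq)
  finally have "(cosh s)\<^sup>2 = real c / real (c - a)" ..
  then have X: "quot (partition_value \<Lambda> (Suc k) ES (Suc l)) = (cosh s)\<^sup>2 * ?X"
    using ac pq by simp
  have arith: "\<bar>2 * x + y\<bar> \<le> 2 * z + w" if "\<bar>x\<bar> \<le> z" "\<bar>y\<bar> \<le> w" for x y z w :: real
    using that by linarith
  have pos: "0 < (cosh s)\<^sup>2" "0 < (cosh t)\<^sup>2" by simp_all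
  have "ln (quot (partition_value \<Lambda> (Suc k) ES (Suc l))) - ln ?Z = 2 * (ln (cosh s) - ln (cosh t)) + (ln ?X - ln ?Z')"
    unfolding X Z using IH Z' by (simp add: ln_mult_pos ln_realpow)
  also have "\<bar>\<dots>\<bar> \<le> 2 * \<bar>s - t\<bar> + real k * ?E"
    using abs_ln_cosh_diff_le[of s t] IH(2) by (rule arith)
  also have "\<dots> \<le> real (Suc k) * ?E"
    unfolding of_nat_Suc distrib_right mult_1_left using diff by (rule add_right_mono)
  finally have "\<bar>ln (quot (partition_value \<Lambda> (Suc k) ES (Suc l))) - ln ?Z\<bar> \<le> real (Suc k) * ?E" .
  moreover have "0 < quot (partition_value \<Lambda> (Suc k) ES (Suc l))" unfolding X using IH pos by simp
  ultimately show ?case by blast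
qed

end

end

section \<open>Sensitivity to the activity\<close>

lemma weight_perturb:
  fixes \<delta> :: real
  assumes "finite V" "0 < lam" "0 < lam'" "lam \<le> exp \<delta> * lam'" "0 \<le> \<delta>"
  shows "weight lam V ES \<le> exp (card V * \<delta>) * weight lam' V ES"
  unfolding weight_def sum_distrib_left
proof (rule sum_mono)
  fix I assume "I \<in> indep_sets V ES"
  then have "card I \<le> card V" using assms by (auto simp: indep_sets_def intro: card_mono)
  then have "exp (card I * \<delta>) \<le> exp (card V * \<delta>)" using assms by (simp add: mult_right_mono)
  have "lam ^ card I \<le> (exp \<delta> * lam') ^ card I" using assms by (intro power_mono) auto
  also have "\<dots> = exp (card I * \<delta>) * lam' ^ card I"
    by (simp add: power_mult_distrib exp_of_nat_mult)
  also have "\<dots> \<le> exp (card V * \<delta>) * lam' ^ card I"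
    using \<open>exp (card I * \<delta>) \<le> exp (card V * \<delta>)\<close> assms by (intro mult_right_mono) auto
  finally show "lam ^ card I \<le> exp (card V * \<delta>) * lam' ^ card I" .
qed

text \<open>The weight is a polynomial of degree at most \<open>card V\<close> in the activity with
  nonnegative coefficients, so its logarithm is \<open>card V\<close>-Lipschitz in the logarithm of
  the activity.\<close>

lemma abs_ln_weight_diff_le:
  assumes "finite V" "0 < lam" "0 < lam'" "[] \<notin> set ES"
  shows "\<bar>ln (weight lam V ES) - ln (weight lam' V ES)\<bar> \<le> card V * \<bar>ln lam - ln lam'\<bar>"
proof -
  have *: "ln (weight x V ES) - ln (weight y V ES) \<le> card V * \<bar>ln x - ln y\<bar>" if "0 < x" "0 < y" for x y
  proof -
    have "ln x \<le> \<bar>ln x - ln y\<bar> + ln y" by linarith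
    then have "exp (ln x) \<le> exp (\<bar>ln x - ln y\<bar> + ln y)" by simp
    then have "x \<le> exp \<bar>ln x - ln y\<bar> * y" using that by (simp add: exp_add)
    then have "weight x V ES \<le> exp (card V * \<bar>ln x - ln y\<bar>) * weight y V ES"
      using that assms weight_perturb[of V x y "\<bar>ln x - ln y\<bar>" ES] by simp
    then have "ln (weight x V ES) \<le> ln (exp (card V * \<bar>ln x - ln y\<bar>) * weight y V ES)"
      using that assms weight_pos by (intro ln_mono) auto
    also have "\<dots> = card V * \<bar>ln x - ln y\<bar> + ln (weight y V ES)"
      using weight_pos[OF assms(1) that(2) assms(4)] by (simp add: ln_mult_pos)
    finally show ?thesis by simp
  qed
  show ?thesis using *[OF assms(2,3)] *[OF assms(3,2)] by (simp add: abs_le_iff abs_minus_commute)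
qed

section \<open>Size of the fractions\<close>

text \<open>The \<open>w\<close> subtrees below a hyperedge together are charged like one subtree of
  depth \<open>l\<close>, because \<open>w \<le> A ^ (w - 1)\<close>. Subtracting 1 makes the left
  side 0 once the depth is exhausted, however large \<open>w\<close> is.\<close>

lemma budget_nodes:
  fixes A l w :: nat
  assumes "2 \<le> A" "1 \<le> w"
  shows "w * (A ^ (l - (w - 1)) - 1) \<le> A ^ l"
proof (cases "w - 1 \<le> l")
  case True
  have "w \<le> A ^ (w - 1)"
  proof -
    have "w - 1 < 2 ^ (w - 1)" by simp
    also have "\<dots> \<le> A ^ (w - 1)" using assms by (intro power_mono) auto
    finally show ?thesis by simp
  qed
  then have "w * A ^ (l - (w - 1)) \<le> A ^ (w - 1) * A ^ (l - (w - 1))" by simp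
  also have "\<dots> = A ^ l" using True by (simp flip: power_add)
  finally show ?thesis by (simp add: diff_mult_distrib2)
qed simp

text \<open>The reason for the base \<open>\<Delta> + 2\<close>: its surplus over
  \<open>\<Delta>\<close> pays for the node itself and for the subtracted 1.\<close>

lemma one_plus_branch_le: "1 + \<Delta> * (\<Delta> + 2) ^ l \<le> (\<Delta> + 2) ^ Suc l - (1::nat)"
proof -
  have "1 \<le> (\<Delta> + 2) ^ l" by simp
  moreover have "(\<Delta> + 2) ^ Suc l = \<Delta> * (\<Delta> + 2) ^ l + 2 * (\<Delta> + 2) ^ l" by (simp add: algebra_simps)
  ultimately show ?thesis by linarith
qed

context
  fixes \<Delta> :: nat and \<Lambda> :: "nat \<times> nat" and S :: nat
  assumes \<Lambda>: "0 < snd \<Lambda>" "fst \<Lambda> + snd \<Lambda> \<le> S"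
begin

text \<open>Denominators are multiplied up without reduction, and each inner node contributes at
  most one factor \<open>S\<close>, so the exponents count nodes.\<close>

lemma size_bounds:
  shows "L = \<Lambda> \<Longrightarrow> \<forall>u. deg u ES \<le> \<Delta> \<Longrightarrow> snd (marginal L v ES l) \<le> S ^ ((\<Delta> + 2) ^ l - 1)"
    and "L = \<Lambda> \<Longrightarrow> \<forall>u. deg u H \<le> \<Delta> \<Longrightarrow> snd (edge_marginal L e H l) \<le> S ^ (length e * ((\<Delta> + 2) ^ l - 1))"
    and "L = \<Lambda> \<Longrightarrow> \<forall>u. deg u A + deg u H \<le> \<Delta> \<Longrightarrow> snd (survival L A H l) \<le> S ^ (length A * (\<Delta> + 2) ^ l)"
proof (induction L v ES l and L e H l and L A H l rule: marginal_edge_marginal_survival.induct)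
  case (2 L v ES l)
  obtain N D where ND: "survival \<Lambda> (touched v ES) (avoiding v ES) l = (N, D)" by fastforce
  have "deg u (touched v ES) + deg u (avoiding v ES) \<le> \<Delta>" for u
    using 2(3)[rule_format, of u] deg_touched_avoiding[of u v ES] by linarith
  then have "D \<le> S ^ (length (touched v ES) * (\<Delta> + 2) ^ l)"
    using 2(1)[OF 2(2)] ND 2(2) by simp
  also have "\<dots> \<le> S ^ (\<Delta> * (\<Delta> + 2) ^ l)"
    using 2(3) \<Lambda> by (intro power_increasing mult_right_mono) (auto simp: length_touched)
  finally have D: "D \<le> S ^ (\<Delta> * (\<Delta> + 2) ^ l)" .
  have "N \<le> D" using marginal_range(3)[OF \<Lambda>(1), of "touched v ES" "avoiding v ES" l] ND by simp
  then have "snd (marginal L v ES (Suc l)) \<le> fst \<Lambda> * D + snd \<Lambda> * D"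
    using ND 2(2) by (simp add: marginal.simps(2))
  also have "\<dots> = (fst \<Lambda> + snd \<Lambda>) * D" by (simp add: algebra_simps)
  also have "\<dots> \<le> S * S ^ (\<Delta> * (\<Delta> + 2) ^ l)"
    using \<Lambda> D by (intro mult_le_mono) auto
  also have "\<dots> = S ^ (1 + \<Delta> * (\<Delta> + 2) ^ l)" by simp
  also have "\<dots> \<le> S ^ ((\<Delta> + 2) ^ Suc l - 1)"
    using \<Lambda> by (intro power_increasing one_plus_branch_le) auto
  finally show ?case .
next
  case (4 L u e H l)
  obtain a c where ac: "marginal \<Lambda> u H l = (a, c)" by fastforce
  obtain a' c' where ac': "edge_marginal \<Lambda> e (shrink u H) l = (a', c')" by fastforce
  have "deg x (shrink u H) \<le> \<Delta>" for x
    using 4(4)[rule_format, of x] deg_shrink[of x u H] by linarith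
  then have "c \<le> S ^ ((\<Delta> + 2) ^ l - 1)" "c' \<le> S ^ (length e * ((\<Delta> + 2) ^ l - 1))"
    using 4 ac ac' by (metis snd_conv)+
  then have "c * c' \<le> S ^ ((\<Delta> + 2) ^ l - 1) * S ^ (length e * ((\<Delta> + 2) ^ l - 1))"
    by (rule mult_le_mono)
  then have "c * c' \<le> S ^ (length (u # e) * ((\<Delta> + 2) ^ l - 1))"
    by (simp only: power_add[symmetric] length_Cons mult_Suc)
  then show ?case using ac ac' 4(3) by (simp add: edge_marginal.simps(2))
next
  case (6 L e A H l)
  obtain a c where ac: "edge_marginal \<Lambda> e H (l - (length e - 1)) = (a, c)" by fastforce
  obtain N D where ND: "survival \<Lambda> A (e # H) l = (N, D)" by fastforce
  have deg: "deg u H \<le> \<Delta>" "deg u A + deg u (e # H) \<le> \<Delta>" for u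
    using 6(4)[rule_format, of u] by (auto simp: deg_Cons)
  then have "c \<le> S ^ (length e * ((\<Delta> + 2) ^ (l - (length e - 1)) - 1))" "D \<le> S ^ (length A * (\<Delta> + 2) ^ l)"
    using 6 ac ND by (metis snd_conv)+
  moreover have "S ^ (length e * ((\<Delta> + 2) ^ (l - (length e - 1)) - 1)) \<le> S ^ ((\<Delta> + 2) ^ l)"
    using \<Lambda> budget_nodes[of "\<Delta> + 2" "length e" l] by (intro power_increasing) (cases e; auto)+
  ultimately have "c * D \<le> S ^ ((\<Delta> + 2) ^ l) * S ^ (length A * (\<Delta> + 2) ^ l)"
    by (meson mult_le_mono order_trans)
  then show ?case using ac ND 6(3) by (simp add: survival.simps(2) power_add)
qed simp_all

lemma partition_value_bounds:
  assumes "\<forall>u. deg u ES \<le> \<Delta>"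
  shows "0 < snd (partition_value \<Lambda> k ES l) \<and>
    fst (partition_value \<Lambda> k ES l) \<le> S ^ (k * ((\<Delta> + 2) ^ l - 1)) \<and>
    snd (partition_value \<Lambda> k ES l) \<le> S ^ (k * ((\<Delta> + 2) ^ l - 1))"
  using assms
proof (induction k arbitrary: ES)
  case (Suc k)
  obtain a c where ac: "marginal \<Lambda> k ES l = (a, c)" by fastforce
  obtain p q where pq: "partition_value \<Lambda> k (avoiding k ES) l = (p, q)" by fastforce
  have "deg x (avoiding k ES) \<le> \<Delta>" for x
    using Suc.prems[rule_format, of x] deg_avoiding[of x k ES] by linarith
  then have IH: "0 < q" "p \<le> S ^ (k * ((\<Delta> + 2) ^ l - 1))" "q \<le> S ^ (k * ((\<Delta> + 2) ^ l - 1))"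
    using Suc.IH[of "avoiding k ES"] pq by auto
  have c: "c \<le> S ^ ((\<Delta> + 2) ^ l - 1)" "c - a \<le> S ^ ((\<Delta> + 2) ^ l - 1)"
    using size_bounds(1)[OF refl Suc.prems, of k l] ac by auto
  have "a < c" using marginal_range(1)[OF \<Lambda>(1), of k ES l] ac by simp
  moreover have "c * p \<le> S ^ (Suc k * ((\<Delta> + 2) ^ l - 1))"
    using mult_le_mono[OF c(1) IH(2)] by (simp only: power_add[symmetric] mult_Suc)
  moreover have "(c - a) * q \<le> S ^ (Suc k * ((\<Delta> + 2) ^ l - 1))"
    using mult_le_mono[OF c(2) IH(3)] by (simp only: power_add[symmetric] mult_Suc)
  ultimately show ?case using IH(1) ac pq by simp
qed simp

end

section \<open>The program\<close>

text \<open>Truncated subtraction in both directions: the result is 0 exactly for equal numbers,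
  which turns \<open>IfZero\<close> into an equality test.\<close>

abbreviation (input) distance :: "expr \<Rightarrow> expr \<Rightarrow> expr" where
  "distance a b \<equiv> Arith Add (Arith Sub a b) (Arith Sub b a)"

abbreviation (input) "x0 \<equiv> Var 0"
abbreviation (input) "x1 \<equiv> Var (Suc 0)"
abbreviation (input) "x2 \<equiv> Var 2"

text \<open>These numbers are positions in the list \<open>program\<close>.\<close>

abbreviation (input) "MAIN \<equiv> 0"
abbreviation (input) "MEMBER \<equiv> Suc 0"
abbreviation (input) "DELETE \<equiv> 2"
abbreviation (input) "SHRINK \<equiv> 3"
abbreviation (input) "TOUCHED \<equiv> 4"
abbreviation (input) "AVOIDING \<equiv> 5"
abbreviation (input) "LENGTH \<equiv> 6"
abbreviation (input) "MARGINAL \<equiv> 7"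
abbreviation (input) "EDGE \<equiv> 8"
abbreviation (input) "SURVIVAL \<equiv> 9"
abbreviation (input) "PARTITION \<equiv> 10"
abbreviation (input) "HAS_EMPTY \<equiv> 11"
abbreviation (input) "PRECISION \<equiv> 12"
abbreviation (input) "BITS \<equiv> 13"
abbreviation (input) "POWER \<equiv> 14"

text \<open>The precision \<open>k\<close> is the first query index whose answer exceeds 1; then \<open>2 ^ k\<close> lies between
  \<open>1 / \<epsilon>\<close> and \<open>4 / \<epsilon>\<close>.\<close>

abbreviation (input) main_body :: "nat \<Rightarrow> nat \<Rightarrow> nat \<Rightarrow> expr" where
  "main_body c0 c1 K \<equiv>
    IfZero (Call HAS_EMPTY (Snd x0))
    (Bind (Arith Add (Call BITS (Fst x0)) (Call PRECISION (Lit 0)))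
      (Bind (Arith Add x0 (Lit K))
        (Call PARTITION (MkPair (Fst x2) (MkPair (Snd x2)
          (MkPair (Arith Mul (Lit c0) (Arith Add x1 (Lit c1)))
            (MkPair (Query Activity x0) (Call POWER x0))))))))
    (MkPair (Lit 0) (Lit 1))"

abbreviation (input) member_body :: expr where
  "member_body \<equiv>
    IfZero (Snd x0) (Lit 0)
    (IfZero (distance (Fst x0) (Fst (Snd x0))) (Lit 1)
      (Call MEMBER (MkPair (Fst x0) (Snd (Snd x0)))))"

text \<open>Inside \<open>Bind\<close>, \<open>x0\<close> is the result for the tail and the
  argument has moved to \<open>x1\<close>.\<close>

abbreviation (input) delete_body :: expr where
  "delete_body \<equiv>
    IfZero (Snd x0) (Lit 0)
    (Bind (Call DELETE (MkPair (Fst x0) (Snd (Snd x0))))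
      (IfZero (distance (Fst x1) (Fst (Snd x1))) x0 (MkPair (Fst (Snd x1)) x0)))"

abbreviation (input) shrink_body :: expr where
  "shrink_body \<equiv>
    IfZero (Snd x0) (Lit 0)
    (MkPair (Call DELETE (MkPair (Fst x0) (Fst (Snd x0))))
      (Call SHRINK (MkPair (Fst x0) (Snd (Snd x0)))))"

abbreviation (input) touched_body :: expr where
  "touched_body \<equiv>
    IfZero (Snd x0) (Lit 0)
    (Bind (Call TOUCHED (MkPair (Fst x0) (Snd (Snd x0))))
      (IfZero (Call MEMBER (MkPair (Fst x1) (Fst (Snd x1)))) x0
        (MkPair (Call DELETE (MkPair (Fst x1) (Fst (Snd x1)))) x0)))"

abbreviation (input) avoiding_body :: expr where
  "avoiding_body \<equiv>
    IfZero (Snd x0) (Lit 0)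
    (Bind (Call AVOIDING (MkPair (Fst x0) (Snd (Snd x0))))
      (IfZero (Call MEMBER (MkPair (Fst x1) (Fst (Snd x1))))
        (MkPair (Fst (Snd x1)) x0) x0))"

abbreviation (input) length_body :: expr where
  "length_body \<equiv>
    IfZero x0 (Lit 0) (Arith Add (Lit 1) (Call LENGTH (Snd x0)))"

text \<open>The argument is nested as vertex, hyperedges, depth, activity. The other recursive
  functions use the same tail, so that depth and activity can be passed on as one shared
  value.\<close>

abbreviation (input) marginal_body :: expr where
  "marginal_body \<equiv>
    IfZero (Fst (Snd (Snd x0))) (MkPair (Lit 0) (Lit 1))
    (Bind (Call SURVIVAL
        (MkPair (Call TOUCHED (MkPair (Fst x0) (Fst (Snd x0))))
          (MkPair (Call AVOIDING (MkPair (Fst x0) (Fst (Snd x0))))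
            (MkPair (Arith Sub (Fst (Snd (Snd x0))) (Lit 1)) (Snd (Snd (Snd x0)))))))
      (Bind (Arith Mul (Fst (Snd (Snd (Snd x1)))) (Fst x0))
        (MkPair x0 (Arith Add x0 (Arith Mul (Snd (Snd (Snd (Snd x2)))) (Snd x1))))))"

abbreviation (input) edge_body :: expr where
  "edge_body \<equiv>
    IfZero (Fst x0) (MkPair (Lit 1) (Lit 1))
    (Bind (Call MARGINAL (MkPair (Fst (Fst x0)) (Snd x0)))
      (Bind (Call EDGE (MkPair (Snd (Fst x1))
          (MkPair (Call SHRINK (MkPair (Fst (Fst x1)) (Fst (Snd x1)))) (Snd (Snd x1)))))
        (MkPair (Arith Mul (Fst x1) (Fst x0)) (Arith Mul (Snd x1) (Snd x0)))))"

abbreviation (input) survival_body :: expr where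
  "survival_body \<equiv>
    IfZero (Fst x0) (MkPair (Lit 1) (Lit 1))
    (Bind (Call EDGE (MkPair (Fst (Fst x0)) (MkPair (Fst (Snd x0))
        (MkPair (Arith Sub (Fst (Snd (Snd x0))) (Arith Sub (Call LENGTH (Fst (Fst x0))) (Lit 1)))
          (Snd (Snd (Snd x0)))))))
      (Bind (Call SURVIVAL (MkPair (Snd (Fst x1))
          (MkPair (MkPair (Fst (Fst x1)) (Fst (Snd x1))) (Snd (Snd x1)))))
        (MkPair (Arith Mul (Arith Sub (Snd x1) (Fst x1)) (Fst x0)) (Arith Mul (Snd x1) (Snd x0)))))"

abbreviation (input) partition_body :: expr where
  "partition_body \<equiv>
    IfZero (Fst x0) (MkPair (Lit 1) (Lit 1))
    (Bind (Arith Sub (Fst x0) (Lit 1))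
      (Bind (Call MARGINAL (MkPair x0 (Snd x1)))
        (Bind (Call PARTITION (MkPair x1 (MkPair
            (Call AVOIDING (MkPair x1 (Fst (Snd x2)))) (Snd (Snd x2)))))
          (MkPair (Arith Mul (Snd x1) (Fst x0))
            (Arith Mul (Arith Sub (Snd x1) (Fst x1)) (Snd x0))))))"

abbreviation (input) has_empty_body :: expr where
  "has_empty_body \<equiv>
    IfZero x0 (Lit 0) (IfZero (Fst x0) (Lit 1) (Call HAS_EMPTY (Snd x0)))"

abbreviation (input) precision_body :: expr where
  "precision_body \<equiv>
    IfZero (Arith Sub (Query Accuracy x0) (Lit 1)) (Call PRECISION (Arith Add x0 (Lit 1))) x0"

abbreviation (input) bits_body :: expr where
  "bits_body \<equiv>
    IfZero x0 (Lit 0) (Arith Add (Lit 1) (Call BITS (Arith Div x0 (Lit 2))))"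

abbreviation (input) power_body :: expr where
  "power_body \<equiv>
    IfZero x0 (Lit 1) (Arith Mul (Lit 2) (Call POWER (Arith Sub x0 (Lit 1))))"

definition program :: "nat \<Rightarrow> nat \<Rightarrow> nat \<Rightarrow> prog" where
  "program c0 c1 K = [main_body c0 c1 K, member_body, delete_body, shrink_body, touched_body,
    avoiding_body, length_body, marginal_body, edge_body, survival_body,
    partition_body, has_empty_body, precision_body, bits_body, power_body]"

lemma length_program: "length (program c0 c1 K) = 15"
  by (simp add: program_def)

section \<open>Evaluation with a bound on the cost\<close>

text \<open>An upper bound on the cost, so that estimates for called functions can be inserted
  without knowing exact costs.\<close>

definition evals :: "prog \<Rightarrow> access \<Rightarrow> val list \<Rightarrow> expr \<Rightarrow> val \<Rightarrow> nat \<Rightarrow> bool" where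
  "evals P acc env e v T \<longleftrightarrow> (\<exists>t\<le>T. eval P acc env e v t)"

definition computes :: "prog \<Rightarrow> access \<Rightarrow> nat \<Rightarrow> val \<Rightarrow> val \<Rightarrow> nat \<Rightarrow> bool" where
  "computes P acc f u v T \<longleftrightarrow> f < length P \<and> evals P acc [u] (P ! f) v T"

text \<open>Postpones the choice of the branch until the value of the condition is known, so that
  rules can be selected by the shape of that value.\<close>

definition branch :: "prog \<Rightarrow> access \<Rightarrow> val \<Rightarrow> val list \<Rightarrow> expr \<Rightarrow> expr \<Rightarrow> val \<Rightarrow> nat \<Rightarrow> bool" where
  "branch P acc u env a b v T \<longleftrightarrow> evals P acc env (if u = Num 0 then a else b) v T"

text \<open>Value and cost of the body stay schematic while the evaluation rules run; the last two
  premises then compare them with the claim.\<close>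

lemma computesI:
  assumes "P ! f = body" "f < length P" "evals P acc [u] body v T" "v = v'" "T \<le> T'"
  shows "computes P acc f u v' T'"
  using assms order_trans by (fastforce simp: computes_def evals_def)

lemma computes_mono: "computes P acc f u v T \<Longrightarrow> T \<le> T' \<Longrightarrow> computes P acc f u v T'"
  using order_trans by (fastforce simp: computes_def evals_def)

context
  fixes P :: prog and acc :: access
begin

lemma evals_vars:
  "evals P acc (x # env) x0 x 1"
  "evals P acc (x # y # env) x1 y 1"
  "evals P acc (x # y # z # env) x2 z 1"
  using eval.Var[of 0 "x # env" P acc] eval.Var[of "Suc 0" "x # y # env" P acc]
    eval.Var[of 2 "x # y # z # env" P acc]
  by (auto simp: evals_def)

lemma evals_Lit: "evals P acc env (Lit n) (Num n) 1"
  using eval.Lit by (force simp: evals_def)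

lemma evals_Bind:
  "evals P acc env a u s \<Longrightarrow> evals P acc (u # env) b v t \<Longrightarrow> evals P acc env (Bind a b) v (1 + s + t)"
  unfolding evals_def by (elim exE conjE) (rule exI, rule conjI[rotated], erule (1) eval.Bind, simp)

lemma evals_Arith:
  "evals P acc env a (Num m) s \<Longrightarrow> evals P acc env b (Num n) t \<Longrightarrow>
    evals P acc env (Arith f a b) (Num (apply_arith f m n)) (1 + s + t + bits m + bits n)"
  unfolding evals_def by (elim exE conjE) (rule exI, rule conjI[rotated], erule (1) eval.Arith, simp)

lemmas evals_arith = evals_Arith[where f = Add, simplified] evals_Arith[where f = Sub, simplified]
  evals_Arith[where f = Mul, simplified] evals_Arith[where f = Div, simplified]

lemma evals_MkPair:
  "evals P acc env a u s \<Longrightarrow> evals P acc env b v t \<Longrightarrow> evals P acc env (MkPair a b) (Pair u v) (1 + s + t)"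
  unfolding evals_def by (elim exE conjE) (rule exI, rule conjI[rotated], erule (1) eval.MkPair, simp)

lemma evals_Fst: "evals P acc env a (Pair u v) s \<Longrightarrow> evals P acc env (Fst a) u (1 + s)"
  unfolding evals_def by (elim exE conjE) (rule exI, rule conjI[rotated], erule eval.Fst, simp)

lemma evals_Snd: "evals P acc env a (Pair u v) s \<Longrightarrow> evals P acc env (Snd a) v (1 + s)"
  unfolding evals_def by (elim exE conjE) (rule exI, rule conjI[rotated], erule eval.Snd, simp)

lemma evals_Call:
  "evals P acc env a u s \<Longrightarrow> computes P acc f u v t \<Longrightarrow> evals P acc env (Call f a) v (1 + s + t)"
  unfolding evals_def computes_def
  by (elim exE conjE) (rule exI, rule conjI[rotated], erule (2) eval.Call, simp)

lemma evals_Query: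
  "evals P acc env a (Num k) s \<Longrightarrow>
    evals P acc env (Query r a) (Num (acc r k)) (1 + s + k + bits (acc r k))"
  unfolding evals_def by (elim exE conjE) (rule exI, rule conjI[rotated], erule eval.Query, simp)

lemma evals_IfZero:
  "evals P acc env c u s \<Longrightarrow> branch P acc u env a b v t \<Longrightarrow> evals P acc env (IfZero c a b) v (1 + s + t)"
  unfolding evals_def branch_def
  by (elim exE conjE, cases "u = Num 0")
     (rule exI, rule conjI[rotated], simp, erule (1) eval.IfZero_True, simp,
      rule exI, rule conjI[rotated], simp, erule (2) eval.IfZero_False, simp)

lemma branch_0: "evals P acc env a v t \<Longrightarrow> branch P acc (Num 0) env a b v t"
  by (simp add: branch_def)

lemma branch_Pair: "evals P acc env b v t \<Longrightarrow> branch P acc (Pair p q) env a b v t"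
  by (simp add: branch_def)

lemma branch_zero: "m = 0 \<Longrightarrow> evals P acc env a v t \<Longrightarrow> branch P acc (Num m) env a b v t"
  by (simp add: branch_def)

lemma branch_nonzero: "m \<noteq> 0 \<Longrightarrow> evals P acc env b v t \<Longrightarrow> branch P acc (Num m) env a b v t"
  by (simp add: branch_def)

end

lemmas evals_rules = evals_vars evals_Lit evals_Bind evals_arith evals_MkPair evals_Fst evals_Snd
  evals_Call evals_Query evals_IfZero branch_0 branch_Pair

section \<open>List operations\<close>

definition enc_edge :: "nat list \<Rightarrow> val" where
  "enc_edge e = val_of_list (map Num e)"

definition enc_edges :: "nat list list \<Rightarrow> val" where
  "enc_edges ES = val_of_list (map enc_edge ES)"

definition enc_frac :: "nat \<times> nat \<Rightarrow> val" where
  "enc_frac p = Pair (Num (fst p)) (Num (snd p))"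

lemma enc_edge_simps: "enc_edge [] = Num 0" "enc_edge (v # e) = Pair (Num v) (enc_edge e)"
  by (simp_all add: enc_edge_def)

lemma enc_edges_simps: "enc_edges [] = Num 0" "enc_edges (e # ES) = Pair (enc_edge e) (enc_edges ES)"
  by (simp_all add: enc_edges_def)

lemma enc_frac_Pair: "enc_frac (a, c) = Pair (Num a) (Num c)"
  by (simp add: enc_frac_def)

lemma bits_le_self: "bits n \<le> n"
  by (rule floorlog_leI) auto

lemma bits_le: "n \<le> N \<Longrightarrow> bits n \<le> N"
  using bits_le_self order_trans by blast

definition sized :: "nat \<Rightarrow> nat \<Rightarrow> nat list list \<Rightarrow> bool" where
  "sized N M ES \<longleftrightarrow> length ES \<le> M \<and> (\<forall>e\<in>set ES. length e \<le> N \<and> set e \<subseteq> {..<N})"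

context
  fixes c0 c1 K :: nat and acc :: access
begin

abbreviation "computes' \<equiv> computes (program c0 c1 K) acc"

text \<open>The factor \<open>N + 1\<close> pays for the bit lengths, each bounded by the number
  itself. The numerical constants here and below are generous.\<close>

lemma computes_MEMBER:
  assumes "v \<le> N" "set e \<subseteq> {..<N}"
  shows "computes' MEMBER (Pair (Num v) (enc_edge e)) (Num (if v \<in> set e then 1 else 0))
    (50 * (N + 1) * (length e + 1))"
  using assms(2)
proof (induction e)
  case Nil
  show ?case
    unfolding enc_edge_simps
    by (rule computesI, simp add: program_def, simp add: length_program, (rule evals_rules)+, simp_all)
next
  case (Cons x e)
  have IH: "computes' MEMBER (Pair (Num v) (enc_edge e)) (Num (if v \<in> set e then 1 else 0))
    (50 * (N + 1) * (length e + 1))" using Cons by simp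
  have b: "bits v \<le> N" "bits x \<le> N" "bits (v - x) \<le> N" "bits (x - v) \<le> N"
    using Cons.prems assms by (auto intro!: bits_le)
  show ?case
  proof (cases "v = x")
    case True
    then have z: "v - x + (x - v) = 0" by simp
    show ?thesis
      unfolding enc_edge_simps
      by (rule computesI, simp add: program_def, simp add: length_program,
          (rule evals_rules branch_zero[OF z])+) (use True b in \<open>simp_all add: algebra_simps\<close>)
  next
    case False
    then have z: "v - x + (x - v) \<noteq> 0" by simp
    show ?thesis
      unfolding enc_edge_simps
      by (rule computesI, simp add: program_def, simp add: length_program,
          (rule evals_rules branch_nonzero[OF z] IH)+) (use False b in \<open>simp_all add: algebra_simps\<close>)
  qed
qed

lemma computes_DELETE:
  assumes "v \<le> N" "set e \<subseteq> {..<N}"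
  shows "computes' DELETE (Pair (Num v) (enc_edge e)) (enc_edge (removeAll v e))
    (60 * (N + 1) * (length e + 1))"
  using assms(2)
proof (induction e)
  case Nil
  show ?case
    unfolding enc_edge_simps
    by (rule computesI, simp add: program_def, simp add: length_program, (rule evals_rules)+, simp_all add: enc_edge_simps)
next
  case (Cons x e)
  have IH: "computes' DELETE (Pair (Num v) (enc_edge e)) (enc_edge (removeAll v e))
    (60 * (N + 1) * (length e + 1))" using Cons by simp
  have b: "bits v \<le> N" "bits x \<le> N" "bits (v - x) \<le> N" "bits (x - v) \<le> N"
    using Cons.prems assms by (auto intro!: bits_le)
  show ?case
  proof (cases "v = x")
    case True
    then have z: "v - x + (x - v) = 0" by simp
    show ?thesis
      unfolding enc_edge_simps
      by (rule computesI, simp add: program_def, simp add: length_program,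
          (rule evals_rules branch_zero[OF z] IH)+) (use True b in \<open>simp_all add: algebra_simps\<close>)
  next
    case False
    then have z: "v - x + (x - v) \<noteq> 0" by simp
    show ?thesis
      unfolding enc_edge_simps
      by (rule computesI, simp add: program_def, simp add: length_program,
          (rule evals_rules branch_nonzero[OF z] IH)+) (use False b in \<open>simp_all add: algebra_simps enc_edge_simps\<close>)
  qed
qed

lemma computes_SHRINK:
  assumes "v \<le> N" "\<forall>e\<in>set ES. length e \<le> N \<and> set e \<subseteq> {..<N}"
  shows "computes' SHRINK (Pair (Num v) (enc_edges ES)) (enc_edges (shrink v ES))
    (100 * (N + 1) * (N + 1) * (length ES + 1))"
  using assms(2)
proof (induction ES)
  case Nil
  show ?case
    unfolding enc_edges_simps
    by (rule computesI, simp add: program_def, simp add: length_program, (rule evals_rules)+, simp_all add: enc_edges_simps shrink_def)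
next
  case (Cons e ES)
  have IH: "computes' SHRINK (Pair (Num v) (enc_edges ES)) (enc_edges (shrink v ES))
    (100 * (N + 1) * (N + 1) * (length ES + 1))" using Cons by simp
  have "computes' DELETE (Pair (Num v) (enc_edge e)) (enc_edge (removeAll v e)) (60 * (N + 1) * (length e + 1))"
    using Cons.prems assms(1) by (intro computes_DELETE) auto
  then have del: "computes' DELETE (Pair (Num v) (enc_edge e)) (enc_edge (removeAll v e)) (60 * (N + 1) * (N + 1))"
    by (rule computes_mono) (use Cons.prems in simp)
  show ?case
    unfolding enc_edges_simps
    by (rule computesI, simp add: program_def, simp add: length_program,
          (rule evals_rules IH del)+) (simp_all add: algebra_simps shrink_def enc_edges_simps)
qed

lemma computes_TOUCHED:
  assumes "v \<le> N" "\<forall>e\<in>set ES. length e \<le> N \<and> set e \<subseteq> {..<N}"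
  shows "computes' TOUCHED (Pair (Num v) (enc_edges ES)) (enc_edges (touched v ES))
    (200 * (N + 1) * (N + 1) * (length ES + 1))"
  using assms(2)
proof (induction ES)
  case Nil
  show ?case
    unfolding enc_edges_simps
    by (rule computesI, simp add: program_def, simp add: length_program, (rule evals_rules)+, simp_all add: enc_edges_simps touched_def)
next
  case (Cons e ES)
  have IH: "computes' TOUCHED (Pair (Num v) (enc_edges ES)) (enc_edges (touched v ES))
    (200 * (N + 1) * (N + 1) * (length ES + 1))" using Cons by simp
  have "computes' DELETE (Pair (Num v) (enc_edge e)) (enc_edge (removeAll v e)) (60 * (N + 1) * (length e + 1))"
    using Cons.prems assms(1) by (intro computes_DELETE) auto
  then have del: "computes' DELETE (Pair (Num v) (enc_edge e)) (enc_edge (removeAll v e)) (60 * (N + 1) * (N + 1))"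
    by (rule computes_mono) (use Cons.prems in simp)
  have "computes' MEMBER (Pair (Num v) (enc_edge e)) (Num (if v \<in> set e then 1 else 0)) (50 * (N + 1) * (length e + 1))"
    using Cons.prems assms(1) by (intro computes_MEMBER) auto
  then have mem: "computes' MEMBER (Pair (Num v) (enc_edge e)) (Num (if v \<in> set e then 1 else 0)) (50 * (N + 1) * (N + 1))"
    by (rule computes_mono) (use Cons.prems in simp)
  show ?case
  proof (cases "v \<in> set e")
    case True
    then have z: "(if v \<in> set e then 1 else 0) \<noteq> (0::nat)" by simp
    show ?thesis
      unfolding enc_edges_simps
      by (rule computesI, simp add: program_def, simp add: length_program,
            (rule evals_rules branch_nonzero[OF z] IH del mem)+)
         (use True in \<open>simp_all add: algebra_simps touched_def enc_edges_simps\<close>)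
  next
    case False
    then have z: "(if v \<in> set e then 1 else 0) = (0::nat)" by simp
    show ?thesis
      unfolding enc_edges_simps
      by (rule computesI, simp add: program_def, simp add: length_program,
            (rule evals_rules branch_zero[OF z] IH del mem)+)
         (use False in \<open>simp_all add: algebra_simps touched_def enc_edges_simps\<close>)
  qed
qed

lemma computes_AVOIDING:
  assumes "v \<le> N" "\<forall>e\<in>set ES. length e \<le> N \<and> set e \<subseteq> {..<N}"
  shows "computes' AVOIDING (Pair (Num v) (enc_edges ES)) (enc_edges (avoiding v ES))
    (100 * (N + 1) * (N + 1) * (length ES + 1))"
  using assms(2)
proof (induction ES)
  case Nil
  show ?case
    unfolding enc_edges_simps
    by (rule computesI, simp add: program_def, simp add: length_program, (rule evals_rules)+, simp_all add: enc_edges_simps avoiding_def)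
next
  case (Cons e ES)
  have IH: "computes' AVOIDING (Pair (Num v) (enc_edges ES)) (enc_edges (avoiding v ES))
    (100 * (N + 1) * (N + 1) * (length ES + 1))" using Cons by simp
  have "computes' MEMBER (Pair (Num v) (enc_edge e)) (Num (if v \<in> set e then 1 else 0)) (50 * (N + 1) * (length e + 1))"
    using Cons.prems assms(1) by (intro computes_MEMBER) auto
  then have mem: "computes' MEMBER (Pair (Num v) (enc_edge e)) (Num (if v \<in> set e then 1 else 0)) (50 * (N + 1) * (N + 1))"
    by (rule computes_mono) (use Cons.prems in simp)
  show ?case
  proof (cases "v \<in> set e")
    case True
    then have z: "(if v \<in> set e then 1 else 0) \<noteq> (0::nat)" by simp
    show ?thesis
      unfolding enc_edges_simps
      by (rule computesI, simp add: program_def, simp add: length_program,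
            (rule evals_rules branch_nonzero[OF z] IH mem)+)
         (use True in \<open>simp_all add: algebra_simps avoiding_def enc_edges_simps\<close>)
  next
    case False
    then have z: "(if v \<in> set e then 1 else 0) = (0::nat)" by simp
    show ?thesis
      unfolding enc_edges_simps
      by (rule computesI, simp add: program_def, simp add: length_program,
            (rule evals_rules branch_zero[OF z] IH mem)+)
         (use False in \<open>simp_all add: algebra_simps avoiding_def enc_edges_simps\<close>)
  qed
qed

lemma computes_LENGTH:
  assumes "length e \<le> N"
  shows "computes' LENGTH (enc_edge e) (Num (length e)) (20 * (N + 1) * (length e + 1))"
  using assms
proof (induction e)
  case Nil
  show ?case
    unfolding enc_edge_simps
    by (rule computesI, simp add: program_def, simp add: length_program, (rule evals_rules)+, simp_all)
next
  case (Cons x e)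
  have IH: "computes' LENGTH (enc_edge e) (Num (length e)) (20 * (N + 1) * (length e + 1))" using Cons by simp
  have b: "bits (length e) \<le> N" "bits (Suc 0) \<le> 1"
    using Cons.prems by (auto intro!: bits_le)
  show ?case
    unfolding enc_edge_simps
    by (rule computesI, simp add: program_def, simp add: length_program,
        (rule evals_rules IH)+) (use b in \<open>simp_all add: algebra_simps\<close>)
qed

lemma computes_HAS_EMPTY:
  "computes' HAS_EMPTY (enc_edges ES) (Num (if [] \<in> set ES then 1 else 0)) (10 * (length ES + 1))"
proof (induction ES)
  case Nil
  show ?case
    unfolding enc_edges_simps
    by (rule computesI, simp add: program_def, simp add: length_program, (rule evals_rules)+, simp_all)
next
  case (Cons e ES)
  show ?case
  proof (cases e)
    case Nil
    show ?thesis
      unfolding enc_edges_simps enc_edge_simps Nil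
      by (rule computesI, simp add: program_def, simp add: length_program,
          (rule evals_rules)+) simp_all
  next
    case (Cons x e')
    show ?thesis
      unfolding enc_edges_simps enc_edge_simps Cons
      by (rule computesI, simp add: program_def, simp add: length_program,
          (rule evals_rules Cons.IH)+) simp_all
  qed
qed

lemma computes_BITS: "computes' BITS (Num n) (Num (bits n)) (20 * (n + 1) * (n + 1))"
proof (induction n rule: less_induct)
  case (less n)
  show ?case
  proof (cases "n = 0")
    case True
    show ?thesis
      unfolding True
      by (rule computesI, simp add: program_def, simp add: length_program, (rule evals_rules)+, simp_all add: floorlog_eq_zero_iff)
  next
    case False
    let ?T = "20 * (n div 2 + 1) * (n div 2 + 1)"
    have IH: "computes' BITS (Num (n div 2)) (Num (bits (n div 2))) ?T"
      using False by (intro less.IH) simp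
    have b: "bits n \<le> n" "bits (Suc 0) \<le> 1" "bits 2 \<le> 2" "bits (bits (n div 2)) \<le> n"
      using bits_le_self[of "n div 2"] by (auto intro!: bits_le)
    \<comment> \<open>Halving is exploited in one of the two factors only; this leaves enough room
      for the cost of one step.\<close>
    have "(n div 2 + 1) * (n div 2 + 1) \<le> (n div 2 + 1) * (n + 1)" by (intro mult_le_mono) auto
    also have "2 * ((n div 2 + 1) * (n + 1)) \<le> (n + 2) * (n + 1)"
      using mult_le_mono1[of "2 * (n div 2 + 1)" "n + 2" "n + 1"] by (simp add: mult.assoc)
    finally have T: "?T \<le> 10 * ((n + 2) * (n + 1))" by linarith
    have "1 \<le> n" "n \<le> n * n" using False by auto
    then have n: "12 + n * 32 + n * (n * 10) \<le> n * 40 + n * (n * 20)" by linarith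
    have rec: "bits n = Suc (bits (n div 2))"
      using False by (subst compute_floorlog) simp
    show ?thesis
      by (rule computesI, simp add: program_def, simp add: length_program,
        (rule evals_rules branch_nonzero[OF False] IH)+) (use b T rec n in \<open>simp_all add: algebra_simps\<close>)
  qed
qed

lemma computes_POWER: "computes' POWER (Num n) (Num (2 ^ n)) (20 * (n + 1) * (n + 1))"
proof (induction n)
  case 0
  show ?case
    by (rule computesI, simp add: program_def, simp add: length_program, (rule evals_rules)+, simp_all)
next
  case (Suc n)
  have IH: "computes' POWER (Num (Suc n - Suc 0)) (Num (2 ^ n)) (20 * (n + 1) * (n + 1))"
    using Suc by simp
  have "bits (Suc n) \<le> Suc n" "bits (Suc 0) \<le> 1" "bits 2 \<le> 2"
    by (auto intro!: bits_le)
  moreover have "bits (2 ^ n) \<le> n + 1" by (rule floorlog_leI) auto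
  ultimately have b: "bits (Suc n) \<le> Suc n" "bits (Suc 0) \<le> 1" "bits 2 \<le> 2" "bits (2 ^ n) \<le> n + 1"
    by auto
  show ?case
    by (rule computesI, simp add: program_def, simp add: length_program,
        (rule evals_rules branch_nonzero[OF nat.simps(3)] IH)+) (use b in \<open>simp_all add: algebra_simps\<close>)
qed

text \<open>Before index \<open>k\<close> the answers are at most 1, so the test yields 0 and the
  search goes on. The induction runs downwards from \<open>k\<close>.\<close>

lemma computes_PRECISION:
  assumes acc: "\<And>j. acc Accuracy j \<le> 2 ^ j + 1" and k: "k = (LEAST j. 2 \<le> acc Accuracy j)" "2 \<le> acc Accuracy k"
    and j: "j \<le> k"
  shows "computes' PRECISION (Num j) (Num k) (30 * (k + 1) * (k - j + 1))"
  using j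
proof (induction j rule: inc_induct)
  case base
  have nz: "acc Accuracy k - Suc 0 \<noteq> 0" using k by simp
  have "1 \<le> (2::nat) ^ k" "(2::nat) ^ (k + 2) = 4 * 2 ^ k" by simp_all
  then have "acc Accuracy k < 2 ^ (k + 2)" using acc[of k] by linarith
  then have "bits (acc Accuracy k) \<le> k + 2" by (intro floorlog_leI) auto
  moreover have "bits (Suc 0) \<le> 1" by (rule bits_le) simp
  ultimately have b: "bits (acc Accuracy k) \<le> k + 2" "bits (Suc 0) \<le> 1" .
  show ?case
    by (rule computesI, simp add: program_def, simp add: length_program,
        (rule evals_rules branch_nonzero[OF nz])+) (use b in \<open>simp_all add: algebra_simps\<close>)
next
  case (step j)
  have "\<not> 2 \<le> acc Accuracy j" using step k not_less_Least by blast
  then have z: "acc Accuracy j - Suc 0 = 0" by simp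
  have IH: "computes' PRECISION (Num (j + Suc 0)) (Num k) (30 * (k + 1) * (k - Suc j + 1))"
    using step by simp
  have b: "bits (acc Accuracy j) \<le> 1" "bits (Suc 0) \<le> 1" "bits j \<le> k" "j \<le> k"
    using z step by (auto intro!: bits_le)
  have "30 * (k + 1) * (Suc m + 1) = 30 * (k + 1) * (m + 1) + 30 * (k + 1)" for m
    by (simp add: algebra_simps)
  moreover have "k - j = Suc (k - Suc j)" using step by simp
  ultimately have r: "30 * (k + 1) * (k - j + 1) = 30 * (k + 1) * (k - Suc j + 1) + 30 * (k + 1)"
    by (simp only:)
  show ?case unfolding r
    by (rule computesI, simp add: program_def, simp add: length_program,
        (rule evals_rules branch_zero[OF z] IH)+) (use b in simp_all)
qed

end

section \<open>Cost of the recursion\<close>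

lemma sized_shrink:
  assumes "sized N M ES"
  shows "sized N M (shrink v ES)"
proof -
  have "length (removeAll v e) \<le> N" if "e \<in> set ES" for e
    using assms that length_removeAll_less_eq[of v e] unfolding sized_def by (meson order_trans)
  then show ?thesis using assms by (auto simp: sized_def shrink_def)
qed

lemma sized_avoiding: "sized N M ES \<Longrightarrow> sized N M (avoiding v ES)"
  by (auto simp: sized_def avoiding_def intro: order_trans[OF length_filter_le])

lemma sized_touched_avoiding: "sized N M ES \<Longrightarrow> sized N M (touched v ES @ avoiding v ES)"
proof -
  assume s: "sized N M ES"
  have "length (touched v ES) + length (avoiding v ES) = length ES"
    by (induction ES) (auto simp: touched_def avoiding_def)
  moreover have "length (removeAll v e) \<le> N" if "e \<in> set ES" for e
    using s that length_removeAll_less_eq[of v e] unfolding sized_def by (meson order_trans)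
  ultimately show ?thesis using s by (fastforce simp: sized_def touched_def avoiding_def)
qed

text \<open>\<open>Q\<close> measures the list operations and \<open>\<beta>\<close> bounds the bit length of every number that occurs;
  \<open>W\<close> bounds the cost of a call without its recursive calls, and \<open>U\<close> is charged per node of the tree.\<close>

locale machine =
  fixes c0 c1 K :: nat and acc :: access and \<Delta> N M L S Q \<beta> W U :: nat and \<Lambda> :: "nat \<times> nat"
  assumes \<Lambda>: "0 < fst \<Lambda>" "0 < snd \<Lambda>" "fst \<Lambda> + snd \<Lambda> = S"
    and Q: "Q = (N + 1) * (N + 1) * (M + 1)"
    and \<beta>: "bits (S ^ ((N + 1) * (\<Delta> + 2) ^ L)) \<le> \<beta>"
    and W: "W = 1000 * Q + 200 * (\<beta> + 1)"
    and U: "U = (\<Delta> * (3 * N + 2) + 1) * W"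
begin

abbreviation "run \<equiv> computes (program c0 c1 K) acc"
abbreviation "enc_lam \<equiv> Pair (Num (fst \<Lambda>)) (Num (snd \<Lambda>))"

lemma bits_power: "m \<le> (N + 1) * (\<Delta> + 2) ^ L \<Longrightarrow> n \<le> S ^ m \<Longrightarrow> bits n \<le> \<beta>"
  using \<Lambda> by (intro order_trans[OF floorlog_mono \<beta>]) (erule order_trans, rule power_increasing, auto)

lemma bits_lam: "bits (fst \<Lambda>) \<le> \<beta>" "bits (snd \<Lambda>) \<le> \<beta>"
  using \<Lambda> by (auto intro!: bits_power[of 1] simp: Suc_le_eq)

lemma bits_level: "l \<le> L \<Longrightarrow> bits l \<le> \<beta>"
proof (rule bits_power[of L])
  have "L < (\<Delta> + 2) ^ L" by (rule less_le_trans[OF less_exp power_mono]) auto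
  then show "L \<le> (N + 1) * (\<Delta> + 2) ^ L" by (simp add: trans_le_add2 less_imp_le)
  assume "l \<le> L"
  also have "L \<le> 2 ^ L" by (rule less_imp_le[OF less_exp])
  also have "\<dots> \<le> S ^ L" using \<Lambda> by (intro power_mono) auto
  finally show "l \<le> S ^ L" .
qed

lemma power_level: "l \<le> L \<Longrightarrow> (\<Delta> + 2) ^ l \<le> (\<Delta> + 2) ^ L"
  by (intro power_increasing) auto

lemma level_le: "x \<le> (\<Delta> + 2) ^ L \<Longrightarrow> x \<le> (N + 1) * (\<Delta> + 2) ^ L"
  by (simp add: trans_le_add1)

lemma Q_ge: "1 \<le> Q" "N \<le> Q" "(N + 1) * (N + 1) \<le> Q"
  unfolding Q by (simp_all add: trans_le_add1)

lemma list_op_bound: "n \<le> M \<Longrightarrow> c * (N + 1) * (N + 1) * (n + 1) \<le> c * Q"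
  unfolding Q by (simp only: mult.assoc) (intro mult_le_mono order_refl, simp)

lemma frac_bits:
  assumes "snd p \<le> S ^ m" "fst p \<le> snd p" "m \<le> (N + 1) * (\<Delta> + 2) ^ L"
  shows "bits (fst p) \<le> \<beta>" "bits (snd p) \<le> \<beta>" "bits (snd p - fst p) \<le> \<beta>"
  using assms by (auto intro!: bits_power[of m])

lemma computes_MARGINAL_Suc:
  assumes surv: "run SURVIVAL (Pair (enc_edges (touched v ES)) (Pair (enc_edges (avoiding v ES)) (Pair (Num l) enc_lam)))
      (enc_frac (survival \<Lambda> (touched v ES) (avoiding v ES) l))
      (length (touched v ES) * (U * (\<Delta> + 2) ^ l + (3 * N + 2) * W) + W)"
    and ES: "sized N M ES" "\<forall>u. deg u ES \<le> \<Delta>" and v: "v < N" and l: "Suc l \<le> L"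
  shows "run MARGINAL (Pair (Num v) (Pair (enc_edges ES) (Pair (Num (Suc l)) enc_lam)))
    (enc_frac (marginal \<Lambda> v ES (Suc l))) (U * ((\<Delta> + 2) ^ Suc l - 1) + W)"
proof -
  obtain n D where nD: "survival \<Lambda> (touched v ES) (avoiding v ES) l = (n, D)" by fastforce
  let ?T = "\<Delta> * (U * (\<Delta> + 2) ^ l + (3 * N + 2) * W) + W"
  have len: "length (touched v ES) \<le> \<Delta>" using ES by (simp add: length_touched)
  have "run SURVIVAL (Pair (enc_edges (touched v ES)) (Pair (enc_edges (avoiding v ES)) (Pair (Num l) enc_lam)))
      (enc_frac (n, D)) ?T"
    using surv[unfolded nD] by (rule computes_mono) (intro add_mono mult_le_mono len order_refl)
  then have surv': "run SURVIVAL (Pair (enc_edges (touched v ES)) (Pair (enc_edges (avoiding v ES)) (Pair (Num (Suc l - Suc 0)) enc_lam)))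
      (Pair (Num n) (Num D)) ?T"
    by (simp add: enc_frac_Pair)
  have ES': "\<forall>e\<in>set ES. length e \<le> N \<and> set e \<subseteq> {..<N}" "length ES \<le> M" using ES by (auto simp: sized_def)
  have touch: "run TOUCHED (Pair (Num v) (enc_edges ES)) (enc_edges (touched v ES)) (200 * Q)"
    using computes_TOUCHED[OF less_imp_le[OF v] ES'(1)] by (rule computes_mono) (rule list_op_bound[OF ES'(2)])
  have avoid: "run AVOIDING (Pair (Num v) (enc_edges ES)) (enc_edges (avoiding v ES)) (100 * Q)"
    using computes_AVOIDING[OF less_imp_le[OF v] ES'(1)] by (rule computes_mono) (rule list_op_bound[OF ES'(2)])
  have "deg u (touched v ES) + deg u (avoiding v ES) \<le> \<Delta>" for u
    using ES(2)[rule_format, of u] deg_touched_avoiding[of u v ES] by linarith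
  then have D: "D \<le> S ^ (length (touched v ES) * (\<Delta> + 2) ^ l)"
    using size_bounds(3)[OF \<Lambda>(2) eq_imp_le[OF \<Lambda>(3)] refl, of "touched v ES" "avoiding v ES" \<Delta> l] nD by simp
  have "length (touched v ES) * (\<Delta> + 2) ^ l \<le> (\<Delta> + 2) * (\<Delta> + 2) ^ l"
    using len by (intro mult_le_mono) auto
  also have "\<dots> = (\<Delta> + 2) ^ Suc l" by simp
  also have "\<dots> \<le> (\<Delta> + 2) ^ L" using l by (rule power_level)
  finally have "length (touched v ES) * (\<Delta> + 2) ^ l \<le> (N + 1) * (\<Delta> + 2) ^ L" by (rule level_le)
  then have nDb: "bits n \<le> \<beta>" "bits D \<le> \<beta>"
    using frac_bits[of "(n, D)"] D marginal_range(3)[OF \<Lambda>(2), of "touched v ES" "avoiding v ES" l] nD by auto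
  have "snd (marginal \<Lambda> v ES (Suc l)) \<le> S ^ ((\<Delta> + 2) ^ Suc l - 1)"
    using size_bounds(1)[OF \<Lambda>(2) eq_imp_le[OF \<Lambda>(3)] refl ES(2)] .
  moreover have "(\<Delta> + 2) ^ Suc l - 1 \<le> (N + 1) * (\<Delta> + 2) ^ L"
    using power_level[OF l] by (intro level_le) linarith
  ultimately have "bits x \<le> \<beta>" if "x \<le> snd (marginal \<Lambda> v ES (Suc l))" for x
    using bits_power order_trans that by blast
  then have ab: "bits (fst \<Lambda> * n) \<le> \<beta>" "bits (snd \<Lambda> * D) \<le> \<beta>"
    using nD by (auto simp: marginal.simps(2))
  have l1: "bits (Suc l) \<le> \<beta>" "bits (Suc 0) \<le> 1" using bits_level[OF l] by (auto intro!: bits_le)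
  have "U * (1 + \<Delta> * (\<Delta> + 2) ^ l) \<le> U * ((\<Delta> + 2) ^ Suc l - 1)"
    by (intro mult_le_mono order_refl one_plus_branch_le)
  \<comment> \<open>\<open>U\<close> is chosen as the local cost of a node together with the
    overhead of its at most \<open>\<Delta>\<close> hyperedges.\<close>
  moreover have "U = \<Delta> * ((3 * N + 2) * W) + W" unfolding U by (simp add: algebra_simps)
  then have "U * (1 + y) \<le> h \<Longrightarrow> U * y + \<Delta> * ((3 * N + 2) * W) + W \<le> h" for y h
    unfolding distrib_left mult_1_right by linarith
  ultimately have main: "U * (\<Delta> * (\<Delta> + 2) ^ l) + \<Delta> * ((3 * N + 2) * W) + W \<le> U * ((\<Delta> + 2) ^ Suc l - 1)"
    by blast
  have T: "?T = U * (\<Delta> * (\<Delta> + 2) ^ l) + \<Delta> * ((3 * N + 2) * W) + W"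
    by (simp only: distrib_left mult.left_commute)
  \<comment> \<open>The nonlinear costs are hidden behind variables, so that the remaining
    inequality is linear.\<close>
  obtain t R where tR: "t = ?T" "R = U * ((\<Delta> + 2) ^ Suc l - 1) + W" by blast
  have "t + W \<le> R" unfolding tR using T main by linarith
  show ?thesis unfolding tR(2)[symmetric]
    apply (rule computesI, simp add: program_def, simp add: length_program)
      apply (rule evals_rules branch_nonzero[OF nat.simps(3)] surv'[folded tR(1)] touch avoid)+
     apply (simp add: enc_frac_def marginal.simps(2) nD Let_def)
    using nDb ab l1 Q_ge(1) W bits_lam \<open>t + W \<le> R\<close> by simp
qed

lemma computes_EDGE_Cons:
  assumes marg: "run MARGINAL (Pair (Num u) (Pair (enc_edges H) (Pair (Num l) enc_lam)))
      (enc_frac (marginal \<Lambda> u H l)) (U * ((\<Delta> + 2) ^ l - 1) + W)"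
    and edge: "run EDGE (Pair (enc_edge e) (Pair (enc_edges (shrink u H)) (Pair (Num l) enc_lam)))
      (enc_frac (edge_marginal \<Lambda> e (shrink u H) l)) (length e * (U * ((\<Delta> + 2) ^ l - 1) + 3 * W) + W)"
    and H: "sized N M H" "\<forall>u. deg u H \<le> \<Delta>" and u: "u < N" and l: "l \<le> L"
    and len: "length (u # e) * ((\<Delta> + 2) ^ l - 1) \<le> (\<Delta> + 2) ^ L"
  shows "run EDGE (Pair (enc_edge (u # e)) (Pair (enc_edges H) (Pair (Num l) enc_lam)))
    (enc_frac (edge_marginal \<Lambda> (u # e) H l)) (length (u # e) * (U * ((\<Delta> + 2) ^ l - 1) + 3 * W) + W)"
proof -
  obtain a c where ac: "marginal \<Lambda> u H l = (a, c)" by fastforce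
  obtain a' c' where ac': "edge_marginal \<Lambda> e (shrink u H) l = (a', c')" by fastforce
  note calls = marg[unfolded ac enc_frac_Pair] edge[unfolded ac' enc_frac_Pair]
  have H': "\<forall>e\<in>set H. length e \<le> N \<and> set e \<subseteq> {..<N}" "length H \<le> M" using H by (auto simp: sized_def)
  have shr: "run SHRINK (Pair (Num u) (enc_edges H)) (enc_edges (shrink u H)) (100 * Q)"
    using computes_SHRINK[OF less_imp_le[OF u] H'(1)] by (rule computes_mono) (rule list_op_bound[OF H'(2)])
  have deg: "deg x (shrink u H) \<le> \<Delta>" for x
    using H(2)[rule_format, of x] deg_shrink[of x u H] by linarith
  have "snd (a, c) \<le> S ^ ((\<Delta> + 2) ^ l - 1)" "snd (a', c') \<le> S ^ (length e * ((\<Delta> + 2) ^ l - 1))"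
    using size_bounds(1)[OF \<Lambda>(2) eq_imp_le[OF \<Lambda>(3)] refl H(2), of u l]
      size_bounds(2)[OF \<Lambda>(2) eq_imp_le[OF \<Lambda>(3)] refl, of "shrink u H" \<Delta> e l] deg ac ac' by auto
  moreover have "(\<Delta> + 2) ^ l - 1 \<le> (\<Delta> + 2) ^ L" "length e * ((\<Delta> + 2) ^ l - 1) \<le> (\<Delta> + 2) ^ L"
    using len by auto
  moreover have "fst (a, c) \<le> snd (a, c)" "fst (a', c') \<le> snd (a', c')"
    using marginal_range(1)[OF \<Lambda>(2), of u H l] marginal_range(2)[OF \<Lambda>(2), of e "shrink u H" l] ac ac' by auto
  ultimately have b: "bits a \<le> \<beta>" "bits c \<le> \<beta>" "bits a' \<le> \<beta>" "bits c' \<le> \<beta>"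
    using frac_bits[of "(a, c)", OF _ _ level_le] frac_bits[of "(a', c')", OF _ _ level_le] by auto
  obtain t X where tX: "t = U * ((\<Delta> + 2) ^ l - 1)" "X = length e * (t + 3 * W)" by blast
  have T: "length (u # e) * (t + 3 * W) = X + (t + 3 * W)" by (simp add: tX(2))
  show ?thesis unfolding tX(1)[symmetric] T enc_edge_simps
    apply (rule computesI, simp add: program_def, simp add: length_program)
      apply (rule evals_rules calls[folded tX(1), folded tX(2)] shr)+
     apply (simp add: enc_frac_def edge_marginal.simps(2) ac ac' Let_def)
    using b Q_ge(1) W by simp
qed

lemma computes_SURVIVAL_Cons:
  defines "k e l \<equiv> l - (length e - 1)"
  assumes edge: "run EDGE (Pair (enc_edge e) (Pair (enc_edges H) (Pair (Num (k e l)) enc_lam)))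
      (enc_frac (edge_marginal \<Lambda> e H (k e l))) (length e * (U * ((\<Delta> + 2) ^ k e l - 1) + 3 * W) + W)"
    and surv: "run SURVIVAL (Pair (enc_edges A) (Pair (enc_edges (e # H)) (Pair (Num l) enc_lam)))
      (enc_frac (survival \<Lambda> A (e # H) l)) (length A * (U * (\<Delta> + 2) ^ l + (3 * N + 2) * W) + W)"
    and AH: "sized N M ((e # A) @ H)" "\<forall>u. deg u (e # A) + deg u H \<le> \<Delta>" and l: "Suc l \<le> L"
    and len: "length (e # A) * (\<Delta> + 2) ^ l \<le> (\<Delta> + 2) ^ L"
  shows "run SURVIVAL (Pair (enc_edges (e # A)) (Pair (enc_edges H) (Pair (Num l) enc_lam)))
    (enc_frac (survival \<Lambda> (e # A) H l)) (length (e # A) * (U * (\<Delta> + 2) ^ l + (3 * N + 2) * W) + W)"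
proof -
  obtain a c where ac: "edge_marginal \<Lambda> e H (k e l) = (a, c)" by fastforce
  obtain n D where nD: "survival \<Lambda> A (e # H) l = (n, D)" by fastforce
  have e: "length e \<le> N" using AH by (simp add: sized_def)
  have br: "length e * ((\<Delta> + 2) ^ k e l - 1) \<le> (\<Delta> + 2) ^ l"
    unfolding k_def using budget_nodes[of "\<Delta> + 2" "length e" l] by (cases e) auto
  \<comment> \<open>By \<open>budget_nodes\<close> the reduced depth lets the whole hyperedge be
    charged like a single subtree of depth \<open>l\<close>.\<close>
  have "length e * (U * ((\<Delta> + 2) ^ k e l - 1) + 3 * W) + W \<le> U * (\<Delta> + 2) ^ l + (3 * N + 1) * W"
  proof -
    have "U * (length e * ((\<Delta> + 2) ^ k e l - 1)) \<le> U * (\<Delta> + 2) ^ l" using br by (rule mult_le_mono2)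
    moreover have "length e * (3 * W) \<le> N * (3 * W)" using e by (rule mult_le_mono1)
    moreover have "length e * (U * g + 3 * W) + W = U * (length e * g) + length e * (3 * W) + W"
      "U * h + (3 * N + 1) * W = U * h + N * (3 * W) + W" for g h
      by (simp_all add: algebra_simps)
    ultimately show ?thesis by (metis add_le_mono order_refl)
  qed
  then have edge': "run EDGE (Pair (enc_edge e) (Pair (enc_edges H) (Pair (Num (l - (length e - Suc 0))) enc_lam)))
      (Pair (Num a) (Num c)) (U * (\<Delta> + 2) ^ l + (3 * N + 1) * W)"
    using computes_mono[OF edge] ac by (simp add: k_def enc_frac_Pair)
  note surv' = surv[unfolded nD enc_frac_Pair enc_edges_simps]
  have lengthe: "run LENGTH (enc_edge e) (Num (length e)) (20 * Q)"
    using computes_LENGTH[OF e]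
  proof (rule computes_mono)
    have "20 * (N + 1) * (length e + 1) \<le> 20 * ((N + 1) * (N + 1))"
      using e by (simp only: mult.assoc) (intro mult_le_mono; simp)
    then show "20 * (N + 1) * (length e + 1) \<le> 20 * Q" using Q_ge by linarith
  qed
  have deg: "deg u H \<le> \<Delta>" "deg u A + deg u (e # H) \<le> \<Delta>" for u
    using AH(2)[rule_format, of u] by (auto simp: deg_Cons)
  have "snd (a, c) \<le> S ^ (length e * ((\<Delta> + 2) ^ k e l - 1))" "snd (n, D) \<le> S ^ (length A * (\<Delta> + 2) ^ l)"
    using size_bounds(2)[OF \<Lambda>(2) eq_imp_le[OF \<Lambda>(3)] refl, of H \<Delta> e "k e l"]
      size_bounds(3)[OF \<Lambda>(2) eq_imp_le[OF \<Lambda>(3)] refl, of A "e # H" \<Delta> l] deg ac nD by auto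
  moreover have "length e * ((\<Delta> + 2) ^ k e l - 1) \<le> (\<Delta> + 2) ^ L" "length A * (\<Delta> + 2) ^ l \<le> (\<Delta> + 2) ^ L"
    using br len by auto
  moreover have "fst (a, c) \<le> snd (a, c)" "fst (n, D) \<le> snd (n, D)"
    using marginal_range(2)[OF \<Lambda>(2), of e H "k e l"] marginal_range(3)[OF \<Lambda>(2), of A "e # H" l] ac nD by auto
  ultimately have b: "bits a \<le> \<beta>" "bits c \<le> \<beta>" "bits (c - a) \<le> \<beta>" "bits n \<le> \<beta>" "bits D \<le> \<beta>"
    using frac_bits[of "(a, c)", OF _ _ level_le] frac_bits[of "(n, D)", OF _ _ level_le] by auto
  have b2: "bits l \<le> \<beta>" "bits (length e) \<le> N" "bits (length e - Suc 0) \<le> N" "bits (Suc 0) \<le> 1"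
    using bits_level[of l] l e by (auto intro!: bits_le)
  obtain X Y where XY: "X = U * (\<Delta> + 2) ^ l + (3 * N + 1) * W" "Y = length A * (U * (\<Delta> + 2) ^ l + (3 * N + 2) * W)" by blast
  have T: "length (e # A) * (U * (\<Delta> + 2) ^ l + (3 * N + 2) * W) = Y + X + W"
    by (simp add: XY algebra_simps)
  show ?thesis unfolding T enc_edges_simps
    apply (rule computesI, simp add: program_def, simp add: length_program)
      apply (rule evals_rules edge'[folded XY(1)] surv'[folded XY(2)] lengthe)+
     apply (simp add: enc_frac_def survival.simps(2) Let_def ac[unfolded k_def One_nat_def] nD)
    using b b2 Q_ge(1,2) W by simp
qed

lemma length_mult_power_le:
  assumes "n \<le> \<Delta>" "Suc l \<le> L"
  shows "n * (\<Delta> + 2) ^ l \<le> (\<Delta> + 2) ^ L"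
proof -
  have "n * (\<Delta> + 2) ^ l \<le> (\<Delta> + 2) * (\<Delta> + 2) ^ l"
    using assms by (intro mult_le_mono) auto
  also have "\<dots> = (\<Delta> + 2) ^ Suc l" by simp
  also have "\<dots> \<le> (\<Delta> + 2) ^ L" using assms(2) by (rule power_level)
  finally show ?thesis .
qed

text \<open>The premises on \<open>length e\<close> and \<open>length A\<close> bound the exponents
  from \<open>size_bounds\<close>, so every number has at most \<open>\<beta>\<close> bits.\<close>

lemma computes_recursion:
  shows "lam = \<Lambda> \<Longrightarrow> sized N M ES \<Longrightarrow> \<forall>u. deg u ES \<le> \<Delta> \<Longrightarrow> v < N \<Longrightarrow> l \<le> L \<Longrightarrow>
      run MARGINAL (Pair (Num v) (Pair (enc_edges ES) (Pair (Num l) enc_lam)))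
        (enc_frac (marginal \<Lambda> v ES l)) (U * ((\<Delta> + 2) ^ l - 1) + W)"
    and "lam = \<Lambda> \<Longrightarrow> sized N M H \<Longrightarrow> \<forall>u. deg u H \<le> \<Delta> \<Longrightarrow> set e \<subseteq> {..<N} \<Longrightarrow> l \<le> L \<Longrightarrow>
      length e * ((\<Delta> + 2) ^ l - 1) \<le> (\<Delta> + 2) ^ L \<Longrightarrow>
      run EDGE (Pair (enc_edge e) (Pair (enc_edges H) (Pair (Num l) enc_lam)))
        (enc_frac (edge_marginal \<Lambda> e H l)) (length e * (U * ((\<Delta> + 2) ^ l - 1) + 3 * W) + W)"
    and "lam = \<Lambda> \<Longrightarrow> sized N M (A @ H) \<Longrightarrow> \<forall>u. deg u A + deg u H \<le> \<Delta> \<Longrightarrow> Suc l \<le> L \<Longrightarrow>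
      length A * (\<Delta> + 2) ^ l \<le> (\<Delta> + 2) ^ L \<Longrightarrow>
      run SURVIVAL (Pair (enc_edges A) (Pair (enc_edges H) (Pair (Num l) enc_lam)))
        (enc_frac (survival \<Lambda> A H l)) (length A * (U * (\<Delta> + 2) ^ l + (3 * N + 2) * W) + W)"
proof (induction lam v ES l and lam e H l and lam A H l rule: marginal_edge_marginal_survival.induct)
  case (1 lam v ES)
  show ?case
    apply (rule computesI, simp add: program_def, simp add: length_program)
      apply (rule evals_rules)+
     apply (simp add: enc_frac_def)
    using W by simp
next
  case (2 lam v ES l)
  have "deg u (touched v ES) + deg u (avoiding v ES) \<le> \<Delta>" for u
    using 2(4)[rule_format, of u] deg_touched_avoiding[of u v ES] by linarith
  moreover have "length (touched v ES) \<le> \<Delta>" using 2(4) by (simp add: length_touched)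
  ultimately show ?case
    by (intro computes_MARGINAL_Suc 2 allI sized_touched_avoiding length_mult_power_le)
next
  case (3 lam H l)
  show ?case
    unfolding enc_edge_simps
    apply (rule computesI, simp add: program_def, simp add: length_program)
      apply (rule evals_rules)+
     apply (simp add: enc_frac_def)
    using W by simp
next
  case (4 lam u e H l)
  obtain a c where ac: "(a, c) = marginal lam u H l" by (metis surj_pair)
  have deg: "\<forall>x. deg x (shrink u H) \<le> \<Delta>"
    using 4(5) deg_shrink le_trans by metis
  have len: "length e * ((\<Delta> + 2) ^ l - 1) \<le> (\<Delta> + 2) ^ L" using 4(8) by simp
  have u: "u < N" "set e \<subseteq> {..<N}" using 4(6) by auto
  show ?case
    using 4(1)[OF 4(3,4,5) u(1) 4(7)] 4(2)[OF ac refl 4(3) sized_shrink[OF 4(4)] deg u(2) 4(7) len]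
    by (rule computes_EDGE_Cons[OF _ _ 4(4,5) u(1) 4(7,8)])
next
  case (5 lam H l)
  show ?case
    unfolding enc_edges_simps
    apply (rule computesI, simp add: program_def, simp add: length_program)
      apply (rule evals_rules)+
     apply (simp add: enc_frac_def)
    using W by simp
next
  case (6 lam e A H l)
  let ?l = "l - (length e - 1)"
  obtain a c where ac: "(a, c) = edge_marginal lam e H ?l" by (metis surj_pair)
  have "deg u H \<le> \<Delta> \<and> deg u A + deg u (e # H) \<le> \<Delta>" for u
    using 6(5)[rule_format, of u] by (auto simp: deg_Cons split: if_splits)
  then have deg: "\<forall>u. deg u H \<le> \<Delta>" "\<forall>u. deg u A + deg u (e # H) \<le> \<Delta>" by blast+
  have sz: "sized N M H" "set e \<subseteq> {..<N}" "sized N M (A @ e # H)" using 6(4) by (auto simp: sized_def)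
  have len: "length A * (\<Delta> + 2) ^ l \<le> (\<Delta> + 2) ^ L" using 6(7) by simp
  have br: "length e * ((\<Delta> + 2) ^ ?l - 1) \<le> (\<Delta> + 2) ^ l"
    using budget_nodes[of "\<Delta> + 2" "length e" l] by (cases e) auto
  also have "\<dots> \<le> (\<Delta> + 2) ^ L" using 6(6) by (intro power_level) simp
  finally have br: "length e * ((\<Delta> + 2) ^ ?l - 1) \<le> (\<Delta> + 2) ^ L" .
  have l: "?l \<le> L" using 6(6) by simp
  show ?case
    using 6(1)[OF 6(3) sz(1) deg(1) sz(2) l br] 6(2)[OF ac refl 6(3) sz(3) deg(2) 6(6) len]
    by (rule computes_SURVIVAL_Cons[OF _ _ 6(4,5,6,7)])
qed

lemma computes_PARTITION:
  assumes "sized N M ES" "\<forall>u. deg u ES \<le> \<Delta>" "k \<le> N" "l \<le> L"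
  shows "run PARTITION (Pair (Num k) (Pair (enc_edges ES) (Pair (Num l) enc_lam)))
    (enc_frac (partition_value \<Lambda> k ES l)) (k * (U * (\<Delta> + 2) ^ l + 4 * W) + W)"
  using assms(1-3)
proof (induction k arbitrary: ES)
  case 0
  show ?case
    apply (rule computesI, simp add: program_def, simp add: length_program)
      apply (rule evals_rules)+
     apply (simp add: enc_frac_def)
    using W by simp
next
  case (Suc k)
  let ?H = "avoiding k ES"
  obtain a c where ac: "marginal \<Lambda> k ES l = (a, c)" by fastforce
  obtain p q where pq: "partition_value \<Lambda> k ?H l = (p, q)" by fastforce
  obtain t X where tX: "t = U * (\<Delta> + 2) ^ l" "X = k * (t + 4 * W)" by blast
  have k: "k < N" using Suc.prems by simp
  have ES': "\<forall>e\<in>set ES. length e \<le> N \<and> set e \<subseteq> {..<N}" "length ES \<le> M"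
    using Suc.prems by (auto simp: sized_def)
  have deg: "\<forall>u. deg u ?H \<le> \<Delta>" using Suc.prems(2) deg_avoiding le_trans by metis
  have "run MARGINAL (Pair (Num k) (Pair (enc_edges ES) (Pair (Num l) enc_lam))) (Pair (Num a) (Num c))
      (U * ((\<Delta> + 2) ^ l - 1) + W)"
    using computes_recursion(1)[OF refl Suc.prems(1,2) k assms(4)] ac by (simp add: enc_frac_Pair)
  moreover have "U * ((\<Delta> + 2) ^ l - 1) + W \<le> t + W" by (simp add: tX(1))
  ultimately have marg: "run MARGINAL (Pair (Num (Suc k - Suc 0)) (Pair (enc_edges ES) (Pair (Num l) enc_lam)))
      (Pair (Num a) (Num c)) (t + W)"
    by (simp add: computes_mono)
  have IH: "run PARTITION (Pair (Num (Suc k - Suc 0)) (Pair (enc_edges ?H) (Pair (Num l) enc_lam)))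
      (Pair (Num p) (Num q)) (X + W)"
    using Suc.IH[OF sized_avoiding[OF Suc.prems(1)] deg] k pq tX by (simp add: enc_frac_Pair)
  have avoid: "run AVOIDING (Pair (Num (Suc k - Suc 0)) (enc_edges ES)) (enc_edges ?H) (100 * Q)"
    using computes_mono[OF computes_AVOIDING[OF less_imp_le[OF k] ES'(1)] list_op_bound[OF ES'(2)]] by simp
  have "bits x \<le> \<beta>" if "x \<le> c" for x
  proof (rule bits_power)
    show "x \<le> S ^ ((\<Delta> + 2) ^ l - 1)"
      using size_bounds(1)[OF \<Lambda>(2) eq_imp_le[OF \<Lambda>(3)] refl Suc.prems(2), of k l] ac that by simp
    show "(\<Delta> + 2) ^ l - 1 \<le> (N + 1) * (\<Delta> + 2) ^ L"
      using power_level[OF assms(4)] by (intro level_le) linarith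
  qed
  moreover have "a \<le> c" using marginal_range(1)[OF \<Lambda>(2), of k ES l] ac by simp
  moreover have "bits x \<le> \<beta>" if "x \<le> p \<or> x \<le> q" for x
  proof (rule bits_power)
    show "x \<le> S ^ (k * ((\<Delta> + 2) ^ l - 1))"
      using partition_value_bounds[OF \<Lambda>(2) eq_imp_le[OF \<Lambda>(3)] deg, of k l] pq that by auto
    show "k * ((\<Delta> + 2) ^ l - 1) \<le> (N + 1) * (\<Delta> + 2) ^ L"
      using power_level[OF assms(4)] k by (intro mult_le_mono order_trans[OF diff_le_self]) auto
  qed
  ultimately have b: "bits a \<le> \<beta>" "bits c \<le> \<beta>" "bits (c - a) \<le> \<beta>" "bits p \<le> \<beta>" "bits q \<le> \<beta>" by auto
  have b2: "bits (Suc k) \<le> N" "bits (Suc 0) \<le> 1" using k by (auto intro!: bits_le)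
  have T: "Suc k * (t + 4 * W) = X + (t + 4 * W)" by (simp add: tX(2))
  show ?case unfolding tX(1)[symmetric] T
    apply (rule computesI, simp add: program_def, simp add: length_program)
      apply (rule evals_rules branch_nonzero[OF nat.simps(3)] marg IH avoid)+
     apply (simp add: enc_frac_def ac pq Let_def)
    using b b2 Q_ge(1,2) W by simp
qed

text \<open>\<open>m\<close> is of the order of the logarithm of \<open>N / eps\<close>; it
  determines both the depth and the precision of the activity. An empty hyperedge is detected
  beforehand and answered by \<open>0 / 1\<close>.\<close>

lemma computes_MAIN:
  assumes ES: "sized N M ES" "\<forall>u. deg u ES \<le> \<Delta>"
    and acc: "\<And>j. acc Accuracy j \<le> 2 ^ j + 1" and k: "k = (LEAST j. 2 \<le> acc Accuracy j)" "2 \<le> acc Accuracy k"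
    and m: "m = bits N + k" and L: "L = c0 * (m + c1)" and \<Lambda>': "\<Lambda> = (acc Activity (m + K), 2 ^ (m + K))"
  shows "run MAIN (Pair (Num N) (enc_edges ES))
    (enc_frac (if [] \<in> set ES then (0, 1) else partition_value \<Lambda> N ES L))
    (N * (U * (\<Delta> + 2) ^ L + 4 * W) + 2 * W + 100 * ((m + K + 1) * (m + K + 1)) + 2 * (c0 + c1))"
proof (cases "[] \<in> set ES")
  case True
  have nz: "(if [] \<in> set ES then 1 else 0) \<noteq> (0::nat)" using True by simp
  have "length ES \<le> Q" using ES(1) by (simp add: sized_def Q trans_le_add1)
  then show ?thesis
    apply -
    apply (rule computesI, simp add: program_def, simp add: length_program)
      apply (rule evals_rules branch_nonzero[OF nz] computes_HAS_EMPTY)+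
     apply (simp add: enc_frac_def True)
    using W Q_ge(1) by simp
next
  case False
  have z: "(if [] \<in> set ES then 1 else 0) = (0::nat)" using False by simp
  have empty: "length ES \<le> Q" using ES(1) by (simp add: sized_def Q trans_le_add1)
  obtain X where X: "X = N * (U * (\<Delta> + 2) ^ L + 4 * W)" by blast
  obtain R where R: "R = (m + K + 1) * (m + K + 1)" by blast
  have sqle: "(j + 1) * (j + 1) \<le> R" if "j \<le> m + K" for j
    unfolding R using that by (intro mult_le_mono) auto
  have part: "run PARTITION (Pair (Num N) (Pair (enc_edges ES) (Pair (Num (c0 * (bits N + k + c1)))
      (Pair (Num (acc Activity (bits N + k + K))) (Num (2 ^ (bits N + k + K)))))))
      (Pair (Num (fst (partition_value \<Lambda> N ES L))) (Num (snd (partition_value \<Lambda> N ES L)))) (X + W)"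
    using computes_PARTITION[OF ES order_refl order_refl] \<Lambda>' L m X by (simp add: enc_frac_def)
  have "(k + 1) * (k + 1) \<le> R" by (rule sqle) (simp add: m)
  then have "30 * (k + 1) * (k - 0 + 1) \<le> 30 * R"
    unfolding mult.assoc minus_nat.diff_0 by (rule mult_le_mono2)
  then have prec: "run PRECISION (Num 0) (Num k) (30 * R)"
    by (rule computes_mono[OF computes_PRECISION[of acc k 0 c0 c1 K, OF acc k(1,2) le0]])
  have pow: "run POWER (Num (bits N + k + K)) (Num (2 ^ (bits N + k + K))) (20 * R)"
    using computes_POWER[of c0 c1 K acc "m + K", unfolded mult.assoc, folded R, unfolded m] .
  have bts: "run BITS (Num N) (Num (bits N)) (20 * Q)"
    by (rule computes_mono[OF computes_BITS[of c0 c1 K acc N, unfolded mult.assoc]])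
      (rule mult_le_mono2[OF Q_ge(3)])
  have "m + K \<le> R" using sqle[of "m + K"] by simp
  then have le: "bits N \<le> R" "k \<le> R" "bits N + k \<le> R" "K \<le> R" "bits N + k + K \<le> R"
    "bits N + k + c1 \<le> R + c1" "1 \<le> R"
    unfolding m by (simp_all add: R)
  note b = bits_le[OF le(1)] bits_le[OF le(2)] bits_le[OF le(3)] bits_le[OF le(4)] le(5)
    bits_le[OF le(6)] le(7) bits_le_self[of c0] bits_le_self[of c1]
  have b2: "bits (acc Activity (bits N + k + K)) \<le> \<beta>"
    using bits_lam(1) by (simp add: \<Lambda>' m)
  show ?thesis unfolding X[symmetric] R[symmetric]
    apply (rule computesI, simp add: program_def, simp add: length_program)
      apply (rule evals_rules branch_zero[OF z] computes_HAS_EMPTY bts prec pow part)+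
     apply (simp add: enc_frac_def False)
    using W Q_ge(1) empty b b2 by simp
qed

end

section \<open>Polynomial bounds\<close>

text \<open>The second argument stands for the precision: \<open>2 ^ k\<close> is of order \<open>1 / \<epsilon>\<close>.\<close>

definition poly_bounded :: "(nat \<Rightarrow> nat \<Rightarrow> nat) \<Rightarrow> bool" where
  "poly_bounded f \<longleftrightarrow> (\<exists>c d. \<forall>n k. f n k \<le> c * (n + 2 ^ k) ^ d)"

lemma poly_bounded_mono:
  assumes "poly_bounded g" "\<And>n k. f n k \<le> g n k"
  shows "poly_bounded f"
  using assms unfolding poly_bounded_def by (meson order_trans)

lemma poly_bounded_const: "poly_bounded (\<lambda>n k. a)"
  unfolding poly_bounded_def by (rule exI[of _ a], rule exI[of _ 0]) simp

lemma poly_bounded_size: "poly_bounded (\<lambda>n k. n)"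
  unfolding poly_bounded_def by (rule exI[of _ 1], rule exI[of _ 1]) simp

lemma poly_bounded_power2: "poly_bounded (\<lambda>n k. 2 ^ k)"
  unfolding poly_bounded_def by (rule exI[of _ 1], rule exI[of _ 1]) simp

lemma poly_bounded_precision: "poly_bounded (\<lambda>n k. k)"
  by (rule poly_bounded_mono[OF poly_bounded_power2]) (simp add: less_imp_le)

lemma poly_bounded_bits: "poly_bounded (\<lambda>n k. bits n)"
  by (rule poly_bounded_mono[OF poly_bounded_size]) (rule bits_le_self)

lemma poly_bounded_add:
  assumes "poly_bounded f" "poly_bounded g"
  shows "poly_bounded (\<lambda>n k. f n k + g n k)"
proof -
  obtain c d c' d' where f: "\<And>n k. f n k \<le> c * (n + 2 ^ k) ^ d" and g: "\<And>n k. g n k \<le> c' * (n + 2 ^ k) ^ d'"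
    using assms unfolding poly_bounded_def by metis
  have "f n k + g n k \<le> (c + c') * (n + 2 ^ k) ^ (d + d')" for n k
  proof -
    have "1 \<le> n + 2 ^ k" by (simp add: trans_le_add2)
    then have "c * (n + 2 ^ k) ^ d \<le> c * (n + 2 ^ k) ^ (d + d')" "c' * (n + 2 ^ k) ^ d' \<le> c' * (n + 2 ^ k) ^ (d + d')"
      by (intro mult_le_mono2 power_increasing; simp)+
    then show ?thesis
      unfolding distrib_right using f[of n k] g[of n k] by (meson add_le_mono order_trans)
  qed
  then show ?thesis unfolding poly_bounded_def by blast
qed

lemma poly_bounded_mult:
  assumes "poly_bounded f" "poly_bounded g"
  shows "poly_bounded (\<lambda>n k. f n k * g n k)"
proof -
  obtain c d c' d' where f: "\<And>n k. f n k \<le> c * (n + 2 ^ k) ^ d" and g: "\<And>n k. g n k \<le> c' * (n + 2 ^ k) ^ d'"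
    using assms unfolding poly_bounded_def by metis
  have "f n k * g n k \<le> (c * c') * (n + 2 ^ k) ^ (d + d')" for n k
    using mult_le_mono[OF f[of n k] g[of n k]] by (simp add: power_add mult_ac)
  then show ?thesis unfolding poly_bounded_def by blast
qed

lemma poly_bounded_power: "poly_bounded f \<Longrightarrow> poly_bounded (\<lambda>n k. f n k ^ a)"
  by (induction a) (auto intro: poly_bounded_const poly_bounded_mult)

lemma two_power_bits_le: "2 ^ bits n \<le> 2 * n + 1"
proof (cases "n = 0")
  case False
  then have "2 ^ (bits n - 1) \<le> n"
    by (intro floorlog_geD) (auto simp: floorlog_eq_zero_iff neq0_conv[symmetric] simp del: neq0_conv)
  moreover have "bits n \<noteq> 0"
    using False by (simp add: floorlog_eq_zero_iff)
  then have "bits n = Suc (bits n - 1)" by simp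
  ultimately show ?thesis by (metis mult_le_mono2 power_Suc trans_le_add1)
next
  case True
  then have "bits n = 0" unfolding floorlog_eq_zero_iff by simp
  then show ?thesis by simp
qed

lemma less_two_power_bits: "n < 2 ^ bits n"
  by (rule floorlog_leD) auto

text \<open>A tree of logarithmic depth has polynomial size. From \<open>?e \<le> 2 ^ ?e\<close> one
  gets \<open>?e ^ j \<le> (2 ^ j) ^ ?e\<close>, a crude degree that avoids logarithms.\<close>

lemma poly_bounded_exp: "poly_bounded (\<lambda>n k. a ^ (c0 * (bits n + k + c1)))"
proof (rule poly_bounded_mono)
  let ?e = "a ^ c0"
  show "poly_bounded (\<lambda>n k. (2 * n + 1) ^ ?e * (2 ^ k) ^ ?e * ?e ^ c1)"
    by (intro poly_bounded_mult poly_bounded_power poly_bounded_add poly_bounded_const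
        poly_bounded_size poly_bounded_power2)
  fix n k
  have "?e \<le> 2 ^ ?e" by (rule less_imp_le[OF less_exp])
  then have p: "?e ^ j \<le> (2 ^ j) ^ ?e" for j
    using power_mono[of ?e "2 ^ ?e" j] by (simp add: mult.commute flip: power_mult)
  have "?e ^ bits n \<le> (2 * n + 1) ^ ?e"
    using order_trans[OF p[of "bits n"] power_mono[OF two_power_bits_le]] by simp
  then have "?e ^ bits n * ?e ^ k * ?e ^ c1 \<le> (2 * n + 1) ^ ?e * (2 ^ k) ^ ?e * ?e ^ c1"
    using p[of k] by (intro mult_le_mono) auto
  then show "a ^ (c0 * (bits n + k + c1)) \<le> (2 * n + 1) ^ ?e * (2 ^ k) ^ ?e * ?e ^ c1"
    by (simp add: power_mult power_add)
qed

lemmas poly_bounded_intros = poly_bounded_add poly_bounded_mult poly_bounded_exp poly_bounded_const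
  poly_bounded_size poly_bounded_precision poly_bounded_bits

section \<open>Encodings of hypergraphs\<close>

lemma hardcore_Z_eq_weight:
  assumes "verts G = V" "edges G = set ` set es"
  shows "hardcore_Z lam G = weight lam V es"
proof -
  have "{I. independent G I} = indep_sets V es"
    using assms by (auto simp: independent_def indep_sets_def)
  then show ?thesis by (simp add: hardcore_Z_def weight_def)
qed

lemma deg_eq_degree:
  assumes "edges G = set ` set es" "distinct (map set es)"
  shows "deg u es = degree G u"
proof -
  have "distinct (map set (filter (\<lambda>e. u \<in> set e) es))" using assms(2) by (rule distinct_map_filter)
  then have "card (set (map set (filter (\<lambda>e. u \<in> set e) es))) = deg u es"
    by (subst distinct_card) (simp_all add: deg_def)
  moreover have "set (map set (filter (\<lambda>e. u \<in> set e) es)) = {e \<in> edges G. u \<in> e}"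
    using assms(1) by auto
  ultimately show ?thesis by (simp add: degree_def)
qed

lemma deg_le_max_degree:
  assumes "is_hypergraph G" "edges G = set ` set es" "distinct (map set es)"
  shows "deg u es \<le> max_degree G"
proof (cases "u \<in> verts G")
  case True
  then show ?thesis
    using assms unfolding deg_eq_degree[OF assms(2,3)] max_degree_def
    by (intro Max_ge) (auto simp: is_hypergraph_def)
next
  case False
  then have "{e \<in> edges G. u \<in> e} = {}" using assms(1) by (auto simp: is_hypergraph_def)
  then show ?thesis unfolding deg_eq_degree[OF assms(2,3)] degree_def by (simp only: card.empty le0)
qed

text \<open>Every nonempty hyperedge contributes at least 1 to the degree sum.\<close>

lemma length_nonempty_le:
  fixes es :: "nat list list"
  assumes "\<forall>e\<in>set es. set e \<subseteq> {..<n}"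
  shows "length (filter (\<lambda>e. e \<noteq> []) es) \<le> (\<Sum>u<n. deg u es)"
  using assms
proof (induction es)
  case (Cons e es)
  have "(\<Sum>u<n. deg u (e # es)) = (\<Sum>u<n. if u \<in> set e then 1 else 0) + (\<Sum>u<n. deg u es)"
    by (simp add: deg_Cons sum.distrib)
  moreover have "1 \<le> (\<Sum>u<n. if u \<in> set e then 1 else (0::nat))" if "e \<noteq> []"
  proof -
    have "hd e \<in> {..<n}" using Cons.prems hd_in_set[OF that] by fastforce
    then show ?thesis
      using member_le_sum[of "hd e" "{..<n}" "\<lambda>u. if u \<in> set e then 1 else (0::nat)"] that by simp
  qed
  ultimately show ?case using Cons by auto
qed simp

text \<open>The running time is measured in the number of vertices only, so the length of the input
  must be bounded by it. The 1 is for a possible empty hyperedge.\<close>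

lemma length_edges_le:
  assumes "distinct es" "\<forall>e\<in>set es. set e \<subseteq> {..<n}" "\<forall>u. deg u es \<le> \<Delta>"
  shows "length es \<le> \<Delta> * n + 1"
proof -
  have "length (filter (\<lambda>e. e = []) es) = card (set (filter (\<lambda>e. e = []) es))"
    using assms(1) by (intro distinct_card[symmetric] distinct_filter)
  also have "\<dots> \<le> card {[] :: nat list}" by (intro card_mono) auto
  finally have "length (filter (\<lambda>e. e = []) es) \<le> 1" by simp
  moreover have "(\<Sum>u<n. deg u es) \<le> (\<Sum>u<n. \<Delta>)" using assms(3) by (intro sum_mono) auto
  moreover have "length es = length (filter (\<lambda>e. e = []) es) + length (filter (\<lambda>e. e \<noteq> []) es)"
    using sum_length_filter_compl[of "\<lambda>e. e = []" es] by simp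
  ultimately show ?thesis using length_nonempty_le[OF assms(2)] by (simp add: mult.commute)
qed

lemma abs_ln_diff_le:
  fixes a b :: real
  assumes "0 < c" "c \<le> a" "c \<le> b"
  shows "\<bar>ln a - ln b\<bar> \<le> \<bar>a - b\<bar> / c"
proof -
  have *: "ln x - ln y \<le> \<bar>x - y\<bar> / c" if "c \<le> x" "c \<le> y" for x y
  proof -
    have "ln x - ln y \<le> (x - y) / y" using assms(1) that by (intro ln_diff_le) auto
    also have "\<dots> \<le> \<bar>x - y\<bar> / y" using assms(1) that by (simp add: divide_right_mono)
    also have "\<dots> \<le> \<bar>x - y\<bar> / c" using assms(1) that by (intro divide_left_mono) auto
    finally show ?thesis .
  qed
  show ?thesis using *[OF assms(2,3)] *[OF assms(3,2)] by (simp add: abs_le_iff abs_minus_commute)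
qed

section \<open>The approximation scheme\<close>

lemma exists_decay:
  fixes \<Delta> :: nat and lam :: real
  assumes "\<Delta> \<ge> 2" and "lam > 0"
    and "\<Delta> > 2 \<Longrightarrow> lam < (real \<Delta> - 1) ^ (\<Delta> - 1) / (real \<Delta> - 2) ^ \<Delta>"
  obtains lam1 rho \<alpha> C where "lam < lam1" "decay (\<Delta> - 1) lam1 rho \<alpha> C"
proof -
  obtain lam1 rho where lr: "lam < lam1" "0 \<le> rho" "rho < 1"
    "lam1 * (real (\<Delta> - 1) - 1) ^ (\<Delta> - 1 + 1) \<le> rho * real (\<Delta> - 1) ^ (\<Delta> - 1)"
  proof (cases "\<Delta> = 2")
    case True
    then show thesis using that[of "lam + 1" 0] by simp
  next
    case False
    define p where "p = (real \<Delta> - 1) ^ (\<Delta> - 1)"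
    define q where "q = (real \<Delta> - 2) ^ \<Delta>"
    have pq: "0 < p" "0 < q" "lam < p / q" using False assms by (auto simp: p_def q_def)
    obtain lam1 where l1: "lam < lam1" "lam1 < p / q" using dense[OF pq(3)] by blast
    have "0 \<le> lam1 * q / p" "lam1 * q / p < 1" using l1 pq assms by (auto simp: field_simps)
    moreover have "real (\<Delta> - 1) = real \<Delta> - 1" "\<Delta> - 1 + 1 = \<Delta>" using assms by auto
    then have "(real (\<Delta> - 1) - 1) ^ (\<Delta> - 1 + 1) = q" "real (\<Delta> - 1) ^ (\<Delta> - 1) = p"
      by (simp_all add: p_def q_def)
    ultimately show thesis using that[of lam1 "lam1 * q / p"] l1 pq by simp
  qed
  define \<kappa> where "\<kappa> = sqrt ((rho + lam1) / (1 + lam1))"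
  have l1: "0 < lam1" using lr assms by simp
  have \<kappa>: "\<kappa> < 1" using lr l1 by (simp add: \<kappa>_def)
  define \<gamma> where "\<gamma> = sqrt (lam1 / (1 + lam1))"
  have \<gamma>: "0 < \<gamma>" "\<gamma> < 1" using l1 by (auto simp: \<gamma>_def)
  obtain C where C: "0 \<le> C" "tanh C = \<gamma>" using obtain_artanh[of \<gamma>] \<gamma> by auto
  have d: "0 < real (\<Delta> - 1)" using assms by simp
  have "0 < (1 - \<kappa>) / real (\<Delta> - 1)" using \<kappa> d by simp
  then obtain \<alpha> where \<alpha>: "0 < \<alpha>" "\<alpha> < 1" "\<And>w. \<gamma> ^ w * (1 / \<alpha>) ^ w \<le> 1"
    "\<And>u w. 0 \<le> u \<Longrightarrow> u \<le> \<gamma> ^ w \<Longrightarrow> u * (1 / \<alpha>) ^ w \<le> u + (1 - \<kappa>) / real (\<Delta> - 1)"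
    using geometric_slack[OF \<gamma>] by metis
  have "decay (\<Delta> - 1) lam1 rho \<alpha> C"
  proof
    show "(tanh C)\<^sup>2 = lam1 / (1 + lam1)" using l1 by (simp add: C \<gamma>_def)
  qed (use lr l1 assms C \<alpha> in \<open>auto simp: \<kappa>_def\<close>)
  then show thesis using that lr by blast
qed

theorem theorem1:
  fixes \<Delta> :: nat and lam :: real
  assumes "\<Delta> \<ge> 2" and "lam > 0"
    and "\<Delta> > 2 \<Longrightarrow> lam < (real \<Delta> - 1) ^ (\<Delta> - 1) / (real \<Delta> - 2) ^ \<Delta>"
  shows "\<exists>P. is_fptas lam (\<lambda>G. is_hypergraph G \<and> max_degree G \<le> \<Delta>) (hardcore_Z lam) P"
proof -
  obtain lam1 rho \<alpha> C where lam_less: "lam < lam1" and dec: "decay (\<Delta> - 1) lam1 rho \<alpha> C"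
    using exists_decay assms by metis
  interpret decay "\<Delta> - 1" lam1 rho \<alpha> C by (rule dec)
  \<comment> \<open>Each unit of \<open>bits n + k + c1\<close> buys \<open>c0\<close> levels, which
    more than halve the error.\<close>
  obtain c0 where c0: "\<alpha> ^ c0 < 1 / 2" using real_arch_pow_inv[of "1 / 2" \<alpha>] \<alpha> by auto
  then have "c0 \<noteq> 0" by (intro notI) simp
  \<comment> \<open>\<open>c1\<close> absorbs the constants of the truncation error. Passing to
    \<open>Suc c1'\<close> makes it nonzero, so the depth is always positive.\<close>
  obtain c1' where "4 * real \<Delta> * C < 2 ^ c1'" using real_arch_pow[of 2 "4 * real \<Delta> * C"] by auto
  also have "(2::real) ^ c1' \<le> 2 ^ Suc c1'" by simp
  finally obtain c1 where c1: "4 * real \<Delta> * C < 2 ^ c1" "c1 \<noteq> 0" by blast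
  \<comment> \<open>\<open>lam1 - lam\<close> keeps the rational activity below \<open>lam1\<close>.
    \<open>lam / 4\<close> keeps it above \<open>lam / 2\<close> and limits its effect on the
    logarithm of the result to half of \<open>1 / 2 ^ k\<close>.\<close>
  have "0 < min (lam / 4) (lam1 - lam)" using lam_less assms(2) by simp
  then obtain K where K: "(1 / 2 :: real) ^ K < min (lam / 4) (lam1 - lam)"
    using real_arch_pow_inv[of "min (lam / 4) (lam1 - lam)" "1 / 2"] by fastforce
  obtain s where s: "lam + 2 < 2 ^ s" using real_arch_pow[of 2 "lam + 2"] by auto
  define L where "L n k = c0 * (bits n + k + c1)" for n k
  define Q where "Q n = (n + 1) * (n + 1) * (\<Delta> * n + 1 + 1)" for n
  define \<beta> where "\<beta> n k = (bits n + k + K + s) * ((n + 1) * (\<Delta> + 2) ^ L n k) + 1" for n k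
  define W where "W n k = 1000 * Q n + 200 * (\<beta> n k + 1)" for n k
  define U where "U n k = (\<Delta> * (3 * n + 2) + 1) * W n k" for n k
  define T where "T n k = n * (U n k * (\<Delta> + 2) ^ L n k + 4 * W n k) + 2 * W n k
    + 100 * ((bits n + k + K + 1) * (bits n + k + K + 1)) + 2 * (c0 + c1)" for n k
  have "poly_bounded (\<lambda>n k. T n k + 3)"
    unfolding T_def U_def W_def \<beta>_def Q_def L_def by (intro poly_bounded_intros)
  then obtain c e where T: "\<And>n k. T n k + 3 \<le> c * (n + 2 ^ k) ^ e" unfolding poly_bounded_def by blast
  let ?P = "program c0 c1 K"
  have "is_fptas lam (\<lambda>G. is_hypergraph G \<and> max_degree G \<le> \<Delta>) (hardcore_Z lam) ?P"
    unfolding is_fptas_def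
  \<comment> \<open>The factor \<open>4 ^ e\<close> stems from
    \<open>2 ^ k \<le> 4 / eps\<close>.\<close>
  proof (rule exI[of _ "real c * 4 ^ e"], rule exI[of _ e], intro allI impI, elim conjE)
    fix G x eps acc
    assume hyp: "is_hypergraph G" "max_degree G \<le> \<Delta>" and enc: "encodes x G" and eps: "0 < eps" "eps < 1"
      and "approximates (acc Activity) lam" "approximates (acc Accuracy) eps"
    then have accA: "\<bar>real (acc Activity j) / 2 ^ j - lam\<bar> \<le> 1 / 2 ^ j"
      and accE: "\<bar>real (acc Accuracy j) / 2 ^ j - eps\<bar> \<le> 1 / 2 ^ j" for j
      by (auto simp: approximates_def)
    obtain n es where G: "verts G = {..<n}" "edges G = set ` set es" and es: "distinct (map set es)" "\<forall>e\<in>set es. distinct e"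
      and x: "x = Pair (Num n) (enc_edges es)"
      using enc unfolding encodes_def enc_edges_def enc_edge_def by blast
    have sub: "set e \<subseteq> {..<n}" if "e \<in> set es" for e
      using hyp(1) that unfolding is_hypergraph_def G by auto
    have deg: "\<forall>u. deg u es \<le> \<Delta>" using deg_le_max_degree[OF hyp(1) G(2) es(1)] hyp(2) order_trans by blast
    have valid: "valid_edges {..<n} es" using es(2) sub by (simp add: valid_edges_def)
    have sized: "sized n (\<Delta> * n + 1) es"
    proof -
      have "length e \<le> n" if "e \<in> set es" for e
        using es(2) that distinct_card[of e] card_mono[OF _ sub[OF that]] by simp
      moreover have "distinct es" using es(1) by (simp add: distinct_map)
      ultimately show ?thesis using length_edges_le[of es n \<Delta>] sub deg by (auto simp: sized_def)
    qed
    define k where "k = (LEAST j. 2 \<le> acc Accuracy j)"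
    have accE_le: "real (acc Accuracy j) \<le> 2 ^ j * eps + 1" and accE_ge: "2 ^ j * eps - 1 \<le> real (acc Accuracy j)" for j
      using accE[of j] by (auto simp: abs_le_iff field_simps)
    have accE_bound: "acc Accuracy j \<le> 2 ^ j + 1" for j
    proof -
      have "2 ^ j * eps \<le> 2 ^ j * 1" using eps by (intro mult_left_mono) auto
      then have "real (acc Accuracy j) \<le> 2 ^ j + 1" using accE_le[of j] by linarith
      then have "real (acc Accuracy j) \<le> real (2 ^ j + 1)" by simp
      then show ?thesis by (simp only: of_nat_le_iff)
    qed
    obtain j where j: "3 / eps < 2 ^ j" using real_arch_pow[of 2 "3 / eps"] by auto
    then have "2 \<le> acc Accuracy j" using accE_ge[of j] eps by (simp add: field_simps)
    then have k2: "2 \<le> acc Accuracy k" unfolding k_def by (rule LeastI)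
    have "1 \<le> 2 ^ k * eps" using accE_le[of k] k2 by simp
    then have k_eps: "1 / 2 ^ k \<le> eps" by (simp add: field_simps)
    have eps_k: "2 ^ k \<le> 4 / eps"
    proof (cases k)
      case 0
      then show ?thesis using eps by (simp add: field_simps)
    next
      case (Suc i)
      then have "\<not> 2 \<le> acc Accuracy i" using not_less_Least[of i "\<lambda>j. 2 \<le> acc Accuracy j"] by (simp add: k_def)
      then have "2 ^ i * eps \<le> 2" using accE_ge[of i] by simp
      then show ?thesis using eps Suc by (simp add: field_simps)
    qed
    define mk where "mk = bits n + k + K"
    define \<Lambda> :: "nat \<times> nat" where "\<Lambda> = (acc Activity mk, 2 ^ mk)"
    have quot\<Lambda>: "quot \<Lambda> = real (acc Activity mk) / 2 ^ mk" by (simp add: \<Lambda>_def)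
    have mkK: "1 / 2 ^ mk \<le> (1 / 2 :: real) ^ K"
      unfolding mk_def power_one_over by (intro divide_left_mono power_increasing) auto
    have close: "\<bar>quot \<Lambda> - lam\<bar> \<le> 1 / 2 ^ mk" unfolding quot\<Lambda> by (rule accA)
    have quot_bounds: "lam / 2 \<le> quot \<Lambda>" "quot \<Lambda> \<le> lam1"
      using close mkK K assms(2) by auto
    then have "0 < quot \<Lambda>" using assms(2) by simp
    then have pos\<Lambda>: "0 < fst \<Lambda>" "0 < snd \<Lambda>" by (auto simp: \<Lambda>_def intro: Nat.gr0I)
    have S: "fst \<Lambda> + snd \<Lambda> \<le> 2 ^ (mk + s)"
    proof -
      have "real (fst \<Lambda>) \<le> lam * 2 ^ mk + 1"
        using accA[of mk] by (simp add: \<Lambda>_def abs_le_iff field_simps)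
      then have "real (fst \<Lambda>) + real (snd \<Lambda>) \<le> lam * 2 ^ mk + 1 + 2 ^ mk" by (simp add: \<Lambda>_def)
      also have "\<dots> \<le> (lam + 2) * 2 ^ mk" by (simp add: algebra_simps)
      also have "\<dots> \<le> 2 ^ s * 2 ^ mk" using s by (intro mult_right_mono) auto
      finally have "real (fst \<Lambda> + snd \<Lambda>) \<le> real (2 ^ (mk + s))" by (simp add: power_add mult.commute)
      then show ?thesis by (simp only: of_nat_le_iff)
    qed
    interpret machine c0 c1 K acc \<Delta> n "\<Delta> * n + 1" "L n k" "fst \<Lambda> + snd \<Lambda>" "Q n" "\<beta> n k" "W n k" "U n k" \<Lambda>
    proof
      have "(fst \<Lambda> + snd \<Lambda>) ^ ((n + 1) * (\<Delta> + 2) ^ L n k) \<le> (2 ^ (mk + s)) ^ ((n + 1) * (\<Delta> + 2) ^ L n k)"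
        by (intro power_mono S) simp
      also have "\<dots> < 2 ^ \<beta> n k"
        unfolding \<beta>_def mk_def power_mult[symmetric] by simp
      finally show "bits ((fst \<Lambda> + snd \<Lambda>) ^ ((n + 1) * (\<Delta> + 2) ^ L n k)) \<le> \<beta> n k"
        by (intro floorlog_leI) auto
    qed (simp_all add: pos\<Lambda> Q_def W_def U_def)
    define p where "p = (if [] \<in> set es then (0, 1) else partition_value \<Lambda> n es (L n k))"
    have "computes ?P acc 0 x (enc_frac p) (T n k)"
      unfolding x p_def T_def
      by (rule computes_MAIN[OF sized deg accE_bound k_def k2 refl L_def]) (simp add: \<Lambda>_def mk_def)
    then have "evals ?P acc [x] (Call 0 (Var 0)) (enc_frac p) (1 + 1 + T n k)"
      by (rule evals_Call[OF evals_vars(1)])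
    then obtain t where t: "t \<le> 1 + 1 + T n k" "runs ?P acc x (enc_frac p) t"
      unfolding evals_def runs_def by blast
    have "t \<le> c * (n + 2 ^ k) ^ e" using t(1) T[of n k] by linarith
    then have "real t \<le> real (c * (n + 2 ^ k) ^ e)" by (simp only: of_nat_le_iff)
    also have "\<dots> = real c * (real n + 2 ^ k) ^ e" by simp
    also have "\<dots> \<le> real c * (4 * (real n + 1 / eps)) ^ e"
      using eps_k by (intro mult_left_mono power_mono) auto
    also have "\<dots> = real c * 4 ^ e * (real (card (verts G)) + 1 / eps) ^ e"
      by (simp only: G(1) card_lessThan power_mult_distrib mult.assoc)
    finally have time: "real t \<le> real c * 4 ^ e * (real (card (verts G)) + 1 / eps) ^ e" .
    have q: "0 < snd p"
      using partition_value_bounds[OF pos\<Lambda>(2) order_refl deg, of n "L n k"] by (simp add: p_def)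
    have Z: "hardcore_Z lam G = weight lam {..<n} es" by (rule hardcore_Z_eq_weight[OF G])
    have "within_accuracy eps (hardcore_Z lam G) (quot p)"
    proof (cases "[] \<in> set es")
      case True
      then show ?thesis by (simp add: Z weight_zero within_accuracy_def p_def)
    next
      case False
      let ?Z = "weight lam {..<n} es" and ?Z' = "weight (quot \<Lambda>) {..<n} es" and ?X = "quot p"
      have Zpos: "0 < ?Z" using False assms(2) by (intro weight_pos) auto
      have "L n k \<noteq> 0" using \<open>c0 \<noteq> 0\<close> c1(2) by (simp add: L_def)
      then obtain l where l: "L n k = Suc l" by (cases "L n k") auto
      have bn: "real n \<le> 2 ^ bits n" using less_two_power_bits[of n] by (metis less_imp_le of_nat_le_iff of_nat_numeral of_nat_power)
      have deg': "\<forall>u. deg u es \<le> \<Delta> - 1 + 1" using deg assms(1) by simp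
      have X: "0 < ?X" "\<bar>ln ?X - ln ?Z'\<bar> \<le> real n * (2 * real \<Delta> * C * \<alpha> ^ L n k)"
        using ln_partition_close[OF pos\<Lambda> quot_bounds(2) valid False deg', of l] assms(1) False
        by (auto simp: p_def l)
      note X(2)
      \<comment> \<open>In the depth, \<open>bits n\<close> cancels the factor \<open>n\<close> from
        telescoping, \<open>k\<close> yields the accuracy and \<open>c1\<close> the
        constants.\<close>
      also have "real n * (2 * real \<Delta> * C * \<alpha> ^ L n k) \<le> 2 ^ bits n * (2 * real \<Delta> * C * (1 / 2) ^ (bits n + k + c1))"
      proof (intro mult_mono bn)
        have "\<alpha> ^ L n k = (\<alpha> ^ c0) ^ (bits n + k + c1)" by (simp add: L_def power_mult)
        also have "\<dots> \<le> (1 / 2) ^ (bits n + k + c1)" using c0 \<alpha> by (intro power_mono) auto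
        finally show "\<alpha> ^ L n k \<le> (1 / 2) ^ (bits n + k + c1)" .
      qed (use C \<alpha> in auto)
      also have "\<dots> = (4 * real \<Delta> * C) / 2 ^ c1 * (1 / 2 ^ k / 2)"
        by (simp add: power_add power_one_over field_simps)
      also have "\<dots> \<le> 1 * (1 / 2 ^ k / 2)" using c1(1) by (intro mult_right_mono) auto
      finally have err1: "\<bar>ln ?X - ln ?Z'\<bar> \<le> 1 / 2 ^ k / 2" by simp
      have "\<bar>ln ?Z' - ln ?Z\<bar> \<le> real n * \<bar>ln (quot \<Lambda>) - ln lam\<bar>"
        using abs_ln_weight_diff_le[of "{..<n}" "quot \<Lambda>" lam es] \<open>0 < quot \<Lambda>\<close> assms(2) False by simp
      also have "\<dots> \<le> 2 ^ bits n * ((1 / 2 ^ mk) / (lam / 2))"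
      proof (intro mult_mono bn)
        have "\<bar>ln (quot \<Lambda>) - ln lam\<bar> \<le> \<bar>quot \<Lambda> - lam\<bar> / (lam / 2)"
          using assms(2) quot_bounds by (intro abs_ln_diff_le) auto
        also have "\<dots> \<le> (1 / 2 ^ mk) / (lam / 2)" using close assms(2) by (intro divide_right_mono) auto
        finally show "\<bar>ln (quot \<Lambda>) - ln lam\<bar> \<le> (1 / 2 ^ mk) / (lam / 2)" .
      qed auto
      also have "\<dots> = (1 / 2) ^ K / (lam / 4) * (1 / 2 ^ k / 2)"
        using assms(2) by (simp add: mk_def power_add power_one_over field_simps)
      also have "\<dots> \<le> 1 * (1 / 2 ^ k / 2)"
        using K assms(2) by (intro mult_right_mono) auto
      finally have err2: "\<bar>ln ?Z' - ln ?Z\<bar> \<le> 1 / 2 ^ k / 2" by simp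
      \<comment> \<open>Truncation and rounding of the activity each use half of
        \<open>1 / 2 ^ k\<close>, which is at most \<open>eps\<close>.\<close>
      have "\<bar>c - a\<bar> \<le> h'" if "\<bar>a - b\<bar> \<le> h / 2" "\<bar>b - c\<bar> \<le> h / 2" "h \<le> h'" for a b c h h' :: real
        using that by linarith
      from this[OF err1 err2 k_eps] have "\<bar>ln ?Z - ln ?X\<bar> \<le> eps" .
      moreover have "?Z / ?X = exp (ln ?Z - ln ?X)" using Zpos X by (simp add: exp_diff)
      ultimately show ?thesis using Zpos unfolding Z within_accuracy_def by auto
    qed
    then show "\<exists>p q t. runs ?P acc x (Pair (Num p) (Num q)) t \<and> q > 0 \<and>
        within_accuracy eps (hardcore_Z lam G) (real p / real q) \<and>
        real t \<le> real c * 4 ^ e * (real (card (verts G)) + 1 / eps) ^ e"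
      using t(2) q time unfolding enc_frac_def quot_def by blast
  qed
  then show ?thesis by blast
qed

end
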